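(* Let $d\ge2$ be an integer, let $\mu_d$ and $\mathsf G_d$ be as defined in the context, and set $$\alpha_d:=\frac{d^{1-d}\,\Gamma(d/2)}{2\,(d-1)\,\pi^{d/2}}.$$ Then for every $v\in\mathrm L^1(\mathbb R^d,d\mu_d)$ such that $\nabla v\in\mathrm L^2(\mathbb R^d,dx)$, $$\int_{\mathbb R^d}|v-\overline v|^2\,d\mu_d\le\alpha_d\int_{\mathbb R^d}\mathsf G_d(x,\nabla v(x))\,dx,\qquad\text{where}\quad\overline v=\int_{\mathbb R^d}v\,d\mu_d .$$
   Context: Let $|\cdot|$ be the Euclidean norm on $\mathbb R^d$, $\mathbb S^{d-1}$ the unit sphere of $\mathbb R^d$ and $|\mathbb S^{d-1}|$ its surface measure. Functions are real-valued and $\nabla v$ is the distributional gradient. The probability measure $\mu_d$ on $\mathbb R^d$ is $$d\mu_d(x):=\frac d{|\mathbb S^{d-1}|}\,\frac{dx}{\left(1+|x|^{\frac d{d-1}}\right)^d}.$$ For $X,Y\in\mathbb R^d$, $$\mathsf Q_d(X,Y):=\frac{d^2}{dt^2}\,|X+t\,Y|^d\Big|_{t=0}=d\,|X|^{d-4}\left[(d-2)\,(X\cdot Y)^2+|X|^2\,|Y|^2\right],$$ and for $(x,p)\in\mathbb R^d\times\mathbb R^d$, $$\mathsf G_d(x,p):=\mathsf Q_d\left(-\frac{d\,|x|^{-\frac{d-2}{d-1}}}{1+|x|^{\frac d{d-1}}}\,x,\ \frac{d-1}d\,p\right),$$ which is needed only for almost every $x$ (i.e. $x\ne0$). *)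

theory Defs
  imports "HOL-Analysis.Analysis"
begin

text \<open>
  Throughout, the dimension is \<open>d = CARD('n)\<close> and the underlying space is \<open>real ^ 'n\<close>.
\<close>

subsection \<open>Surface measure of the unit sphere and the reference probability measure\<close>

text \<open>
  The measure that polar coordinates induce on the unit sphere: \<open>d\<close> times the Lebesgue measure
  of the cone \<open>{r \<omega>. 0 < r \<le> 1, \<omega> \<in> E}\<close>, for \<open>E\<close> a subset of the sphere.
\<close>
definition sphere_measure :: "(real ^ 'n) set \<Rightarrow> real" where
  "sphere_measure E =
     real CARD('n) * measure lebesgue {r *\<^sub>R w | r w. 0 < r \<and> r \<le> 1 \<and> w \<in> E}"

definition onofri_measure :: "(real ^ 'n) measure" where
  "onofri_measure = density lebesgue (\<lambda>x. ennreal
     (real CARD('n) / sphere_measure (sphere (0 :: real ^ 'n) 1) *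
      (1 / (1 + norm x powr (real CARD('n) / (real CARD('n) - 1))) ^ CARD('n))))"


subsection \<open>Distributional gradients\<close>

text \<open>
  \<open>Ck_fun k f\<close>: \<open>f\<close> is of class \<open>C\<^sup>k\<close> on the whole space. Differentiability of \<open>f\<close> and
  continuity of its first \<open>k\<close> derivatives are expressed through iterated directional derivatives.
\<close>
primrec Ck_fun :: "nat \<Rightarrow> (real ^ 'n \<Rightarrow> real) \<Rightarrow> bool" where
  "Ck_fun 0 f \<longleftrightarrow> continuous_on UNIV f"
| "Ck_fun (Suc k) f \<longleftrightarrow>
     (\<forall>x. f differentiable (at x)) \<and> (\<forall>h. Ck_fun k (\<lambda>x. frechet_derivative f (at x) h))"

definition test_function :: "(real ^ 'n \<Rightarrow> real) \<Rightarrow> bool" where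
  "test_function f \<longleftrightarrow> (\<forall>k. Ck_fun k f) \<and> compact (closure {x. f x \<noteq> 0})"

text \<open>
  The distributional gradient of the locally integrable function \<open>v\<close> is (represented by) the locally
  integrable vector field \<open>g\<close>. Such a \<open>g\<close> is unique up to null sets.
\<close>
definition distributional_gradient ::
    "(real ^ 'n \<Rightarrow> real) \<Rightarrow> (real ^ 'n \<Rightarrow> real ^ 'n) \<Rightarrow> bool" where
  "distributional_gradient v g \<longleftrightarrow>
     (\<forall>K. compact K \<longrightarrow> v absolutely_integrable_on K) \<and>
     (\<forall>K. compact K \<longrightarrow> g absolutely_integrable_on K) \<and>
     (\<forall>f i. test_function f \<longrightarrow>
        (LINT x|lebesgue. v x * frechet_derivative f (at x) (axis i 1)) =
        - (LINT x|lebesgue. g x $ i * f x))"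

definition L2_field :: "(real ^ 'n \<Rightarrow> real ^ 'n) \<Rightarrow> bool" where
  "L2_field g \<longleftrightarrow>
     g \<in> borel_measurable lebesgue \<and> integrable lebesgue (\<lambda>x. (norm (g x))\<^sup>2)"


subsection \<open>The quadratic form in the gradient\<close>

definition Qform :: "real ^ 'n \<Rightarrow> real ^ 'n \<Rightarrow> real" where
  "Qform X Y = deriv (deriv (\<lambda>t. norm (X + t *\<^sub>R Y) ^ CARD('n))) 0"

definition Gform :: "real ^ 'n \<Rightarrow> real ^ 'n \<Rightarrow> real" where
  "Gform x p =
     (let d = real CARD('n) in
        Qform
          ((- (d * norm x powr (- ((d - 2) / (d - 1)))
                / (1 + norm x powr (d / (d - 1))))) *\<^sub>R x)
          (((d - 1) / d) *\<^sub>R p))"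

definition onofri_const :: "nat \<Rightarrow> real" where
  "onofri_const d =
     real d powr (1 - real d) * Gamma (real d / 2) /
       (2 * (real d - 1) * pi powr (real d / 2))"


subsection \<open>Closed forms\<close>

lemma Qform_eq:
  fixes X Y :: "real ^ 'n"
  assumes "X \<noteq> 0"
  shows "Qform X Y = real CARD('n) * norm X powi (int CARD('n) - 4) *
           ((real CARD('n) - 2) * (X \<bullet> Y)\<^sup>2 + (norm X)\<^sup>2 * (norm Y)\<^sup>2)"
proof -
  define a b c d where "a = (norm X)\<^sup>2" and "b = X \<bullet> Y" and "c = (norm Y)\<^sup>2"
    and "d = real CARD('n)"
  define q where "q = (\<lambda>t::real. a + 2 * t * b + t\<^sup>2 * c)"
  have a: "a > 0" using assms by (simp add: a_def)
  have q: "(norm (X + t *\<^sub>R Y))\<^sup>2 = q t" for t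
    unfolding q_def a_def b_def c_def power2_norm_eq_inner
    by (simp add: inner_add_left inner_add_right inner_commute power2_eq_square algebra_simps)
  have np: "norm (X + t *\<^sub>R Y) ^ CARD('n) = q t powr (d / 2)" if "q t > 0" for t
  proof -
    have n: "norm (X + t *\<^sub>R Y) = sqrt (q t)" by (simp flip: q)
    have "sqrt (q t) ^ CARD('n) = sqrt (q t) powr d"
      using that by (simp add: d_def powr_realpow)
    also have "\<dots> = q t powr (d / 2)"
      using that by (simp add: powr_half_sqrt[symmetric] powr_powr)
    finally show ?thesis by (simp add: n)
  qed
  define S where "S = {t. q t > 0}"
  have "open S" unfolding S_def q_def by (intro open_Collect_less continuous_intros)
  have 0: "0 \<in> S" using a by (simp add: S_def q_def)
  have D1: "((\<lambda>t. q t powr r) has_field_derivative r * q t powr (r - 1) * (2 * b + 2 * t * c)) (at t)"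
    if "t \<in> S" for t r
    using that unfolding S_def q_def by (auto intro!: derivative_eq_intros)
  have d1: "deriv (\<lambda>t. norm (X + t *\<^sub>R Y) ^ CARD('n)) t
      = d / 2 * q t powr (d / 2 - 1) * (2 * b + 2 * t * c)" if "t \<in> S" for t
  proof (rule DERIV_imp_deriv)
    show "((\<lambda>t. norm (X + t *\<^sub>R Y) ^ CARD('n)) has_field_derivative
        d / 2 * q t powr (d / 2 - 1) * (2 * b + 2 * t * c)) (at t)"
      by (rule has_field_derivative_transform_within_open[OF D1[OF that] \<open>open S\<close> that])
        (simp add: np S_def)
  qed
  have "((\<lambda>t. d / 2 * q t powr (d / 2 - 1) * (2 * b + 2 * t * c)) has_field_derivative
      d / 2 * ((d / 2 - 1) * q 0 powr (d / 2 - 1 - 1) * (2 * b + 2 * 0 * c)) * (2 * b + 2 * 0 * c)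
      + d / 2 * q 0 powr (d / 2 - 1) * (2 * c)) (at 0)"
    by (rule derivative_eq_intros D1[OF 0] refl | simp)+
  then have "Qform X Y = d / 2 * ((d / 2 - 1) * q 0 powr (d / 2 - 1 - 1) * (2 * b)) * (2 * b)
      + d / 2 * q 0 powr (d / 2 - 1) * (2 * c)"
    unfolding Qform_def
    using has_field_derivative_transform_within_open[OF _ \<open>open S\<close> 0 d1[symmetric]]
    by (subst DERIV_imp_deriv) simp_all
  also have "q 0 = a" by (simp add: q_def)
  also have "a powr (d / 2 - 1) = a powr (d / 2 - 1 - 1) * a"
    using a by (simp add: powr_diff power2_eq_square)
  also have "a powr (d / 2 - 1 - 1) = norm X powr (d - 4)"
  proof -
    have "a = norm X powr 2" using assms by (simp add: a_def)
    then show ?thesis by (simp only: powr_powr) (simp add: algebra_simps)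
  qed
  also have "norm X powr (d - 4) = norm X powi (int CARD('n) - 4)"
    using powr_real_of_int'[of "norm X" "int CARD('n) - 4"] assms by (simp add: d_def)
  finally show ?thesis
    by (simp add: a_def b_def c_def d_def power2_eq_square algebra_simps)
qed

lemma sphere_measure_unit_sphere:
  "sphere_measure (sphere (0 :: real ^ 'n) 1) =
     2 * pi powr (real CARD('n) / 2) / Gamma (real CARD('n) / 2)"
proof -
  let ?C = "{r *\<^sub>R w | r w. 0 < r \<and> r \<le> 1 \<and> w \<in> sphere (0 :: real ^ 'n) 1}"
  have "?C = cball 0 1 - {0}"
  proof (intro equalityI subsetI)
    fix x :: "real ^ 'n" assume "x \<in> cball 0 1 - {0}"
    then have "x = norm x *\<^sub>R sgn x \<and> 0 < norm x \<and> norm x \<le> 1 \<and> sgn x \<in> sphere 0 1"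
      by (simp add: sgn_div_norm)
    then show "x \<in> ?C" by blast
  qed auto
  moreover have "measure lebesgue (cball 0 1 - {0 :: real ^ 'n}) = unit_ball_vol (real CARD('n))"
    by (simp add: content_cball measure_Diff_null_set)
  moreover have "Gamma (real CARD('n) / 2 + 1) = real CARD('n) / 2 * Gamma (real CARD('n) / 2)"
    using nonpos_Ints_nonpos[of "real CARD('n) / 2"]
    by (intro Gamma_plus1) fastforce
  ultimately show ?thesis
    by (simp add: sphere_measure_def unit_ball_vol_def)
qed

end

theory Submission
  imports Defs
begin

text \<open>
  Write \<open>F v\<close> for the difference of the two sides. For a reflection \<open>s\<close> in a hyperplane through the
  origin, \<open>F\<close> splits orthogonally into its values at the even part \<open>(v + v \<circ> s) / 2\<close> and at the odd part
  \<open>(v - v \<circ> s) / 2\<close>. The odd part vanishes on the hyperplane; Wirtinger's inequality on circles bounds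
  its angular energy from below, and a ground state substitution along rays then gives \<open>F \<ge> 0\<close>. So
  \<open>F\<close> does not increase under averaging with a reflection. Iterated averages of a smooth function become
  almost constant on the sphere on which the radial eigenfunction vanishes, and for functions that are
  constant there a second ground state substitution along rays gives \<open>F \<ge> 0\<close>. The general case
  follows by mollification: the energy is controlled by Jensen's inequality, the variance by Fatou's lemma.
\<close>

subsection \<open>Inequalities on the line\<close>

text \<open>The two ground states come from the symmetries of
  \<open>ln (1 + norm x powr (d / (d - 1)))\<close>. Its derivative under dilations is, up to a
  factor, z = \<open>radial_z x\<close>; its derivative under translations in direction k is, up to
  a factor, \<open>x $ k / norm x\<close> times
  \<open>z powr (1 / d) * (1 - z) powr (1 - 1 / d)\<close>. After an additive constant in the first
  case, both are eigenfunctions for one and the same eigenvalue, which the constant in the theorem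
  turns into 1. So neither the odd nor the radial estimate can afford a loss. In the variable z the
  measure has density proportional to \<open>z ^ (d - 2)\<close>, hence z has mean
  \<open>(d - 1) / d\<close>; this value fixes the sphere on which the radial eigenfunction
  vanishes. Separation of variables is avoided: integration over the sphere is replaced by averages
  over dilations and rotations. Masses and energies are extended nonnegative reals and may be
  infinite, so nothing is subtracted: an arbitrary constant c stands in for the mean, and estimates
  travel back through the symmetrization in the form mass <= a * energy + k.\<close>

lemma nn_integral_Icc_continuous:
  fixes f :: "real \<Rightarrow> real"
  assumes "continuous_on {a..b} f" "\<And>t. t \<in> {a..b} \<Longrightarrow> 0 \<le> f t"
  shows "(\<integral>\<^sup>+t. ennreal (f t) * indicator {a..b} t \<partial>lborel) = ennreal (integral {a..b} f)"
  using assms by (intro nn_integral_has_integral_lebesgue' integrable_integral integrable_continuous_real) auto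

text \<open>The cosine of a slightly lower frequency is a ground state which is positive on the closed interval,
  so that no boundary terms with \<open>0 / 0\<close> appear.\<close>
lemma wirtinger:
  fixes f f' :: "real \<Rightarrow> real"
  assumes f: "\<And>t. (f has_real_derivative f' t) (at t)" and f': "continuous_on UNIV f'"
    and 0: "f a = 0" "f (a + pi) = 0"
  shows "integral {a..a+pi} (\<lambda>t. (f t)\<^sup>2) \<le> integral {a..a+pi} (\<lambda>t. (f' t)\<^sup>2)"
proof -
  have cf: "continuous_on S f" for S
    using f by (intro continuous_at_imp_continuous_on) (blast intro: DERIV_isCont)
  have cf': "continuous_on S f'" for S using f' continuous_on_subset by blast
  have *: "k * integral {a..a+pi} (\<lambda>t. (f t)\<^sup>2) \<le> integral {a..a+pi} (\<lambda>t. (f' t)\<^sup>2)"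
    if k: "0 < k" "k < 1" for k
  proof -
    define r where "r = sqrt k"
    have r: "0 < r" "r < 1" "r\<^sup>2 = k" using k by (auto simp: r_def)
    \<comment> \<open>\<open>p\<close> is the logarithmic derivative of
      \<open>cos (r * (t - (a + pi/2)))\<close>, hence the Riccati equation p' = -k - p^2.\<close>
    define p where "p t = - r * tan (r * (t - (a + pi/2)))" for t
    have pd: "(p has_real_derivative - k - (p t)\<^sup>2) (at t)" if t: "t \<in> {a..a+pi}" for t
    proof -
      have "\<bar>t - (a + pi/2)\<bar> \<le> pi/2" using t unfolding atLeastAtMost_iff abs_le_iff by linarith
      then have "\<bar>r * (t - (a + pi/2))\<bar> \<le> r * (pi/2)"
        using r unfolding abs_mult by (intro mult_mono) auto
      also have "\<dots> < pi/2" using r by simp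
      finally have "cos (r * (t - (a + pi/2))) > 0"
        by (intro cos_gt_zero_pi) auto
      then have c: "cos (r * (t - (a + pi/2))) \<noteq> 0" by simp
      have "(p has_real_derivative - r * (inverse ((cos (r * (t - (a + pi/2))))\<^sup>2) * r)) (at t)"
        unfolding p_def[abs_def] using c by (auto intro!: derivative_eq_intros)
      moreover have "- r * (inverse ((cos (r * (t - (a + pi/2))))\<^sup>2) * r) = - k - (p t)\<^sup>2"
        using c r unfolding p_def tan_sec[OF c, symmetric] power_inverse[symmetric]
        by (simp add: power_mult_distrib tan_sec[OF c, symmetric] flip: r(3) power_inverse)
           (simp add: algebra_simps power2_eq_square)
      ultimately show ?thesis by simp
    qed
    \<comment> \<open>The derivative of p * f^2. It integrates to 0 because f vanishes at both ends,
      and removing it from f'^2 - k * f^2 leaves a square.\<close>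
    let ?D = "\<lambda>t. (- k - (p t)\<^sup>2) * (f t)\<^sup>2 + p t * (2 * f t * f' t)"
    have "(?D has_integral (p (a+pi) * (f (a+pi))\<^sup>2 - p a * (f a)\<^sup>2)) {a..a+pi}"
    proof (rule fundamental_theorem_of_calculus)
      fix t assume t: "t \<in> {a..a+pi}"
      have "((\<lambda>t. p t * (f t)\<^sup>2) has_real_derivative ?D t) (at t)"
        by (auto intro!: derivative_eq_intros pd[OF t] f simp: power2_eq_square algebra_simps)
      then show "((\<lambda>t. p t * (f t)\<^sup>2) has_vector_derivative ?D t) (at t within {a..a+pi})"
        using has_real_derivative_iff_has_vector_derivative has_vector_derivative_at_within by blast
    qed simp
    then have D: "(?D has_integral 0) {a..a+pi}" using 0 by simp
    have i: "(\<lambda>t. (f t)\<^sup>2) integrable_on {a..a+pi}" "(\<lambda>t. (f' t)\<^sup>2) integrable_on {a..a+pi}"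
      by (intro integrable_continuous_real continuous_intros cf cf')+
    have "((\<lambda>t. (f' t)\<^sup>2 - k * (f t)\<^sup>2 - ?D t) has_integral
        (integral {a..a+pi} (\<lambda>t. (f' t)\<^sup>2) - k * integral {a..a+pi} (\<lambda>t. (f t)\<^sup>2) - 0)) {a..a+pi}"
      by (intro has_integral_diff D has_integral_mult_right integrable_integral i)
    then have "0 \<le> integral {a..a+pi} (\<lambda>t. (f' t)\<^sup>2) - k * integral {a..a+pi} (\<lambda>t. (f t)\<^sup>2) - 0"
    proof (rule has_integral_nonneg)
      fix t
      have "(f' t)\<^sup>2 - k * (f t)\<^sup>2 - ?D t = (f' t - p t * f t)\<^sup>2"
        by (simp add: power2_eq_square algebra_simps)
      then show "0 \<le> (f' t)\<^sup>2 - k * (f t)\<^sup>2 - ?D t" by simp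
    qed
    then show ?thesis by simp
  qed
  show ?thesis by (rule field_le_mult_one_interval) (rule *)
qed

text \<open>The zeros are antipodal: they cut the circle into two arcs of length pi, and by
  periodicity f vanishes at both ends of each.\<close>

lemma wirtinger_circle:
  fixes f f' :: "real \<Rightarrow> real"
  assumes f: "\<And>t. (f has_real_derivative f' t) (at t)" and f': "continuous_on UNIV f'"
    and per: "\<And>t. f (t + 2 * pi) = f t" "\<And>t. f' (t + 2 * pi) = f' t"
    and 0: "f a = 0" "f (a + pi) = 0"
  shows "integral {a..a+2*pi} (\<lambda>t. (f t)\<^sup>2) \<le> integral {a..a+2*pi} (\<lambda>t. (f' t)\<^sup>2)"
proof -
  have cf: "continuous_on S f" for S
    using f by (intro continuous_at_imp_continuous_on) (blast intro: DERIV_isCont)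
  have cf': "continuous_on S f'" for S using f' continuous_on_subset by blast
  have "f (a + pi + pi) = 0" using per(1)[of a] 0 by (simp add: algebra_simps)
  note w = wirtinger[OF f f' 0] wirtinger[OF f f' 0(2) this]
  have s: "integral {a..a+2*pi} h = integral {a..a+pi} h + integral {a+pi..a+pi+pi} h"
    if "continuous_on UNIV h" for h :: "real \<Rightarrow> real"
    using Henstock_Kurzweil_Integration.integral_combine[of a "a+pi" "a+2*pi" h]
    by (simp add: integrable_continuous_real continuous_on_subset[OF that] add.commute)
  show ?thesis
    using w by (subst (1 2) s) (auto intro!: continuous_intros cf cf')
qed

lemma integral_periodic_shift:
  fixes h :: "real \<Rightarrow> real"
  assumes h: "continuous_on UNIV h" and per: "\<And>t. h (t + p) = h t" and a: "0 \<le> a" "a \<le> p"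
  shows "integral {a..a+p} h = integral {0..p} h"
proof -
  have i: "h integrable_on {u..v}" for u v
    by (intro integrable_continuous_real continuous_on_subset[OF h]) auto
  have "integral {a..a+p} h = integral {a..p} h + integral {p..a+p} h"
    using a i by (subst Henstock_Kurzweil_Integration.integral_combine) auto
  also have "integral {p..a+p} h = integral {0..a} (\<lambda>t. h (t + p))"
    using integral_shift[where a=0 and b=a and f=h and c=p] continuous_on_subset[OF h] by (simp add: o_def)
  also have "integral {a..p} h + \<dots> = integral {0..p} h"
    using a i unfolding per by (subst Henstock_Kurzweil_Integration.integral_combine[symmetric, of 0 a p]) auto
  finally show ?thesis .
qed

text \<open>Made for inequalities on [a, b] with boundary terms: the endpoints may be chosen far out
  at places where these terms are small. Monotone convergence in m then gives the whole
  line.\<close>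

lemma nn_integral_le_from_intervals:
  fixes A B :: "real \<Rightarrow> real"
  assumes c: "continuous_on UNIV A" "continuous_on UNIV B" and nn: "\<And>t. 0 \<le> A t" "\<And>t. 0 \<le> B t"
    and le: "\<And>(m::real) e. 0 \<le> m \<Longrightarrow> 0 < e \<Longrightarrow> \<exists>a b. a \<le> - m \<and> m \<le> b \<and> integral {a..b} B \<le> integral {a..b} A + e"
  shows "(\<integral>\<^sup>+t. ennreal (B t) \<partial>lborel) \<le> (\<integral>\<^sup>+t. ennreal (A t) \<partial>lborel)"
proof -
  have [measurable]: "A \<in> borel_measurable borel" "B \<in> borel_measurable borel"
    using c by (auto intro: borel_measurable_continuous_onI)
  have m: "(\<integral>\<^sup>+t. ennreal (B t) * indicator {-m..m} t \<partial>lborel) \<le> (\<integral>\<^sup>+t. ennreal (A t) \<partial>lborel)"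
    if "0 \<le> m" for m
  proof (rule ennreal_le_epsilon)
    fix e :: real assume "0 < e"
    from le[OF that this] obtain a b where ab: "a \<le> -m" "m \<le> b"
      "integral {a..b} B \<le> integral {a..b} A + e" by blast
    have "(\<integral>\<^sup>+t. ennreal (B t) * indicator {-m..m} t \<partial>lborel) \<le> (\<integral>\<^sup>+t. ennreal (B t) * indicator {a..b} t \<partial>lborel)"
      using ab by (intro nn_integral_mono) (auto simp: indicator_def)
    also have "\<dots> = ennreal (integral {a..b} B)"
      using c nn by (intro nn_integral_Icc_continuous) (auto intro: continuous_on_subset)
    also have "\<dots> \<le> ennreal (integral {a..b} A + e)" using ab by (intro ennreal_leI) auto
    also have "\<dots> = ennreal (integral {a..b} A) + ennreal e"
      using \<open>0 < e\<close> c nn by (intro ennreal_plus Henstock_Kurzweil_Integration.integral_nonneg)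
        (auto intro: integrable_continuous_real continuous_on_subset)
    also have "ennreal (integral {a..b} A) = (\<integral>\<^sup>+t. ennreal (A t) * indicator {a..b} t \<partial>lborel)"
      using c nn by (intro nn_integral_Icc_continuous[symmetric]) (auto intro: continuous_on_subset)
    also have "\<dots> \<le> (\<integral>\<^sup>+t. ennreal (A t) \<partial>lborel)"
      by (intro nn_integral_mono) (auto simp: indicator_def)
    finally show "(\<integral>\<^sup>+t. ennreal (B t) * indicator {-m..m} t \<partial>lborel) \<le> (\<integral>\<^sup>+t. ennreal (A t) \<partial>lborel) + ennreal e"
      by (simp add: add_right_mono)
  qed
  have "(\<integral>\<^sup>+t. ennreal (B t) \<partial>lborel) = (\<integral>\<^sup>+t. (SUP n. ennreal (B t) * indicator {-real n..real n} t) \<partial>lborel)"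
  proof (intro nn_integral_cong antisym)
    fix t
    obtain n where "\<bar>t\<bar> \<le> real n" using real_arch_simple by blast
    then have "ennreal (B t) = ennreal (B t) * indicator {-real n..real n} t" by (auto simp: indicator_def)
    also have "\<dots> \<le> (SUP n. ennreal (B t) * indicator {-real n..real n} t)" by (rule SUP_upper) simp
    finally show "ennreal (B t) \<le> (SUP n. ennreal (B t) * indicator {-real n..real n} t)" .
    show "(SUP n. ennreal (B t) * indicator {-real n..real n} t) \<le> ennreal (B t)"
      by (intro SUP_least) (auto simp: indicator_def)
  qed
  also have "\<dots> = (SUP n. \<integral>\<^sup>+t. ennreal (B t) * indicator {-real n..real n} t \<partial>lborel)"
    by (intro nn_integral_monotone_convergence_SUP) (auto simp: incseq_def le_fun_def indicator_def)
  also have "\<dots> \<le> (\<integral>\<^sup>+t. ennreal (A t) \<partial>lborel)" by (intro SUP_least m) simp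
  finally show ?thesis .
qed

section \<open>The logistic function and ground state substitutions\<close>

definition logistic :: "real \<Rightarrow> real" where "logistic t = 1 / (1 + exp (- t))"

lemma logistic_bounds: "0 < logistic t" "logistic t < 1"
  by (simp_all add: logistic_def add_pos_pos)

lemma logistic_deriv: "(logistic has_real_derivative logistic t * (1 - logistic t)) (at t)"
proof -
  have p: "1 + exp (-t) \<noteq> 0" using exp_gt_zero[of "-t"] by linarith
  have "(logistic has_real_derivative exp (-t) / (1 + exp (-t))^2) (at t)"
    unfolding logistic_def[abs_def] using p
    by (auto intro!: derivative_eq_intros simp: power2_eq_square)
  moreover have "exp (-t) / (1 + exp (-t))^2 = logistic t * (1 - logistic t)"
    using p unfolding logistic_def by (simp add: divide_simps power2_eq_square)
  ultimately show ?thesis by simp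
qed

lemma isCont_logistic: "isCont logistic t"
  using logistic_deriv DERIV_isCont by blast

lemma continuous_logistic [continuous_intros]: "continuous_on S logistic"
  using isCont_logistic by (simp add: continuous_at_imp_continuous_on)

lemma strict_mono_logistic: "strict_mono logistic"
  unfolding strict_mono_def logistic_def
  by (auto intro!: divide_strict_left_mono simp: add_pos_pos)

lemma DERIV_logistic_power:
  "((\<lambda>t. logistic t ^ n) has_real_derivative real n * logistic t ^ n * (1 - logistic t)) (at t)"
proof (cases n)
  case (Suc k)
  show ?thesis unfolding Suc
    by (rule derivative_eq_intros logistic_deriv refl)+ (simp add: algebra_simps)
qed simp

text \<open>The common core of both substitutions. A is the energy density, B the mass density, P =
  weight * p * f^2 with p the logarithmic derivative of the ground state, and R = weight * (f' - p *
  f)^2. The exceptional point s, where only continuity of P is asked, is the zero of the radial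
  ground state.\<close>

lemma ground_state_interval:
  fixes A B P R :: "real \<Rightarrow> real"
  assumes c: "continuous_on UNIV A" "continuous_on UNIV B" and P: "\<And>t. isCont P t"
    and D: "\<And>t. t \<noteq> s \<Longrightarrow> (P has_real_derivative A t - B t - R t) (at t)"
    and R: "\<And>t. t \<noteq> s \<Longrightarrow> 0 \<le> R t" and ab: "a \<le> b"
  shows "integral {a..b} B \<le> integral {a..b} A - (P b - P a)"
proof -
  let ?I = "integral {a..b} A - integral {a..b} B - (P b - P a)"
  have i: "(A has_integral integral {a..b} A) {a..b}" "(B has_integral integral {a..b} B) {a..b}"
    using c by (auto intro!: integrable_integral integrable_continuous_real intro: continuous_on_subset)
  have "((\<lambda>t. A t - B t - R t) has_integral (P b - P a)) {a..b}"
    using P ab D by (intro fundamental_theorem_of_calculus_interior_strong[of "{s}"])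
      (auto intro: continuous_at_imp_continuous_on simp flip: has_real_derivative_iff_has_vector_derivative)
  from has_integral_diff[OF has_integral_diff[OF i] this]
  have "((\<lambda>t. A t - B t - (A t - B t - R t)) has_integral ?I) {a..b}" .
  then have "((\<lambda>t. if t = s then 0 else R t) has_integral ?I) {a..b}"
    by (rule has_integral_spike_finite[of "{s}", rotated 2]) auto
  then have "0 \<le> ?I" by (rule has_integral_nonneg) (simp add: R)
  then show ?thesis by simp
qed

text \<open>Below, \<open>p\<close> is the logarithmic derivative of the ground state
  \<open>logistic powr (1 / d) * (1 - logistic) powr (1 - 1 / d)\<close>.\<close>
lemma line_inequality_odd:
  fixes f f' :: "real \<Rightarrow> real" and d :: real
  assumes f: "\<And>t. (f has_real_derivative f' t) (at t)" and f': "continuous_on UNIV f'"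
    and d: "d = real n + 2"
  shows "(\<integral>\<^sup>+t. ennreal (d * logistic t ^ Suc n * (1 - logistic t) * (f t)\<^sup>2) \<partial>lborel)
    \<le> (\<integral>\<^sup>+t. ennreal (logistic t ^ n * ((f' t)\<^sup>2 + ((d - 1) / d)\<^sup>2 * (f t)\<^sup>2)) \<partial>lborel)"
proof -
  define A where "A t = logistic t ^ n * ((f' t)\<^sup>2 + ((d - 1) / d)\<^sup>2 * (f t)\<^sup>2)" for t
  define B where "B t = d * logistic t ^ Suc n * (1 - logistic t) * (f t)\<^sup>2" for t
  define p where "p t = 1 / d - logistic t" for t
  define P where "P t = logistic t ^ n * p t * (f t)\<^sup>2" for t
  have d0: "d \<ge> 2" using d by simp
  have cf: "continuous_on S f" for S
    using f by (intro continuous_at_imp_continuous_on) (blast intro: DERIV_isCont)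
  have cf': "continuous_on S f'" for S using f' continuous_on_subset by blast
  have cA: "continuous_on S A" for S unfolding A_def by (intro continuous_intros cf cf')
  have cB: "continuous_on S B" for S unfolding B_def by (intro continuous_intros cf cf')
  have A0: "0 \<le> A t" for t using logistic_bounds[of t] by (simp add: A_def)
  have B0: "0 \<le> B t" for t using logistic_bounds[of t] d0 by (simp add: B_def)
  let ?R = "\<lambda>t. logistic t ^ n * (f' t - p t * f t)\<^sup>2"
  have R0: "0 \<le> ?R t" for t using logistic_bounds[of t] by simp
  let ?D = "\<lambda>t. (real n * logistic t ^ n * (1 - logistic t) * p t - logistic t ^ n * (logistic t * (1 - logistic t))) * (f t)\<^sup>2
      + logistic t ^ n * p t * (2 * f t * f' t)"
  have PD: "(P has_real_derivative ?D t) (at t)" for t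
    unfolding P_def[abs_def] p_def
    by (rule derivative_eq_intros DERIV_logistic_power logistic_deriv f refl)+
       (simp add: algebra_simps power2_eq_square)
  have key: "?D t = A t - B t - ?R t" for t
  proof -
    \<comment> \<open>The eigenvalue equation of the ground state in Riccati form, divided by
      \<open>logistic t ^ n\<close>; the derivative of p is -
      \<open>logistic t * (1 - logistic t)\<close>.\<close>
    have "((d - 1) / d)\<^sup>2 - d * logistic t * (1 - logistic t)
       - (real n * (1 - logistic t) * p t - logistic t * (1 - logistic t)) - (p t)\<^sup>2 = 0"
      using d0 unfolding p_def d by (simp add: divide_simps) (simp add: power2_eq_square algebra_simps)
    then have "((d - 1) / d)\<^sup>2 = d * logistic t * (1 - logistic t)
       + (real n * (1 - logistic t) * p t - logistic t * (1 - logistic t)) + (p t)\<^sup>2" by simp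
    then show ?thesis unfolding A_def B_def
      by (simp only:) (simp add: power2_eq_square algebra_simps)
  qed
  have seg: "integral {a..b} B \<le> integral {a..b} A - (P b - P a)" if "a \<le> b" for a b
    by (rule ground_state_interval[OF cA cB DERIV_isCont[OF PD] PD[unfolded key] R0 that])
  \<comment> \<open>The boundary terms are dominated by the energy density itself, with factor 4
    because \<open>((d - 1) / d)^2 >= 1/4\<close> for d >= 2. They are therefore small wherever A is
    small.\<close>
  have PA: "\<bar>P t\<bar> \<le> 4 * A t" for t
  proof -
    have "0 \<le> 1 / d" "1 / d \<le> 1" using d0 by auto
    then have "\<bar>p t\<bar> \<le> 1" using logistic_bounds[of t] d0 unfolding p_def abs_le_iff by linarith
    then have "\<bar>P t\<bar> \<le> logistic t ^ n * 1 * (f t)\<^sup>2"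
      unfolding P_def abs_mult using logistic_bounds[of t] by (intro mult_mono) auto
    moreover have "4 * ((d-1)/d)\<^sup>2 \<ge> 1"
    proof -
      have "1/2 \<le> (d-1)/d" using d0 by (simp add: field_simps)
      then have "(1/2)\<^sup>2 \<le> ((d-1)/d)\<^sup>2" by (intro power_mono) auto
      moreover have "(1/2 :: real)\<^sup>2 = 1/4" by (simp add: power2_eq_square)
      ultimately show ?thesis by linarith
    qed
    then have "1 * (f t)\<^sup>2 \<le> (4 * ((d-1)/d)\<^sup>2) * (f t)\<^sup>2" by (intro mult_right_mono) auto
    then have "(f t)\<^sup>2 \<le> 4 * ((f' t)\<^sup>2 + ((d - 1) / d)\<^sup>2 * (f t)\<^sup>2)"
      using zero_le_power2[of "f' t"] by argo
    then have "logistic t ^ n * (f t)\<^sup>2 \<le> logistic t ^ n * (4 * ((f' t)\<^sup>2 + ((d - 1) / d)\<^sup>2 * (f t)\<^sup>2))"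
      using logistic_bounds[of t] by (intro mult_left_mono) auto
    ultimately show ?thesis unfolding A_def mult.left_commute[of _ 4] by linarith
  qed
  show ?thesis
  proof (cases "(\<integral>\<^sup>+t. ennreal (A t) \<partial>lborel) = \<infinity>")
    case True
    then show ?thesis by (simp add: A_def)
  next
    case False
    have [measurable]: "A \<in> borel_measurable borel" using cA by (intro borel_measurable_continuous_onI)
    \<comment> \<open>A half-line has infinite measure, so a function with finite integral cannot
      stay above e on it.\<close>
    have ex: "\<exists>t\<in>{u..}. A t < e" "\<exists>t\<in>{..u}. A t < e" if "0 < e" for u e
    proof -
      have *: "\<exists>t\<in>T. A t < e" if "emeasure lborel T = \<infinity>" "T \<in> sets borel" for T
      proof (rule ccontr)
        assume "\<not> (\<exists>t\<in>T. A t < e)"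
        then have "ennreal e * indicator T t \<le> ennreal (A t)" for t
          by (auto simp: indicator_def not_less intro: ennreal_leI)
        then have "(\<integral>\<^sup>+t. ennreal e * indicator T t \<partial>lborel) \<le> (\<integral>\<^sup>+t. ennreal (A t) \<partial>lborel)"
          by (intro nn_integral_mono)
        then show False using that False \<open>0 < e\<close>
          by (simp add: nn_integral_cmult ennreal_mult_top top_unique)
      qed
      have inf: "emeasure lborel T = \<infinity>" if T: "\<And>m::nat. {v m..v m + real m} \<subseteq> T" "T \<in> sets borel" for T v
      proof -
        have "of_nat m \<le> emeasure lborel T" for m
          using emeasure_mono[OF T(1)[of m], of lborel] T(2) by (simp flip: ennreal_of_nat_eq_real_of_nat)
        then have "(SUP m. of_nat m) \<le> emeasure lborel T" by (intro SUP_least) auto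
        then show ?thesis by (simp add: ennreal_SUP_of_nat_eq_top top_unique)
      qed
      have 1: "emeasure lborel {u..} = \<infinity>" by (rule inf[of "\<lambda>_. u"]) auto
      have 2: "emeasure lborel {..u} = \<infinity>" by (rule inf[of "\<lambda>m. u - real m"]) auto
      show "\<exists>t\<in>{u..}. A t < e" "\<exists>t\<in>{..u}. A t < e" by (intro * 1 2; simp)+
    qed
    show ?thesis
      unfolding A_def[symmetric] B_def[symmetric]
    proof (rule nn_integral_le_from_intervals[OF cA cB A0 B0])
      fix m e :: real assume "0 \<le> m" "0 < e"
      obtain b where b: "b \<ge> m" "A b < e/8" using ex(1)[of "e/8" m] \<open>0 < e\<close> by auto
      obtain a where a: "a \<le> -m" "A a < e/8" using ex(2)[of "e/8" "-m"] \<open>0 < e\<close> by auto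
      \<comment> \<open>Each of the two boundary terms is at most 4 * (e/8) in absolute
        value.\<close>
      have "integral {a..b} B \<le> integral {a..b} A + e"
        using seg[of a b] PA[of a] PA[of b] a b \<open>0 \<le> m\<close> by linarith
      with a b show "\<exists>a b. a \<le> - m \<and> m \<le> b \<and> integral {a..b} B \<le> integral {a..b} A + e" by blast
    qed
  qed
qed

text \<open>Here \<open>p\<close> is the logarithmic derivative of \<open>logistic s - logistic t\<close>, and \<open>p s = 0\<close> is the value of
  a division by zero. It is harmless, since \<open>P\<close> tends to \<open>0\<close> at \<open>s\<close>.\<close>
lemma line_inequality_radial:
  fixes f f' :: "real \<Rightarrow> real" and d :: real
  assumes f: "\<And>t. (f has_real_derivative f' t) (at t)" and f': "continuous_on UNIV f'"
    and d: "d = real n + 2" and s: "logistic s = (d - 1) / d" and fs: "f s = 0"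
  shows "(\<integral>\<^sup>+t. ennreal (d * logistic t ^ Suc n * (1 - logistic t) * (f t)\<^sup>2) \<partial>lborel)
    \<le> (\<integral>\<^sup>+t. ennreal (logistic t ^ n * (f' t)\<^sup>2) \<partial>lborel)"
proof -
  define A where "A t = logistic t ^ n * (f' t)\<^sup>2" for t
  define B where "B t = d * logistic t ^ Suc n * (1 - logistic t) * (f t)\<^sup>2" for t
  define p where "p t = logistic t * (1 - logistic t) / (logistic t - logistic s)" for t
  define P where "P t = logistic t ^ n * p t * (f t)\<^sup>2" for t
  have d0: "d \<ge> 2" using d by simp
  have df: "isCont f t" for t using f DERIV_isCont by blast
  have cf: "continuous_on S f" for S
    using df by (intro continuous_at_imp_continuous_on) blast
  have cf': "continuous_on S f'" for S using f' continuous_on_subset by blast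
  have cA: "continuous_on S A" for S unfolding A_def by (intro continuous_intros cf cf')
  have cB: "continuous_on S B" for S unfolding B_def by (intro continuous_intros cf cf')
  have A0: "0 \<le> A t" for t using logistic_bounds[of t] by (simp add: A_def)
  have B0: "0 \<le> B t" for t using logistic_bounds[of t] d0 by (simp add: B_def)
  have ne: "logistic t - logistic s \<noteq> 0" if "t \<noteq> s" for t
    using strict_mono_eq[OF strict_mono_logistic] that by auto
  let ?R = "\<lambda>t. logistic t ^ n * (f' t - p t * f t)\<^sup>2"
  have R0: "0 \<le> ?R t" for t using logistic_bounds[of t] by simp
  let ?D = "\<lambda>t. (real n * logistic t ^ n * (1 - logistic t) * p t
      + logistic t ^ n * (p t * (1 - 2 * logistic t) - (p t)\<^sup>2)) * (f t)\<^sup>2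
      + logistic t ^ n * p t * (2 * f t * f' t)"
  \<comment> \<open>Write p = psi' / psi with psi = logistic - \<open>logistic s\<close>; then psi''
    = psi' * (1 - 2 * logistic), and p' = psi'' / psi - p^2.\<close>
  have pD: "(p has_real_derivative p t * (1 - 2 * logistic t) - (p t)\<^sup>2) (at t)" if "t \<noteq> s" for t
  proof -
    have "(p has_real_derivative
        ((logistic t * (1 - logistic t) * (1 - logistic t) + (0 - logistic t * (1 - logistic t)) * logistic t) * (logistic t - logistic s)
         - logistic t * (1 - logistic t) * (logistic t * (1 - logistic t) - 0)) / ((logistic t - logistic s) * (logistic t - logistic s))) (at t)"
      unfolding p_def[abs_def] by (rule derivative_eq_intros logistic_deriv refl ne[OF that])+
    moreover have "((z * (1 - z) * (1 - z) + (0 - z * (1 - z)) * z) * (z - c) - z * (1 - z) * (z * (1 - z) - 0)) / ((z - c) * (z - c))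
        = z * (1 - z) / (z - c) * (1 - 2 * z) - (z * (1 - z) / (z - c))\<^sup>2" if "z - c \<noteq> 0" for z c :: real
      using that by (simp add: divide_simps) (simp add: algebra_simps power2_eq_square)
    ultimately show ?thesis using ne[OF that] by (simp add: p_def)
  qed
  have PD: "(P has_real_derivative ?D t) (at t)" if "t \<noteq> s" for t
    unfolding P_def[abs_def]
    by (rule derivative_eq_intros DERIV_logistic_power pD f refl that)+
       (simp add: algebra_simps power2_eq_square)
  have key: "?D t = A t - B t - ?R t" if "t \<noteq> s" for t
  proof -
    have "p t * (logistic t - logistic s) = logistic t * (1 - logistic t)" using ne[OF that] by (simp add: p_def)
    then have "p t * (d * logistic t - (d - 1)) = d * logistic t * (1 - logistic t)"
      unfolding s using d0 by (simp add: field_simps)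
    \<comment> \<open>The eigenvalue equation of logistic - \<open>logistic s\<close> in Riccati
      form. It holds for this value of \<open>logistic s\<close> only.\<close>
    then have e: "d * logistic t * (1 - logistic t)
       + (real n * (1 - logistic t) * p t + (p t * (1 - 2 * logistic t) - (p t)\<^sup>2)) + (p t)\<^sup>2 = 0"
      unfolding d by (simp add: algebra_simps)
    have "A t - B t - ?D t - logistic t ^ n * (f' t - p t * f t)\<^sup>2 = - (logistic t ^ n * (f t)\<^sup>2 * (d * logistic t * (1 - logistic t)
       + (real n * (1 - logistic t) * p t + (p t * (1 - 2 * logistic t) - (p t)\<^sup>2)) + (p t)\<^sup>2))"
      unfolding A_def B_def by (simp add: power2_eq_square algebra_simps)
    then show ?thesis unfolding e by linarith
  qed
  have cP: "isCont P t" for t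
  proof (cases "t = s")
    case False then show ?thesis using PD DERIV_isCont by blast
  next
    case True
    \<comment> \<open>Near s, P is a continuous factor times f times a quotient of two difference
      quotients. The quotient converges, and f tends to \<open>f s = 0\<close>.\<close>
    have l: "((\<lambda>t. (f t - f s) / (t - s)) \<longlongrightarrow> f' s) (at s)"
      "((\<lambda>t. (logistic t - logistic s) / (t - s)) \<longlongrightarrow> logistic s * (1 - logistic s)) (at s)"
      using f[of s] logistic_deriv[of s] by (simp_all add: has_field_derivative_iff)
    have "((\<lambda>t. logistic t ^ n * (logistic t * (1 - logistic t)) * f t *
        (((f t - f s) / (t - s)) / ((logistic t - logistic s) / (t - s)))) \<longlongrightarrow>
        logistic s ^ n * (logistic s * (1 - logistic s)) * f s * (f' s / (logistic s * (1 - logistic s)))) (at s)"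
      using logistic_bounds[of s] df[of s] isCont_logistic[of s] unfolding isCont_def
      by (intro tendsto_intros l) auto
    then have "(P \<longlongrightarrow> 0) (at s)"
      unfolding fs mult_zero_right mult_zero_left
      by (rule Lim_transform_eventually)
         (auto simp: eventually_at_filter P_def p_def fs power2_eq_square intro!: always_eventually)
    then show ?thesis unfolding True isCont_def by (simp add: P_def fs)
  qed
  \<comment> \<open>Once s lies in [a, b], both boundary terms have the favourable sign: p is
    nonnegative to the right of s and nonpositive to the left.\<close>
  have seg: "integral {a..b} B \<le> integral {a..b} A" if "a \<le> s" "s \<le> b" for a b
  proof -
    have PD': "(P has_real_derivative A t - B t - ?R t) (at t)" if "t \<noteq> s" for t
      using PD[OF that] unfolding key[OF that] .
    have "integral {a..b} B \<le> integral {a..b} A - (P b - P a)"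
      using that by (intro ground_state_interval[OF cA cB cP PD' R0]) auto
    moreover have "0 \<le> P b"
      unfolding P_def p_def using logistic_bounds[of b] strict_mono_less_eq[OF strict_mono_logistic, of s b] that by (simp add: less_imp_le)
    moreover have "P a \<le> 0"
    proof -
      have "p a \<le> 0" unfolding p_def using logistic_bounds[of a] strict_mono_less_eq[OF strict_mono_logistic, of a s] that
        by (intro divide_nonneg_nonpos) auto
      then show ?thesis unfolding P_def using logistic_bounds[of a]
        by (simp add: mult_nonneg_nonpos mult_nonpos_nonneg)
    qed
    ultimately show ?thesis by simp
  qed
  show ?thesis
    unfolding A_def[symmetric] B_def[symmetric]
  proof (rule nn_integral_le_from_intervals[OF cA cB A0 B0])
    fix m e :: real assume "0 \<le> m" "0 < e"
    define b where "b = max m s" define a where "a = min (-m) s"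
    show "\<exists>a b. a \<le> - m \<and> m \<le> b \<and> integral {a..b} B \<le> integral {a..b} A + e"
      using seg[of a b] \<open>0 < e\<close> by (intro exI[of _ a] exI[of _ b]) (auto simp: a_def b_def)
  qed
qed

subsection \<open>Orthogonal maps, dilations and rotations\<close>

lemma nn_integral_translate:
  fixes h :: "'a::euclidean_space \<Rightarrow> ennreal"
  assumes [measurable]: "h \<in> borel_measurable borel"
  shows "(\<integral>\<^sup>+x. h (c + x) \<partial>lborel) = (\<integral>\<^sup>+x. h x \<partial>lborel)"
proof -
  have "(\<integral>\<^sup>+x. h x \<partial>lborel) = (\<integral>\<^sup>+x. h x \<partial>distr lborel borel ((+) c))" by (simp only: lborel_distr_plus)
  then show ?thesis by (simp add: nn_integral_distr)
qed

text \<open>A translation-invariant measure which agrees with Lebesgue measure on the unit ball is Lebesgue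
  measure: integrate \<open>indicator (ball 0 1) y * f (x + y)\<close> in both orders.\<close>
lemma nn_integral_orthogonal:
  fixes T :: "'a::euclidean_space \<Rightarrow> 'a"
  assumes T: "orthogonal_transformation T" and f[measurable]: "f \<in> borel_measurable borel"
  shows "(\<integral>\<^sup>+x. f (T x) \<partial>lborel) = (\<integral>\<^sup>+x. f x \<partial>lborel)"
proof -
  have l: "linear T" using T by (rule orthogonal_transformation_linear)
  have [measurable]: "T \<in> borel \<rightarrow>\<^sub>M borel"
    using l by (intro borel_measurable_continuous_onI linear_continuous_on) (simp add: linear_conv_bounded_linear)
  have nT: "norm (T x) = norm x" for x using T by (rule orthogonal_transformation_norm)
  obtain S where S: "\<And>x. T (S x) = x"
    using orthogonal_transformation_surj[OF T] by (metis surj_f_inv_f)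
  define h :: "'a \<Rightarrow> ennreal" where "h = indicator (ball 0 1)"
  have [measurable]: "h \<in> borel_measurable borel" unfolding h_def by (intro borel_measurable_indicator) simp
  define I where "I = (\<integral>\<^sup>+y. h y \<partial>lborel)"
  have I: "I \<noteq> 0" "I \<noteq> \<infinity>"
    using emeasure_lborel_ball_finite[of "0::'a" 1] content_ball_pos[of 1 "0::'a"]
    by (auto simp: I_def h_def measure_def)
  have "I * (\<integral>\<^sup>+x. f (T x) \<partial>lborel) = (\<integral>\<^sup>+y. h y * (\<integral>\<^sup>+x. f (T x) \<partial>lborel) \<partial>lborel)"
    by (simp add: I_def nn_integral_multc)
  also have "\<dots> = (\<integral>\<^sup>+y. h y * (\<integral>\<^sup>+x. f (T x + y) \<partial>lborel) \<partial>lborel)"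
  proof -
    have "(\<integral>\<^sup>+x. f (T x + y) \<partial>lborel) = (\<integral>\<^sup>+x. f (T x) \<partial>lborel)" for y
      using nn_integral_translate[of "\<lambda>x. f (T x)" "S y"] by (simp add: linear_add[OF l] S add.commute)
    then show ?thesis by simp
  qed
  also have "\<dots> = (\<integral>\<^sup>+y. (\<integral>\<^sup>+x. h y * f (T x + y) \<partial>lborel) \<partial>lborel)"
    by (intro nn_integral_cong nn_integral_cmult[symmetric]) simp
  also have "\<dots> = (\<integral>\<^sup>+x. (\<integral>\<^sup>+y. h y * f (T x + y) \<partial>lborel) \<partial>lborel)"
    by (intro lborel_pair.Fubini') simp
  also have "\<dots> = (\<integral>\<^sup>+x. (\<integral>\<^sup>+y. h (y - T x) * f y \<partial>lborel) \<partial>lborel)"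
  proof (rule nn_integral_cong)
    fix x
    show "(\<integral>\<^sup>+y. h y * f (T x + y) \<partial>lborel) = (\<integral>\<^sup>+y. h (y - T x) * f y \<partial>lborel)"
      using nn_integral_translate[of "\<lambda>y. h (y - T x) * f y" "T x"] by simp
  qed
  also have "\<dots> = (\<integral>\<^sup>+y. (\<integral>\<^sup>+x. h (y - T x) * f y \<partial>lborel) \<partial>lborel)"
    by (intro lborel_pair.Fubini') simp
  also have "\<dots> = (\<integral>\<^sup>+y. I * f y \<partial>lborel)"
  proof (rule nn_integral_cong)
    fix y
    \<comment> \<open>T is an isometry with right inverse S, and the unit ball is symmetric about
      0.\<close>
    have "h (y - T x) = h (- S y + x)" for x
    proof -
      have "norm (y - T x) = norm (T (S y - x))" by (simp add: linear_diff[OF l] S)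
      then show ?thesis by (simp add: nT h_def indicator_def norm_minus_commute)
    qed
    then have "(\<integral>\<^sup>+x. h (y - T x) \<partial>lborel) = I" using nn_integral_translate[of h "- S y"] by (simp add: I_def)
    then show "(\<integral>\<^sup>+x. h (y - T x) * f y \<partial>lborel) = I * f y" by (simp add: nn_integral_multc)
  qed
  also have "\<dots> = I * (\<integral>\<^sup>+x. f x \<partial>lborel)" by (simp add: nn_integral_cmult)
  finally show ?thesis using I by (simp add: ennreal_mult_cancel_left)
qed

lemma nn_integral_dilate:
  fixes h :: "'a::euclidean_space \<Rightarrow> ennreal"
  assumes [measurable]: "h \<in> borel_measurable borel" and c: "c > 0"
  shows "(\<integral>\<^sup>+x. h x \<partial>lborel) = ennreal (c ^ DIM('a)) * (\<integral>\<^sup>+x. h (c *\<^sub>R x) \<partial>lborel)"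
proof -
  have "(\<integral>\<^sup>+x. h x \<partial>lborel) = (\<integral>\<^sup>+x. h x \<partial>density (distr lborel borel (\<lambda>x. 0 + c *\<^sub>R x)) (\<lambda>_. \<bar>c\<bar>^DIM('a)))"
    using c by (subst (1) lborel_affine[of c 0]) auto
  then show ?thesis using c
    by (simp add: nn_integral_density nn_integral_distr nn_integral_cmult)
qed

text \<open>The annulus is a fundamental domain for the dilations \<open>exp (b * t)\<close> with \<open>t\<close> in a unit interval;
  averaging over this group replaces integration over the unit sphere.\<close>
lemma nn_integral_polar:
  fixes f :: "'a::euclidean_space \<Rightarrow> ennreal"
  assumes [measurable]: "f \<in> borel_measurable borel" and b: "b > 0"
  defines "K \<equiv> {y::'a. 1 \<le> norm y \<and> norm y < exp b}"
  shows "(\<integral>\<^sup>+x. ennreal (inverse (norm x ^ DIM('a))) * f x \<partial>lborel) =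
    (\<integral>\<^sup>+y. ennreal (inverse (norm y ^ DIM('a))) * indicator K y * (\<integral>\<^sup>+t. f (exp (b * t) *\<^sub>R sgn y) \<partial>lborel) \<partial>lborel)"
proof -
  define w :: "'a \<Rightarrow> ennreal" where "w x = ennreal (inverse (norm x ^ DIM('a)))" for x
  have [measurable]: "w \<in> borel_measurable borel" by (simp add: w_def[abs_def])
  have [measurable]: "K \<in> sets borel" unfolding K_def by measurable
  have [measurable]: "(sgn :: 'a \<Rightarrow> 'a) \<in> borel_measurable borel" by (simp add: sgn_div_norm[abs_def])
  \<comment> \<open>The measure \<open>dx / norm x ^ d\<close> is invariant under dilations.\<close>
  have wexp: "ennreal (exp (b * t) ^ DIM('a)) * w (exp (b * t) *\<^sub>R x) = w x" for t x
    using exp_gt_zero[of "b * t"]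
    by (simp add: w_def ennreal_mult'[symmetric] power_mult_distrib)
  \<comment> \<open>In the coordinate \<open>ln (norm x) / b\<close> the annulus is a half-open
    interval of length 1, so every orbit spends exactly one unit of t in it.\<close>
  have 1: "(\<integral>\<^sup>+t. indicator K (exp (- b * t) *\<^sub>R x) \<partial>lborel) = 1" if "x \<noteq> 0" for x
  proof -
    have "exp (- b * t) *\<^sub>R x \<in> K \<longleftrightarrow> t \<in> {ln (norm x) / b - 1 <.. ln (norm x) / b}" for t
    proof -
      define l where "l = ln (norm x)"
      have x: "norm x = exp l" using that by (simp add: l_def)
      have "norm (exp (- b * t) *\<^sub>R x) = exp (l - b * t)" by (simp add: x exp_diff exp_minus field_simps)
      then have "exp (- b * t) *\<^sub>R x \<in> K \<longleftrightarrow> b * t \<le> l \<and> l - b * t < b" by (simp add: K_def)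
      also have "\<dots> \<longleftrightarrow> t \<in> {l / b - 1 <.. l / b}" using b by (auto simp: field_simps)
      finally show ?thesis by (simp only: l_def)
    qed
    then have "(\<integral>\<^sup>+t. indicator K (exp (- b * t) *\<^sub>R x) \<partial>lborel) =
      (\<integral>\<^sup>+t. indicator {ln (norm x) / b - 1 <.. ln (norm x) / b} t \<partial>lborel)"
      by (intro nn_integral_cong) (simp add: indicator_def)
    then show ?thesis by simp
  qed
  have "(\<integral>\<^sup>+x. w x * f x \<partial>lborel) = (\<integral>\<^sup>+x. w x * f x * (\<integral>\<^sup>+t. indicator K (exp (- b * t) *\<^sub>R x) \<partial>lborel) \<partial>lborel)"
  proof (rule nn_integral_cong_AE)
    show "AE x in lborel. w x * f x = w x * f x * (\<integral>\<^sup>+t. indicator K (exp (- b * t) *\<^sub>R x) \<partial>lborel)"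
      using AE_lborel_singleton[of 0] by eventually_elim (subst 1; simp)
  qed
  also have "\<dots> = (\<integral>\<^sup>+x. (\<integral>\<^sup>+t. w x * f x * indicator K (exp (- b * t) *\<^sub>R x) \<partial>lborel) \<partial>lborel)"
    by (intro nn_integral_cong nn_integral_cmult[symmetric]) measurable
  also have "\<dots> = (\<integral>\<^sup>+t. (\<integral>\<^sup>+x. w x * f x * indicator K (exp (- b * t) *\<^sub>R x) \<partial>lborel) \<partial>lborel)"
    by (rule lborel_pair.Fubini'[symmetric]) measurable
  also have "\<dots> = (\<integral>\<^sup>+t. (\<integral>\<^sup>+x. w x * f (exp (b * t) *\<^sub>R x) * indicator K x \<partial>lborel) \<partial>lborel)"
  proof (rule nn_integral_cong)
    fix t :: real
    have "(\<integral>\<^sup>+x. w x * f x * indicator K (exp (- b * t) *\<^sub>R x) \<partial>lborel) =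
      ennreal (exp (b * t) ^ DIM('a)) * (\<integral>\<^sup>+x. w (exp (b * t) *\<^sub>R x) * f (exp (b * t) *\<^sub>R x) * indicator K x \<partial>lborel)"
      by (subst nn_integral_dilate[of _ "exp (b * t)"]) (simp_all add: exp_minus)
    also have "\<dots> = (\<integral>\<^sup>+x. w x * f (exp (b * t) *\<^sub>R x) * indicator K x \<partial>lborel)"
      by (subst nn_integral_cmult[symmetric]) (simp_all add: wexp flip: mult.assoc)
    finally show "(\<integral>\<^sup>+x. w x * f x * indicator K (exp (- b * t) *\<^sub>R x) \<partial>lborel) =
      (\<integral>\<^sup>+x. w x * f (exp (b * t) *\<^sub>R x) * indicator K x \<partial>lborel)" .
  qed
  also have "\<dots> = (\<integral>\<^sup>+x. (\<integral>\<^sup>+t. w x * f (exp (b * t) *\<^sub>R x) * indicator K x \<partial>lborel) \<partial>lborel)"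
    by (rule lborel_pair.Fubini') measurable
  also have "\<dots> = (\<integral>\<^sup>+x. w x * indicator K x * (\<integral>\<^sup>+t. f (exp (b * t) *\<^sub>R x) \<partial>lborel) \<partial>lborel)"
  proof (rule nn_integral_cong)
    fix x :: 'a
    have "(\<integral>\<^sup>+t. w x * f (exp (b * t) *\<^sub>R x) * indicator K x \<partial>lborel) = (\<integral>\<^sup>+t. w x * indicator K x * f (exp (b * t) *\<^sub>R x) \<partial>lborel)"
      by (simp only: mult_ac)
    also have "\<dots> = w x * indicator K x * (\<integral>\<^sup>+t. f (exp (b * t) *\<^sub>R x) \<partial>lborel)"
      by (rule nn_integral_cmult) measurable
    finally show "(\<integral>\<^sup>+t. w x * f (exp (b * t) *\<^sub>R x) * indicator K x \<partial>lborel) = w x * indicator K x * (\<integral>\<^sup>+t. f (exp (b * t) *\<^sub>R x) \<partial>lborel)" .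
  qed
  also have "\<dots> = (\<integral>\<^sup>+x. w x * indicator K x * (\<integral>\<^sup>+t. f (exp (b * t) *\<^sub>R sgn x) \<partial>lborel) \<partial>lborel)"
  proof (rule nn_integral_cong)
    fix x :: 'a
    show "w x * indicator K x * (\<integral>\<^sup>+t. f (exp (b * t) *\<^sub>R x) \<partial>lborel) = w x * indicator K x * (\<integral>\<^sup>+t. f (exp (b * t) *\<^sub>R sgn x) \<partial>lborel)"
    proof (cases "x = 0")
      \<comment> \<open>Shifting t by \<open>ln (norm x) / b\<close> replaces x by its
        direction.\<close>
      case False
      have "(\<integral>\<^sup>+t. f (exp (b * t) *\<^sub>R sgn x) \<partial>lborel) = (\<integral>\<^sup>+t. f (exp (b * (ln (norm x) / b + t)) *\<^sub>R sgn x) \<partial>lborel)"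
        by (rule nn_integral_translate[symmetric]) measurable
      moreover have "exp (b * (ln (norm x) / b + t)) *\<^sub>R sgn x = exp (b * t) *\<^sub>R x" for t
        using False b by (simp add: distrib_left exp_add sgn_div_norm)
      ultimately show ?thesis by simp
    qed (simp add: K_def)
  qed
  finally show ?thesis by (simp add: w_def)
qed

section \<open>Gradients along curves and rotations in coordinate planes\<close>

definition has_gradient :: "('a::euclidean_space \<Rightarrow> real) \<Rightarrow> ('a \<Rightarrow> 'a) \<Rightarrow> bool" where
  "has_gradient u p \<longleftrightarrow> (\<forall>x. (u has_derivative (\<lambda>h. p x \<bullet> h)) (at x)) \<and> continuous_on UNIV p"

lemma has_gradient_continuous_fun: "has_gradient u p \<Longrightarrow> continuous_on UNIV u"
  unfolding has_gradient_def
  by (intro continuous_at_imp_continuous_on) (blast intro: has_derivative_continuous)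

lemma has_gradient_curve:
  assumes u: "has_gradient u p" and c: "(c has_vector_derivative c') (at t)"
  shows "((\<lambda>t. u (c t)) has_real_derivative p (c t) \<bullet> c') (at t)"
proof -
  have "((u \<circ> c) has_derivative (\<lambda>h. p (c t) \<bullet> h) \<circ> (\<lambda>h. h *\<^sub>R c')) (at t)"
    using u c unfolding has_gradient_def has_vector_derivative_def by (intro diff_chain_at) auto
  moreover have "(\<lambda>h. p (c t) \<bullet> h) \<circ> (\<lambda>h. h *\<^sub>R c') = (\<lambda>h. (p (c t) \<bullet> c') * h)" by auto
  ultimately show ?thesis unfolding has_field_derivative_def by (simp add: o_def)
qed

definition plane_rotation :: "'n \<Rightarrow> 'n \<Rightarrow> real \<Rightarrow> real ^ 'n \<Rightarrow> real ^ 'n" where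
  "plane_rotation k j t x = x + ((cos t - 1) * x $ k - sin t * x $ j) *\<^sub>R axis k 1
     + ((cos t - 1) * x $ j + sin t * x $ k) *\<^sub>R axis j 1"

lemma axis_nth_other [simp]: "i \<noteq> k \<Longrightarrow> axis k (1::real) $ i = 0" by (simp add: axis_def)

lemma axis_nth_same [simp]: "axis k (1::real) $ k = 1" by (simp add: axis_def)

lemma plane_rotation_nth:
  assumes "k \<noteq> j"
  shows "plane_rotation k j t x $ k = cos t * x $ k - sin t * x $ j"
    "plane_rotation k j t x $ j = cos t * x $ j + sin t * x $ k"
  using assms by (simp_all add: plane_rotation_def algebra_simps)

lemma orthogonal_plane_rotation:
  assumes "k \<noteq> j"
  shows "orthogonal_transformation (plane_rotation k j t)"
proof -
  have "linear (plane_rotation k j t)"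
    by (rule linearI) (simp_all add: plane_rotation_def algebra_simps)
  moreover have "norm (plane_rotation k j t x) = norm x" for x
  proof -
    define a b where "a = (cos t - 1) * x $ k - sin t * x $ j" and "b = (cos t - 1) * x $ j + sin t * x $ k"
    have "(norm (plane_rotation k j t x))\<^sup>2 = (x + a *\<^sub>R axis k 1 + b *\<^sub>R axis j 1) \<bullet> (x + a *\<^sub>R axis k 1 + b *\<^sub>R axis j 1)"
      by (simp add: power2_norm_eq_inner plane_rotation_def a_def b_def)
    also have "\<dots> = x \<bullet> x + (2 * a * x $ k + 2 * b * x $ j + a\<^sup>2 + b\<^sup>2)"
      using assms by (simp add: inner_simps inner_axis inner_axis' power2_eq_square algebra_simps)
    also have "2 * a * x $ k + 2 * b * x $ j + a\<^sup>2 + b\<^sup>2 =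
      ((cos t)\<^sup>2 + (sin t)\<^sup>2 - 1) * ((x $ k)\<^sup>2 + (x $ j)\<^sup>2)"
      unfolding a_def b_def by algebra
    finally show ?thesis by (simp add: power2_norm_eq_inner[symmetric])
  qed
  ultimately show ?thesis by (simp add: orthogonal_transformation)
qed

lemma plane_rotation_periodic: "plane_rotation k j (t + 2 * pi) x = plane_rotation k j t x"
  by (simp add: plane_rotation_def)

lemma plane_rotation_derivative:
  fixes x :: "real ^ 'n"
  assumes "k \<noteq> j"
  defines "y \<equiv> \<lambda>t. plane_rotation k j t x"
  shows "(y has_vector_derivative (y t $ k *\<^sub>R axis j 1 - y t $ j *\<^sub>R axis k 1)) (at t)"
proof -
  have "((\<lambda>t. x + ((cos t - 1) * x $ k - sin t * x $ j) *\<^sub>R axis k 1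
     + ((cos t - 1) * x $ j + sin t * x $ k) *\<^sub>R axis j 1) has_vector_derivative
     ((0 + (- sin t * x $ k - cos t * x $ j) *\<^sub>R axis k 1)
      + (- sin t * x $ j + cos t * x $ k) *\<^sub>R axis j 1)) (at t)"
    by (rule derivative_eq_intros refl | simp)+
  also have "((0 + (- sin t * x $ k - cos t * x $ j) *\<^sub>R axis k 1)
      + (- sin t * x $ j + cos t * x $ k) *\<^sub>R axis j 1) = y t $ k *\<^sub>R axis j 1 - y t $ j *\<^sub>R (axis k 1 :: real ^ 'n)"
    unfolding y_def plane_rotation_nth[OF assms(1)] by (simp add: algebra_simps)
  finally show ?thesis unfolding y_def plane_rotation_def .
qed

lemma continuous_plane_rotation:
  "continuous_on UNIV (\<lambda>q. plane_rotation k j (fst q) (snd q))"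
  unfolding plane_rotation_def by (intro continuous_intros)

lemma measurable_plane_rotation [measurable (raw)]:
  assumes "f \<in> M \<rightarrow>\<^sub>M borel" "g \<in> M \<rightarrow>\<^sub>M borel"
  shows "(\<lambda>q. plane_rotation k j (f q) (g q)) \<in> M \<rightarrow>\<^sub>M borel"
  using borel_measurable_continuous_on[OF continuous_plane_rotation borel_measurable_Pair[OF assms]] by simp

text \<open>Invariance under each single rotation is integrated over all angles, and Fubini's
  theorem moves the angle inside. Any inequality along the orbit circles thereby becomes one for
  integrals over the space. The factor 2 * pi stays on the left, which avoids a division of extended
  reals.\<close>

lemma nn_integral_rotation_average:
  fixes F :: "real ^ 'n \<Rightarrow> real" and W :: "real ^ 'n \<Rightarrow> ennreal"
  assumes kj: "k \<noteq> j" and W[measurable]: "W \<in> borel_measurable borel"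
    and rad: "\<And>T x. orthogonal_transformation T \<Longrightarrow> W (T x) = W x"
    and F: "continuous_on UNIV F" "\<And>x. 0 \<le> F x"
  shows "ennreal (2 * pi) * (\<integral>\<^sup>+x. W x * ennreal (F x) \<partial>lborel) =
    (\<integral>\<^sup>+x. W x * ennreal (integral {0..2*pi} (\<lambda>t. F (plane_rotation k j t x))) \<partial>lborel)"
proof -
  let ?R = "plane_rotation k j"
  note o = orthogonal_plane_rotation[OF kj]
  have [measurable]: "F \<in> borel_measurable borel" using F by (intro borel_measurable_continuous_onI)
  have "ennreal (2 * pi) * (\<integral>\<^sup>+x. W x * ennreal (F x) \<partial>lborel) = (\<integral>\<^sup>+t. (\<integral>\<^sup>+x. W x * ennreal (F x) \<partial>lborel) * indicator {0..2*pi} t \<partial>lborel)"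
    by (subst nn_integral_cmult_indicator) (simp_all only: sets_lborel emeasure_lborel_Icc_eq atLeastAtMost_borel, simp add: mult.commute)
  also have "\<dots> = (\<integral>\<^sup>+t. (\<integral>\<^sup>+x. W x * ennreal (F (?R t x)) * indicator {0..2*pi} t \<partial>lborel) \<partial>lborel)"
  proof (rule nn_integral_cong)
    fix t
    have "(\<integral>\<^sup>+x. W x * ennreal (F x) \<partial>lborel) = (\<integral>\<^sup>+x. W (?R t x) * ennreal (F (?R t x)) \<partial>lborel)"
      by (rule nn_integral_orthogonal[OF o, symmetric]) simp
    then show "(\<integral>\<^sup>+x. W x * ennreal (F x) \<partial>lborel) * indicator {0..2*pi} t = (\<integral>\<^sup>+x. W x * ennreal (F (?R t x)) * indicator {0..2*pi} t \<partial>lborel)"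
      unfolding rad[OF o] by (subst nn_integral_multc) simp_all
  qed
  also have "\<dots> = (\<integral>\<^sup>+x. (\<integral>\<^sup>+t. W x * ennreal (F (?R t x)) * indicator {0..2*pi} t \<partial>lborel) \<partial>lborel)"
  proof (rule lborel_pair.Fubini'[of "\<lambda>x t. W x * ennreal (F (?R t x)) * indicator {0..2*pi} t"])
    have "(\<lambda>q. W (fst q) * ennreal (F (?R (snd q) (fst q))) * indicator {0..2*pi} (snd q)) \<in> borel_measurable (lborel \<Otimes>\<^sub>M lborel)"
      by measurable
    then show "(\<lambda>(x, t). W x * ennreal (F (?R t x)) * indicator {0..2*pi} t) \<in> borel_measurable (lborel \<Otimes>\<^sub>M lborel)"
      by (simp add: case_prod_beta')
  qed
  also have "\<dots> = (\<integral>\<^sup>+x. W x * ennreal (integral {0..2*pi} (\<lambda>t. F (?R t x))) \<partial>lborel)"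
  proof (rule nn_integral_cong)
    fix x
    have c: "continuous_on UNIV (\<lambda>t. F (?R t x))"
      unfolding plane_rotation_def by (intro continuous_on_compose2[OF F(1)] continuous_intros) auto
    have "(\<integral>\<^sup>+t. W x * ennreal (F (?R t x)) * indicator {0..2*pi} t \<partial>lborel) = W x * (\<integral>\<^sup>+t. ennreal (F (?R t x)) * indicator {0..2*pi} t \<partial>lborel)"
      unfolding mult.assoc by (rule nn_integral_cmult) measurable
    also have "(\<integral>\<^sup>+t. ennreal (F (?R t x)) * indicator {0..2*pi} t \<partial>lborel) = ennreal (integral {0..2*pi} (\<lambda>t. F (?R t x)))"
      using F(2) by (intro nn_integral_Icc_continuous continuous_on_subset[OF c]) auto
    finally show "(\<integral>\<^sup>+t. W x * ennreal (F (?R t x)) * indicator {0..2*pi} t \<partial>lborel) = W x * ennreal (integral {0..2*pi} (\<lambda>t. F (?R t x)))" .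
  qed
  finally show ?thesis .
qed

text \<open>On the right stands the square of the derivative of u along the rotation in the plane of
  k and j. Every orbit meets the hyperplane \<open>x $ k = 0\<close> in a pair of opposite angles,
  where u vanishes, so Wirtinger's inequality applies to each orbit.\<close>

lemma rotational_wirtinger:
  fixes u :: "real ^ 'n \<Rightarrow> real" and W :: "real ^ 'n \<Rightarrow> ennreal"
  assumes kj: "k \<noteq> j" and W: "W \<in> borel_measurable borel"
    and rad: "\<And>T x. orthogonal_transformation T \<Longrightarrow> W (T x) = W x"
    and u: "has_gradient u p" and 0: "\<And>x. x $ k = 0 \<Longrightarrow> u x = 0"
  shows "(\<integral>\<^sup>+x. W x * ennreal ((u x)\<^sup>2) \<partial>lborel) \<le> (\<integral>\<^sup>+x. W x * ennreal ((x $ k * p x $ j - x $ j * p x $ k)\<^sup>2) \<partial>lborel)"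
proof -
  let ?R = "plane_rotation k j" and ?L = "\<lambda>x. x $ k * p x $ j - x $ j * p x $ k"
  have cu: "continuous_on UNIV u" using u by (rule has_gradient_continuous_fun)
  have cp: "continuous_on UNIV p" using u by (simp add: has_gradient_def)
  have cL: "continuous_on UNIV ?L" by (intro continuous_intros cp)
  have avg: "ennreal (2 * pi) * (\<integral>\<^sup>+x. W x * ennreal ((F x)\<^sup>2) \<partial>lborel) =
    (\<integral>\<^sup>+x. W x * ennreal (integral {0..2*pi} (\<lambda>t. (F (?R t x))\<^sup>2)) \<partial>lborel)"
    if "continuous_on UNIV F" for F
    by (rule nn_integral_rotation_average[OF kj W]) (auto intro!: rad continuous_intros that)
  have "ennreal (2 * pi) * (\<integral>\<^sup>+x. W x * ennreal ((u x)\<^sup>2) \<partial>lborel) \<le> ennreal (2 * pi) * (\<integral>\<^sup>+x. W x * ennreal ((?L x)\<^sup>2) \<partial>lborel)"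
    unfolding avg[OF cu] avg[OF cL]
    proof (intro nn_integral_mono mult_left_mono ennreal_leI)
      fix x
      define f where "f t = u (?R t x)" for t
      define f' where "f' t = ?L (?R t x)" for t
      have fd: "(f has_real_derivative f' t) (at t)" for t
        unfolding f_def
        by (rule DERIV_cong[OF has_gradient_curve[OF u plane_rotation_derivative[OF kj]]])
           (simp add: inner_diff_right inner_axis f'_def)
      have cR: "continuous_on UNIV (\<lambda>t. ?R t x)" unfolding plane_rotation_def by (intro continuous_intros)
      have cf: "continuous_on UNIV f" unfolding f_def by (intro continuous_on_compose2[OF cu cR]) auto
      have cf': "continuous_on UNIV f'" unfolding f'_def by (intro continuous_on_compose2[OF cL cR]) auto
      \<comment> \<open>Half a turn reverses the sign of the k-th coordinate, so by the intermediate
        value theorem it has a zero in [0, pi].\<close>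
      obtain a where a: "0 \<le> a" "a \<le> pi" "?R a x $ k = 0"
      proof -
        let ?h = "\<lambda>t. cos t * x $ k - sin t * x $ j"
        have ch: "continuous_on {0..pi} ?h" by (intro continuous_intros)
        have "\<exists>a. 0 \<le> a \<and> a \<le> pi \<and> ?h a = 0"
        proof (cases "x $ k \<le> 0")
          case True
          then show ?thesis using IVT'[of ?h 0 0 pi] ch by auto
        next
          case False
          then show ?thesis using IVT2'[of ?h pi 0 0] ch by auto
        qed
        then show thesis using that by (auto simp: plane_rotation_nth[OF kj])
      qed
      have "?R (a + pi) x $ k = 0" using a(3) by (simp add: plane_rotation_nth[OF kj])
      then have z: "f a = 0" "f (a + pi) = 0" using a(3) by (simp_all add: f_def 0)
      have per: "f (t + 2 * pi) = f t" "f' (t + 2 * pi) = f' t" for t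
        by (simp_all add: f_def f'_def plane_rotation_periodic)
      have "integral {a..a+2*pi} (\<lambda>t. (f t)\<^sup>2) \<le> integral {a..a+2*pi} (\<lambda>t. (f' t)\<^sup>2)"
        by (rule wirtinger_circle[OF fd cf' per z])
      have "integral {0..2*pi} (\<lambda>t. (f t)\<^sup>2) \<le> integral {0..2*pi} (\<lambda>t. (f' t)\<^sup>2)"
      proof -
        have sh: "integral {a..a+2*pi} (\<lambda>t. (h t)\<^sup>2) = integral {0..2*pi} (\<lambda>t. (h t)\<^sup>2)"
          if "continuous_on UNIV h" "\<And>t. h (t + 2 * pi) = h t" for h :: "real \<Rightarrow> real"
          using a by (intro integral_periodic_shift continuous_on_power that) (simp_all add: that(2))
        show ?thesis using \<open>integral {a..a+2*pi} (\<lambda>t. (f t)\<^sup>2) \<le> integral {a..a+2*pi} (\<lambda>t. (f' t)\<^sup>2)\<close>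
          unfolding sh[OF cf per(1)] sh[OF cf' per(2)] .
      qed
      then show "integral {0..2*pi} (\<lambda>t. (u (?R t x))\<^sup>2) \<le> integral {0..2*pi} (\<lambda>t. (?L (?R t x))\<^sup>2)"
        by (simp add: f_def f'_def)
    qed simp
  then show ?thesis by (rule iffD1[OF ennreal_mult_le_mult_iff, rotated 2]) simp_all
qed

subsection \<open>Mass and energy\<close>

text \<open>In the variable \<open>t = ln (norm x) / dim_exp\<close> the measure has a logistic density. The densities below
  have junk values at \<open>0\<close>.\<close>
definition dim_exp :: "'n::finite itself \<Rightarrow> real" where
  "dim_exp _ = (real CARD('n) - 1) / real CARD('n)"

definition radial_z :: "real ^ 'n \<Rightarrow> real" where
  "radial_z x = logistic (ln (norm x) / dim_exp TYPE('n))"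

text \<open>\<open>1 / norm x ^ d\<close> is the density of the dilation-invariant measure, the
  other factor is the density in t. Away from 0 the product is the density of
  \<open>onofri_measure\<close> multiplied by the area of the unit sphere
  (\<open>mass_density_eq\<close>).\<close>

definition mass_density :: "real ^ 'n \<Rightarrow> real" where
  "mass_density x = inverse (norm x ^ CARD('n)) *
     (real CARD('n) * radial_z x ^ (CARD('n) - 1) * (1 - radial_z x))"

definition energy_weight :: "real ^ 'n \<Rightarrow> real" where
  "energy_weight x = inverse (norm x ^ CARD('n)) * radial_z x ^ (CARD('n) - 2)"

text \<open>A constant multiple of \<open>Gform\<close> away from 0 (\<open>Gform_eq\<close>),
  scaled such that the inequality reads mass <= energy. Splitting p into its radial and tangential
  components gives (p . x)^2 the coefficient \<open>dim_exp\<close> squared, so that it is the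
  squared derivative in t, and gives the tangential part the coefficient (d - 1) / d^2.\<close>

definition energy_density :: "real ^ 'n \<Rightarrow> real ^ 'n \<Rightarrow> real" where
  "energy_density x p = energy_weight x * ((real CARD('n) - 1) / (real CARD('n))\<^sup>2 *
     ((real CARD('n) - 2) * (p \<bullet> x)\<^sup>2 + (norm x)\<^sup>2 * (norm p)\<^sup>2))"

definition mass :: "(real ^ 'n \<Rightarrow> real) \<Rightarrow> ennreal" where
  "mass u = (\<integral>\<^sup>+x. ennreal (mass_density x * (u x)\<^sup>2) \<partial>lborel)"

definition energy :: "(real ^ 'n \<Rightarrow> real ^ 'n) \<Rightarrow> ennreal" where
  "energy p = (\<integral>\<^sup>+x. ennreal (energy_density x (p x)) \<partial>lborel)"

lemma radial_z_bounds: "0 < radial_z x" "radial_z x < 1"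
  unfolding radial_z_def by (rule logistic_bounds)+

lemma mass_density_nonneg: "0 \<le> mass_density x"
  using radial_z_bounds[of x] by (simp add: mass_density_def)

lemma energy_weight_nonneg: "0 \<le> energy_weight x"
  using radial_z_bounds[of x] by (simp add: energy_weight_def)

lemma energy_density_nonneg:
  fixes x p :: "real ^ 'n"
  shows "CARD('n) \<ge> 2 \<Longrightarrow> 0 \<le> energy_density x p"
  using energy_weight_nonneg[of x] by (simp add: energy_density_def)

lemma measurable_logistic [measurable]: "logistic \<in> borel_measurable borel"
  unfolding logistic_def[abs_def] by measurable

lemma measurable_radial_z [measurable]: "radial_z \<in> borel_measurable borel"
  unfolding radial_z_def[abs_def] by measurable

lemma measurable_mass_density [measurable]: "mass_density \<in> borel_measurable borel"
  unfolding mass_density_def[abs_def] by measurable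

lemma measurable_energy_weight [measurable]: "energy_weight \<in> borel_measurable borel"
  unfolding energy_weight_def[abs_def] by measurable

lemma measurable_energy_density:
  assumes [measurable]: "f \<in> M \<rightarrow>\<^sub>M borel" "g \<in> M \<rightarrow>\<^sub>M borel"
  shows "(\<lambda>x. energy_density (f x) (g x)) \<in> borel_measurable M"
  unfolding energy_density_def by measurable

lemma measurable_ennreal_energy_density:
  "p \<in> borel_measurable borel \<Longrightarrow> (\<lambda>x. ennreal (energy_density x (p x))) \<in> borel_measurable borel"
  by (intro measurable_compose[OF _ measurable_ennreal] measurable_energy_density) simp_all

lemma measurable_vec_nth [measurable (raw)]:
  "f \<in> M \<rightarrow>\<^sub>M borel \<Longrightarrow> (\<lambda>x. f x $ i) \<in> M \<rightarrow>\<^sub>M (borel :: real measure)"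
  by (rule borel_measurable_continuous_on[of "\<lambda>x. x $ i"]) (intro continuous_intros)

lemma radial_z_orthogonal:
  fixes T :: "real ^ 'n \<Rightarrow> real ^ 'n"
  shows "orthogonal_transformation T \<Longrightarrow> radial_z (T x) = radial_z x"
  by (simp add: radial_z_def orthogonal_transformation_norm)

lemma mass_density_orthogonal:
  fixes T :: "real ^ 'n \<Rightarrow> real ^ 'n"
  shows "orthogonal_transformation T \<Longrightarrow> mass_density (T x) = mass_density x"
  by (simp add: mass_density_def radial_z_orthogonal orthogonal_transformation_norm)

lemma energy_weight_orthogonal:
  fixes T :: "real ^ 'n \<Rightarrow> real ^ 'n"
  shows "orthogonal_transformation T \<Longrightarrow> energy_weight (T x) = energy_weight x"
  by (simp add: energy_weight_def radial_z_orthogonal orthogonal_transformation_norm)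

lemma energy_density_orthogonal:
  fixes T :: "real ^ 'n \<Rightarrow> real ^ 'n"
  shows "orthogonal_transformation T \<Longrightarrow> energy_density (T x) (T p) = energy_density x p"
  by (simp add: energy_density_def energy_weight_orthogonal orthogonal_transformation_norm)
     (simp add: orthogonal_transformation_def)

lemma radial_z_ray:
  fixes y :: "real ^ 'n"
  assumes "y \<noteq> 0" "dim_exp TYPE('n) \<noteq> 0"
  shows "radial_z (exp (dim_exp TYPE('n) * t) *\<^sub>R sgn y) = logistic t"
  using assms by (simp add: radial_z_def norm_sgn)

lemma dim_exp_pos: "CARD('n) \<ge> 2 \<Longrightarrow> dim_exp TYPE('n::finite) > 0"
  by (simp add: dim_exp_def)

lemma nn_integral_le_polar:
  fixes f g :: "real ^ 'n \<Rightarrow> real"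
  assumes d: "CARD('n) \<ge> 2"
    and m: "f \<in> borel_measurable borel" "g \<in> borel_measurable borel"
    and le: "\<And>y. y \<noteq> 0 \<Longrightarrow> (\<integral>\<^sup>+t. ennreal (f (exp (dim_exp TYPE('n) * t) *\<^sub>R sgn y)) \<partial>lborel) \<le>
       (\<integral>\<^sup>+t. ennreal (g (exp (dim_exp TYPE('n) * t) *\<^sub>R sgn y)) \<partial>lborel)"
  shows "(\<integral>\<^sup>+x. ennreal (inverse (norm x ^ CARD('n)) * f x) \<partial>lborel) \<le>
    (\<integral>\<^sup>+x. ennreal (inverse (norm x ^ CARD('n)) * g x) \<partial>lborel)"
proof -
  have e: "(\<integral>\<^sup>+x. ennreal (inverse (norm x ^ CARD('n)) * h x) \<partial>lborel) =
    (\<integral>\<^sup>+x. ennreal (inverse (norm x ^ DIM(real^'n))) * ennreal (h x) \<partial>lborel)" for h :: "real ^ 'n \<Rightarrow> real"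
    by (simp add: ennreal_mult')
  have [measurable]: "f \<in> borel_measurable borel" "g \<in> borel_measurable borel" by (fact m)+
  let ?K = "\<lambda>y::real^'n. ennreal (inverse (norm y ^ DIM(real^'n))) * indicator {y. 1 \<le> norm y \<and> norm y < exp (dim_exp TYPE('n))} y"
  have p: "(\<integral>\<^sup>+x. ennreal (inverse (norm x ^ CARD('n)) * h x) \<partial>lborel) =
    (\<integral>\<^sup>+y. ?K y * (\<integral>\<^sup>+t. ennreal (h (exp (dim_exp TYPE('n) * t) *\<^sub>R sgn y)) \<partial>lborel) \<partial>lborel)"
    if [measurable]: "h \<in> borel_measurable borel" for h :: "real ^ 'n \<Rightarrow> real"
    unfolding e by (rule nn_integral_polar[OF _ dim_exp_pos[OF d]]) simp
  show ?thesis
    unfolding p[OF m(1)] p[OF m(2)]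
  proof (rule nn_integral_mono)
    fix y :: "real ^ 'n"
    show "?K y * (\<integral>\<^sup>+t. ennreal (f (exp (dim_exp TYPE('n) * t) *\<^sub>R sgn y)) \<partial>lborel)
      \<le> ?K y * (\<integral>\<^sup>+t. ennreal (g (exp (dim_exp TYPE('n) * t) *\<^sub>R sgn y)) \<partial>lborel)"
      by (cases "y = 0") (simp, intro mult_left_mono le, auto)
  qed
qed

lemma ennreal_weighted_sum:
  assumes "0 \<le> w" "0 \<le> a" "0 \<le> b" "0 \<le> c"
  shows "ennreal w * ennreal a + ennreal b * (ennreal w * ennreal c) = ennreal (w * (a + b * c))"
  using assms by (simp add: ennreal_mult[symmetric] distrib_left mult.left_commute)

lemma norm_cauchy_schwarz_sq: "(p \<bullet> x)\<^sup>2 \<le> (norm x)\<^sup>2 * (norm p)\<^sup>2"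
  using Cauchy_Schwarz_ineq[of p x] by (simp add: power2_norm_eq_inner mult.commute)

text \<open>By Lagrange's identity the right-hand side is the sum of these squares over all pairs of
  coordinates; the left-hand side keeps the pairs that contain k. The difference is the
  Cauchy-Schwarz defect in the remaining coordinates.\<close>

lemma sum_angular_sq_le:
  fixes x p :: "real ^ 'n"
  shows "(\<Sum>j\<in>UNIV - {k}. (x $ k * p $ j - x $ j * p $ k)\<^sup>2) \<le> (norm x)\<^sup>2 * (norm p)\<^sup>2 - (p \<bullet> x)\<^sup>2"
proof -
  define A B C where "A = (\<Sum>j\<in>UNIV - {k}. (x $ j)\<^sup>2)" and "B = (\<Sum>j\<in>UNIV - {k}. (p $ j)\<^sup>2)"
    and "C = (\<Sum>j\<in>UNIV - {k}. x $ j * p $ j)"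
  have s: "(\<Sum>j\<in>UNIV. h j) = h k + (\<Sum>j\<in>UNIV - {k}. h j)" for h :: "'n \<Rightarrow> real"
    by (rule sum.remove) auto
  have n: "(norm x)\<^sup>2 = (x $ k)\<^sup>2 + A" "(norm p)\<^sup>2 = (p $ k)\<^sup>2 + B" "p \<bullet> x = x $ k * p $ k + C"
    unfolding power2_norm_eq_inner inner_vec_def
    by (subst s; simp add: A_def B_def C_def power2_eq_square mult.commute)+
  have CS: "C\<^sup>2 \<le> A * B" unfolding A_def B_def C_def
    using Cauchy_Schwarz_ineq_sum[of "\<lambda>j. x $ j" "\<lambda>j. p $ j" "UNIV - {k}"] by simp
  have "(\<Sum>j\<in>UNIV - {k}. (x $ k * p $ j - x $ j * p $ k)\<^sup>2) =
     (\<Sum>j\<in>UNIV - {k}. (x $ k)\<^sup>2 * (p $ j)\<^sup>2 - (2 * x $ k * p $ k) * (x $ j * p $ j) + (p $ k)\<^sup>2 * (x $ j)\<^sup>2)"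
    by (intro sum.cong refl) (simp add: power2_eq_square algebra_simps)
  also have "\<dots> = (x $ k)\<^sup>2 * B - 2 * x $ k * p $ k * C + (p $ k)\<^sup>2 * A"
    unfolding A_def B_def C_def by (simp only: sum.distrib sum_subtractf sum_distrib_left)
  finally have S: "(\<Sum>j\<in>UNIV - {k}. (x $ k * p $ j - x $ j * p $ k)\<^sup>2) = (x $ k)\<^sup>2 * B - 2 * x $ k * p $ k * C + (p $ k)\<^sup>2 * A" .
  have "((x $ k)\<^sup>2 + A) * ((p $ k)\<^sup>2 + B) - (x $ k * p $ k + C)\<^sup>2 -
    ((x $ k)\<^sup>2 * B - 2 * x $ k * p $ k * C + (p $ k)\<^sup>2 * A) = A * B - C\<^sup>2" by algebra
  with CS show ?thesis unfolding n S by linarith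
qed

lemma has_derivative_ray:
  assumes "has_gradient u p"
  shows "((\<lambda>t. u (exp (b * t) *\<^sub>R w)) has_real_derivative b * (p (exp (b * t) *\<^sub>R w) \<bullet> (exp (b * t) *\<^sub>R w))) (at t)"
proof -
  have "((\<lambda>t. exp (b * t) *\<^sub>R w) has_vector_derivative (b * exp (b * t)) *\<^sub>R w) (at t)"
    by (auto intro!: derivative_eq_intros)
  from has_gradient_curve[OF assms this] show ?thesis by (simp add: mult.assoc)
qed

lemma continuous_on_ray:
  assumes "has_gradient u p"
  shows "continuous_on UNIV (\<lambda>t. b * (p (exp (b * t) *\<^sub>R w) \<bullet> (exp (b * t) *\<^sub>R w)))"
proof -
  have c: "continuous_on UNIV (\<lambda>t. exp (b * t) *\<^sub>R w)" by (intro continuous_intros)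
  have "continuous_on UNIV (\<lambda>t. p (exp (b * t) *\<^sub>R w))"
    using assms by (intro continuous_on_compose2[OF _ c]) (auto simp: has_gradient_def)
  then show ?thesis by (intro continuous_intros c)
qed

text \<open>Each of the d - 1 coordinate planes through the k-axis contributes one copy of the
  weighted integral of u^2 to the angular energy. This reproduces the first nonzero eigenvalue d - 1
  of the sphere, and (d - 1) / d^2 * (d - 1) is the square of \<open>dim_exp\<close>, exactly the
  zeroth-order term in \<open>line_inequality_odd\<close>.\<close>

lemma mass_le_energy_of_vanishing:
  fixes u :: "real ^ 'n \<Rightarrow> real"
  assumes d: "CARD('n) \<ge> 2" and u: "has_gradient u p" and 0: "\<And>x. x $ k = 0 \<Longrightarrow> u x = 0"
  shows "mass u \<le> energy p"
proof -
  let ?d = "real CARD('n)" and ?b = "dim_exp TYPE('n)"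
  define n where "n = CARD('n) - 2"
  have dn: "?d = real n + 2" "CARD('n) - 1 = Suc n" using d by (auto simp: n_def)
  have b: "?b > 0" "(?d - 1) / ?d = ?b" by (rule dim_exp_pos[OF d]) (simp add: dim_exp_def)
  have [measurable]: "u \<in> borel_measurable borel" "p \<in> borel_measurable borel"
    using has_gradient_continuous_fun[OF u] u by (auto simp: has_gradient_def intro: borel_measurable_continuous_onI)
  define T where "T x = (norm x)\<^sup>2 * (norm (p x))\<^sup>2 - (p x \<bullet> x)\<^sup>2" for x
  have T0: "0 \<le> T x" for x using norm_cauchy_schwarz_sq[of "p x" x] by (simp add: T_def)
  let ?W = "\<lambda>x. ennreal (energy_weight x)"
  have "mass u \<le> (\<integral>\<^sup>+x. ennreal (inverse (norm x ^ CARD('n)) * (radial_z x ^ n * ((?b * (p x \<bullet> x))\<^sup>2 + ?b\<^sup>2 * (u x)\<^sup>2))) \<partial>lborel)"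
    unfolding mass_def mass_density_def mult.assoc
  proof (rule nn_integral_le_polar[OF d])
    fix y :: "real ^ 'n" assume y: "y \<noteq> 0"
    show "(\<integral>\<^sup>+t. ennreal (?d * (radial_z (exp (?b * t) *\<^sub>R sgn y) ^ (CARD('n) - 1) *
        ((1 - radial_z (exp (?b * t) *\<^sub>R sgn y)) * (u (exp (?b * t) *\<^sub>R sgn y))\<^sup>2))) \<partial>lborel) \<le>
      (\<integral>\<^sup>+t. ennreal (radial_z (exp (?b * t) *\<^sub>R sgn y) ^ n * ((?b * (p (exp (?b * t) *\<^sub>R sgn y) \<bullet> (exp (?b * t) *\<^sub>R sgn y)))\<^sup>2
        + ?b\<^sup>2 * (u (exp (?b * t) *\<^sub>R sgn y))\<^sup>2)) \<partial>lborel)"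
      using line_inequality_odd[OF has_derivative_ray[OF u, of ?b "sgn y"] continuous_on_ray[OF u] dn(1)]
      unfolding radial_z_ray[OF y less_imp_neq[OF b(1), symmetric]] b dn(2) by (simp only: mult.assoc)
  qed measurable
  also have "\<dots> = (\<integral>\<^sup>+x. ?W x * ennreal (?b\<^sup>2 * (p x \<bullet> x)\<^sup>2) + ennreal (?b\<^sup>2) * (?W x * ennreal ((u x)\<^sup>2)) \<partial>lborel)"
    by (intro nn_integral_cong, subst ennreal_weighted_sum)
       (auto simp: energy_weight_nonneg, simp add: energy_weight_def n_def power_mult_distrib mult.assoc)
  also have "\<dots> = (\<integral>\<^sup>+x. ?W x * ennreal (?b\<^sup>2 * (p x \<bullet> x)\<^sup>2) \<partial>lborel) + ennreal (?b\<^sup>2) * (\<integral>\<^sup>+x. ?W x * ennreal ((u x)\<^sup>2) \<partial>lborel)"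
    by (subst nn_integral_add) (auto simp: nn_integral_cmult)
  also have "ennreal (?b\<^sup>2) * (\<integral>\<^sup>+x. ?W x * ennreal ((u x)\<^sup>2) \<partial>lborel) \<le> ennreal ((?d - 1) / ?d\<^sup>2) * (\<integral>\<^sup>+x. ?W x * ennreal (T x) \<partial>lborel)"
  proof -
    let ?I = "\<integral>\<^sup>+x. ?W x * ennreal ((u x)\<^sup>2) \<partial>lborel"
    have "ennreal (?d - 1) * ?I = (\<Sum>j\<in>UNIV - {k}. ?I)"
      using d by (simp add: card_Diff_singleton of_nat_diff ennreal_of_nat_eq_real_of_nat)
    also have "\<dots> \<le> (\<Sum>j\<in>UNIV - {k}. \<integral>\<^sup>+x. ?W x * ennreal ((x $ k * p x $ j - x $ j * p x $ k)\<^sup>2) \<partial>lborel)"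
      by (intro sum_mono rotational_wirtinger[OF _ _ _ u 0]) (auto simp: energy_weight_orthogonal)
    also have "\<dots> = (\<integral>\<^sup>+x. (\<Sum>j\<in>UNIV - {k}. ?W x * ennreal ((x $ k * p x $ j - x $ j * p x $ k)\<^sup>2)) \<partial>lborel)"
      by (rule nn_integral_sum[symmetric]) measurable
    also have "\<dots> \<le> (\<integral>\<^sup>+x. ?W x * ennreal (T x) \<partial>lborel)"
      by (intro nn_integral_mono)
         (auto simp: sum_distrib_left[symmetric] sum_ennreal T_def intro!: mult_left_mono ennreal_leI sum_angular_sq_le)
    finally have "ennreal ((?d - 1) / ?d\<^sup>2) * (ennreal (?d - 1) * ?I) \<le> ennreal ((?d - 1) / ?d\<^sup>2) * (\<integral>\<^sup>+x. ?W x * ennreal (T x) \<partial>lborel)"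
      by (rule mult_left_mono) simp
    also have "ennreal ((?d - 1) / ?d\<^sup>2) * (ennreal (?d - 1) * ?I) = ennreal (?b\<^sup>2) * ?I"
      using d unfolding mult.assoc[symmetric]
      by (subst ennreal_mult'[symmetric]) (auto simp: dim_exp_def power2_eq_square)
    finally show ?thesis .
  qed
  also have "(\<integral>\<^sup>+x. ?W x * ennreal (?b\<^sup>2 * (p x \<bullet> x)\<^sup>2) \<partial>lborel) + ennreal ((?d - 1) / ?d\<^sup>2) * (\<integral>\<^sup>+x. ?W x * ennreal (T x) \<partial>lborel)
    = (\<integral>\<^sup>+x. ?W x * ennreal (?b\<^sup>2 * (p x \<bullet> x)\<^sup>2) + ennreal ((?d - 1) / ?d\<^sup>2) * (?W x * ennreal (T x)) \<partial>lborel)"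
    unfolding T_def by (subst nn_integral_add) (auto simp: nn_integral_cmult)
  also have "\<dots> = energy p" unfolding energy_def
  proof (rule nn_integral_cong)
    fix x
    have q: "?b\<^sup>2 * (p x \<bullet> x)\<^sup>2 + (?d - 1) / ?d\<^sup>2 * T x = (?d - 1) / ?d\<^sup>2 * ((?d - 2) * (p x \<bullet> x)\<^sup>2 + (norm x)\<^sup>2 * (norm (p x))\<^sup>2)"
      using d unfolding dim_exp_def T_def by (simp add: divide_simps) (simp add: power2_eq_square algebra_simps)
    have "?W x * ennreal (?b\<^sup>2 * (p x \<bullet> x)\<^sup>2) + ennreal ((?d - 1) / ?d\<^sup>2) * (?W x * ennreal (T x))
      = ennreal (energy_weight x * (?b\<^sup>2 * (p x \<bullet> x)\<^sup>2 + (?d - 1) / ?d\<^sup>2 * T x))"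
      using d T0[of x] energy_weight_nonneg[of x] by (intro ennreal_weighted_sum) auto
    then show "?W x * ennreal (?b\<^sup>2 * (p x \<bullet> x)\<^sup>2) + ennreal ((?d - 1) / ?d\<^sup>2) * (?W x * ennreal (T x)) = ennreal (energy_density x (p x))"
      unfolding q energy_density_def by simp
  qed
  finally show ?thesis by (simp add: add_left_mono)
qed

text \<open>The radius r corresponds to t = ln (d - 1), where the logistic function equals (d - 1) /
  d and the radial eigenfunction vanishes. On each ray the value at r is a constant, so subtracting
  it produces the zero that \<open>line_inequality_radial\<close> asks for. Only derivatives along
  rays enter; the angular energy is given away.\<close>

lemma mass_radial_difference_le_energy:
  fixes u :: "real ^ 'n \<Rightarrow> real"
  assumes d: "CARD('n) \<ge> 2" and u: "has_gradient u p"
    and r: "r = exp (dim_exp TYPE('n) * ln (real CARD('n) - 1))"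
  shows "mass (\<lambda>x. u x - u (r *\<^sub>R sgn x)) \<le> energy p"
proof -
  let ?d = "real CARD('n)" and ?b = "dim_exp TYPE('n)"
  define n where "n = CARD('n) - 2"
  have dn: "?d = real n + 2" "CARD('n) - 1 = Suc n" using d by (auto simp: n_def)
  have b: "?b > 0" "(?d - 1) / ?d = ?b" by (rule dim_exp_pos[OF d]) (simp add: dim_exp_def)
  have [measurable]: "u \<in> borel_measurable borel" "p \<in> borel_measurable borel"
    using has_gradient_continuous_fun[OF u] u by (auto simp: has_gradient_def intro: borel_measurable_continuous_onI)
  have [measurable]: "(sgn :: real ^ 'n \<Rightarrow> real ^ 'n) \<in> borel_measurable borel" by (simp add: sgn_div_norm[abs_def])
  have ls: "logistic (ln (?d - 1)) = (?d - 1) / ?d"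
    using d by (simp add: logistic_def exp_minus field_simps)
  have "mass (\<lambda>x. u x - u (r *\<^sub>R sgn x)) \<le> (\<integral>\<^sup>+x. ennreal (inverse (norm x ^ CARD('n)) * (radial_z x ^ n * (?b * (p x \<bullet> x))\<^sup>2)) \<partial>lborel)"
    unfolding mass_def mass_density_def mult.assoc
  proof (rule nn_integral_le_polar[OF d])
    fix y :: "real ^ 'n" assume y: "y \<noteq> 0"
    have D: "((\<lambda>t. u (exp (?b * t) *\<^sub>R sgn y) - u (r *\<^sub>R sgn y)) has_real_derivative ?b * (p (exp (?b * t) *\<^sub>R sgn y) \<bullet> (exp (?b * t) *\<^sub>R sgn y))) (at t)" for t
      using DERIV_diff[OF has_derivative_ray[OF u] DERIV_const] by simp
    have sg: "sgn (exp (?b * t) *\<^sub>R sgn y) = sgn y" for t by (cases "y = 0") (simp_all add: sgn_scaleR, simp add: sgn_div_norm)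
    show "(\<integral>\<^sup>+t. ennreal (?d * (radial_z (exp (?b * t) *\<^sub>R sgn y) ^ (CARD('n) - 1) *
        ((1 - radial_z (exp (?b * t) *\<^sub>R sgn y)) * (u (exp (?b * t) *\<^sub>R sgn y) - u (r *\<^sub>R sgn (exp (?b * t) *\<^sub>R sgn y)))\<^sup>2))) \<partial>lborel) \<le>
      (\<integral>\<^sup>+t. ennreal (radial_z (exp (?b * t) *\<^sub>R sgn y) ^ n * (?b * (p (exp (?b * t) *\<^sub>R sgn y) \<bullet> (exp (?b * t) *\<^sub>R sgn y)))\<^sup>2) \<partial>lborel)"
      using line_inequality_radial[OF D continuous_on_ray[OF u] dn(1) ls]
      unfolding radial_z_ray[OF y less_imp_neq[OF b(1), symmetric]] b dn(2) sg by (simp add: r mult.assoc)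
  qed measurable
  also have "\<dots> \<le> energy p" unfolding energy_def
  proof (intro nn_integral_mono ennreal_leI)
    fix x
    \<comment> \<open>For a radial p the two terms of the energy combine to (d - 1) / d^2 * (d - 1),
      the square of \<open>dim_exp\<close>.\<close>
    have "(?b * (p x \<bullet> x))\<^sup>2 = (?d - 1) / ?d\<^sup>2 * ((?d - 2) * (p x \<bullet> x)\<^sup>2 + (p x \<bullet> x)\<^sup>2)"
      using d unfolding dim_exp_def by (simp add: divide_simps) (simp add: power2_eq_square algebra_simps)
    also have "\<dots> \<le> (?d - 1) / ?d\<^sup>2 * ((?d - 2) * (p x \<bullet> x)\<^sup>2 + (norm x)\<^sup>2 * (norm (p x))\<^sup>2)"
      using d norm_cauchy_schwarz_sq[of "p x" x] by (intro mult_left_mono add_left_mono) auto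
    finally have "(?b * (p x \<bullet> x))\<^sup>2 \<le> (?d - 1) / ?d\<^sup>2 * ((?d - 2) * (p x \<bullet> x)\<^sup>2 + (norm x)\<^sup>2 * (norm (p x))\<^sup>2)" .
    from mult_left_mono[OF this energy_weight_nonneg[of x]]
    show "inverse (norm x ^ CARD('n)) * (radial_z x ^ n * (?b * (p x \<bullet> x))\<^sup>2) \<le> energy_density x (p x)"
      unfolding energy_density_def energy_weight_def n_def by (simp only: mult.assoc)
  qed
  finally show ?thesis .
qed

subsection \<open>Symmetrization by reflections\<close>

definition reflection :: "'a::euclidean_space \<Rightarrow> 'a \<Rightarrow> 'a" where
  "reflection e x = x - (2 * (x \<bullet> e)) *\<^sub>R e"

lemma orthogonal_reflection:
  assumes "norm e = 1" shows "orthogonal_transformation (reflection e)"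
proof -
  have e: "e \<bullet> e = 1" using assms by (simp add: norm_eq_1)
  have "linear (reflection e)"
    by (rule linearI) (simp_all add: reflection_def algebra_simps)
  moreover have "reflection e x \<bullet> reflection e y = x \<bullet> y" for x y
    by (simp add: reflection_def inner_diff_left inner_diff_right e inner_commute algebra_simps)
  ultimately show ?thesis by (simp add: orthogonal_transformation_def)
qed

lemma reflection_reflection: "norm e = 1 \<Longrightarrow> reflection e (reflection e x) = x"
proof -
  assume "norm e = 1"
  then have "reflection e x \<bullet> e = - (x \<bullet> e)" by (simp add: reflection_def inner_diff_left norm_eq_1)
  then show ?thesis unfolding reflection_def[of e "reflection e x"] by (simp add: reflection_def)
qed

lemma dist_reflection: "norm e = 1 \<Longrightarrow> dist (reflection e x) (reflection e y) = dist x y"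
  using orthogonal_reflection orthogonal_transformation_isometry by blast

text \<open>The inverse S of an orthogonal map is its transpose, and the chain rule moves it onto
  the gradient.\<close>

lemma has_gradient_compose_orthogonal:
  fixes u :: "'a::euclidean_space \<Rightarrow> real" and S T :: "'a \<Rightarrow> 'a"
  assumes u: "has_gradient u p" and T: "orthogonal_transformation T" and S: "orthogonal_transformation S"
    and TS: "\<And>x. S (T x) = x"
  shows "has_gradient (\<lambda>x. u (T x)) (\<lambda>x. S (p (T x)))"
proof -
  have bl: "bounded_linear T" "bounded_linear S"
    using T S orthogonal_transformation_linear linear_conv_bounded_linear by blast+
  have c: "continuous_on A T" "continuous_on A S" for A using bl by (auto intro: linear_continuous_on)
  have "((\<lambda>x. u (T x)) has_derivative (\<lambda>h. S (p (T x)) \<bullet> h)) (at x)" for x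
  proof -
    have "(u \<circ> T has_derivative (\<lambda>h. p (T x) \<bullet> h) \<circ> T) (at x)"
      using u bl unfolding has_gradient_def by (intro diff_chain_at bounded_linear_imp_has_derivative) auto
    moreover have "p (T x) \<bullet> T h = S (p (T x)) \<bullet> h" for h
      using S TS[of h] unfolding orthogonal_transformation_def by metis
    ultimately show ?thesis by (simp add: o_def)
  qed
  moreover have "continuous_on UNIV (\<lambda>x. p (T x))"
    using u by (intro continuous_on_compose2[OF _ c(1)]) (auto simp: has_gradient_def)
  then have "continuous_on UNIV (\<lambda>x. S (p (T x)))"
    by (intro continuous_on_compose2[OF c(2)]) auto
  ultimately show ?thesis by (simp add: has_gradient_def)
qed

lemma has_gradient_lincomb:
  assumes "has_gradient u p" "has_gradient v q"
  shows "has_gradient (\<lambda>x. a * u x + b * v x) (\<lambda>x. a *\<^sub>R p x + b *\<^sub>R q x)"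
  using assms unfolding has_gradient_def
  by (auto intro!: derivative_eq_intros continuous_intros simp: inner_add_left)

lemma measurable_has_gradient:
  "has_gradient u p \<Longrightarrow> u \<in> borel_measurable borel" "has_gradient u p \<Longrightarrow> p \<in> borel_measurable borel"
  using has_gradient_continuous_fun[of u p]
  by (auto simp: has_gradient_def intro: borel_measurable_continuous_onI)

lemma mass_compose_orthogonal:
  fixes T :: "real ^ 'n \<Rightarrow> real ^ 'n"
  assumes T: "orthogonal_transformation T" and [measurable]: "u \<in> borel_measurable borel"
  shows "mass (\<lambda>x. u (T x)) = mass u"
  using nn_integral_orthogonal[OF T, of "\<lambda>x. ennreal (mass_density x * (u x)\<^sup>2)"]
  by (simp add: mass_def mass_density_orthogonal[OF T])

lemma energy_compose_orthogonal:
  fixes T :: "real ^ 'n \<Rightarrow> real ^ 'n"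
  assumes T: "orthogonal_transformation T" and [measurable]: "p \<in> borel_measurable borel"
    and TS: "\<And>x. T (S x) = x"
  shows "energy (\<lambda>x. S (p (T x))) = energy p"
proof -
  have "energy_density x (S (p (T x))) = energy_density (T x) (p (T x))" for x
    using energy_density_orthogonal[OF T, of x "S (p (T x))"] by (simp add: TS)
  then have "energy (\<lambda>x. S (p (T x))) = (\<integral>\<^sup>+x. ennreal (energy_density (T x) (p (T x))) \<partial>lborel)"
    by (simp only: energy_def)
  also have "\<dots> = energy p"
    unfolding energy_def by (intro nn_integral_orthogonal[OF T, of "\<lambda>x. ennreal (energy_density x (p x))"] measurable_ennreal_energy_density) fact
  finally show ?thesis .
qed

lemma mass_le_energy_of_vanishing_hyperplane:
  fixes u :: "real ^ 'n \<Rightarrow> real"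
  assumes d: "CARD('n) \<ge> 2" and u: "has_gradient u p" and e: "norm e = 1"
    and 0: "\<And>x. x \<bullet> e = 0 \<Longrightarrow> u x = 0"
  shows "mass u \<le> energy p"
proof -
  fix k :: 'n
  obtain T :: "real ^ 'n \<Rightarrow> real ^ 'n" where T: "orthogonal_transformation T" "T (axis k 1) = e"
    using orthogonal_transformation_exists_1[OF norm_axis_1[of k] e] by blast
  define S where "S = inv T"
  have bij: "bij T" using T(1) by (rule orthogonal_transformation_bij)
  have S: "orthogonal_transformation S" "S (T x) = x" "T (S x) = x" for x
    unfolding S_def using orthogonal_transformation_inv[OF T(1)] bij
    by (auto simp: bij_is_inj bij_is_surj surj_f_inv_f inv_f_f)
  note g = has_gradient_compose_orthogonal[OF u T(1) S(1,2)]
  have z: "u (T x) = 0" if "x $ k = 0" for x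
  proof (rule 0)
    have "T x \<bullet> e = x \<bullet> axis k 1" using T unfolding orthogonal_transformation_def by metis
    then show "T x \<bullet> e = 0" using that by (simp add: inner_axis)
  qed
  have "mass (\<lambda>x. u (T x)) \<le> energy (\<lambda>x. S (p (T x)))"
    by (rule mass_le_energy_of_vanishing[OF d g z])
  then show ?thesis
    using mass_compose_orthogonal[OF T(1), of u] energy_compose_orthogonal[OF T(1), of p S] measurable_has_gradient[OF u] S
    by simp
qed

text \<open>F and G are the values of a quadratic form at a function and at its reflection, A and B
  those at the even and odd parts. Invariance makes the first two integrals equal, and the
  parallelogram law becomes additivity. Cancelling the factor 2 is legitimate also when the
  integrals are infinite.\<close>

lemma nn_integral_parallelogram:
  assumes [measurable]: "F \<in> borel_measurable M" "G \<in> borel_measurable M" "A \<in> borel_measurable M" "B \<in> borel_measurable M"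
    and nn: "\<And>x. 0 \<le> F x" "\<And>x. 0 \<le> G x" "\<And>x. 0 \<le> A x" "\<And>x. 0 \<le> B x"
    and eq: "\<And>x. F x + G x = 2 * (A x + B x)"
    and FG: "(\<integral>\<^sup>+x. ennreal (G x) \<partial>M) = (\<integral>\<^sup>+x. ennreal (F x) \<partial>M)"
  shows "(\<integral>\<^sup>+x. ennreal (F x) \<partial>M) = (\<integral>\<^sup>+x. ennreal (A x) \<partial>M) + (\<integral>\<^sup>+x. ennreal (B x) \<partial>M)"
proof -
  let ?I = "\<lambda>H. \<integral>\<^sup>+x. ennreal (H x) \<partial>M"
  have add: "?I (\<lambda>x. H x + K x) = ?I H + ?I K"
    if [measurable]: "H \<in> borel_measurable M" "K \<in> borel_measurable M" and "\<And>x. 0 \<le> H x" "\<And>x. 0 \<le> K x" for H K :: "'a \<Rightarrow> real"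
    using that(3,4) by (simp add: ennreal_plus nn_integral_add)
  have "2 * ?I F = ?I (\<lambda>x. F x + G x)"
    using nn by (subst add) (simp_all add: FG mult_2)
  also have "\<dots> = 2 * (?I A + ?I B)"
  proof -
    have "?I (\<lambda>x. F x + G x) = (\<integral>\<^sup>+x. 2 * ennreal (A x + B x) \<partial>M)"
      using nn unfolding eq by (intro nn_integral_cong) (subst ennreal_mult, auto simp del: ennreal_plus)
    also have "\<dots> = 2 * ?I (\<lambda>x. A x + B x)" by (rule nn_integral_cmult) simp
    finally show ?thesis using nn by (simp add: add del: ennreal_plus)
  qed
  finally show ?thesis unfolding ennreal_mult_cancel_left by auto
qed

text \<open>q and r are the gradients of the even and the odd part. A constant is even, so
  subtracting c affects the even part alone; the odd part vanishes on the mirror and its mass is at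
  most its energy. The energy of r appears in both conclusions and is left there, since it may be
  infinite and cannot be cancelled.\<close>

lemma symmetrization_step:
  fixes u :: "real ^ 'n \<Rightarrow> real"
  assumes d: "CARD('n) \<ge> 2" and u: "has_gradient u p" and e: "norm e = 1"
  defines "v \<equiv> \<lambda>x. (u x + u (reflection e x)) / 2"
  shows "\<exists>q (r :: real ^ 'n \<Rightarrow> real ^ 'n). has_gradient v q \<and>
    (\<forall>c. mass (\<lambda>x. u x - c) \<le> mass (\<lambda>x. v x - c) + energy r) \<and> energy p = energy q + energy r"
proof -
  let ?s = "reflection e"
  note o = orthogonal_reflection[OF e] and ss = reflection_reflection[OF e]
  let ?p = "\<lambda>x. ?s (p (?s x))"
  have us: "has_gradient (\<lambda>x. u (?s x)) ?p"
    by (rule has_gradient_compose_orthogonal[OF u o o ss])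
  define q where "q x = (1/2) *\<^sub>R p x + (1/2) *\<^sub>R ?p x" for x
  define r where "r x = (1/2) *\<^sub>R p x + (-1/2) *\<^sub>R ?p x" for x
  define w where "w x = (u x - u (?s x)) / 2" for x
  have v: "has_gradient v q"
    using has_gradient_lincomb[OF u us, of "1/2" "1/2"] unfolding v_def q_def[abs_def] by (simp add: add_divide_distrib)
  have w: "has_gradient w r"
    using has_gradient_lincomb[OF u us, of "1/2" "-1/2"] unfolding w_def[abs_def] r_def[abs_def] by (simp add: diff_divide_distrib)
  note [measurable] = measurable_has_gradient[OF u] measurable_has_gradient[OF us]
     measurable_has_gradient[OF v] measurable_has_gradient[OF w]
  have w0: "mass w \<le> energy r"
  proof (rule mass_le_energy_of_vanishing_hyperplane[OF d w e])
    fix x assume "x \<bullet> e = 0" then show "w x = 0" by (simp add: w_def reflection_def)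
  qed
  have m: "mass (\<lambda>x. u x - c) = mass (\<lambda>x. v x - c) + mass w" for c
    unfolding mass_def
  proof (rule nn_integral_parallelogram)
    show "(\<integral>\<^sup>+x. ennreal (mass_density x * (u (?s x) - c)\<^sup>2) \<partial>lborel) = (\<integral>\<^sup>+x. ennreal (mass_density x * (u x - c)\<^sup>2) \<partial>lborel)"
      using mass_compose_orthogonal[OF o, of "\<lambda>x. u x - c"] by (simp add: mass_def)
    show "mass_density x * (u x - c)\<^sup>2 + mass_density x * (u (?s x) - c)\<^sup>2
        = 2 * (mass_density x * (v x - c)\<^sup>2 + mass_density x * (w x)\<^sup>2)" for x
      unfolding v_def w_def by (simp add: power2_eq_square field_simps)
  qed (simp_all add: mass_density_nonneg)
  have en: "energy p = energy q + energy r"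
    unfolding energy_def
  proof (rule nn_integral_parallelogram)
    show "(\<integral>\<^sup>+x. ennreal (energy_density x (?p x)) \<partial>lborel) = (\<integral>\<^sup>+x. ennreal (energy_density x (p x)) \<partial>lborel)"
      using energy_compose_orthogonal[OF o, of p ?s] ss by (simp add: energy_def)
    show "energy_density x (p x) + energy_density x (?p x) = 2 * (energy_density x (q x) + energy_density x (r x))" for x
    proof -
      have "(norm ((1/2) *\<^sub>R y + (1/2) *\<^sub>R z))\<^sup>2 = (a + b) / 2 - (norm ((1/2) *\<^sub>R y + (-1/2) *\<^sub>R z))\<^sup>2"
        if "a = (norm y)\<^sup>2" "b = (norm z)\<^sup>2" for a b and y z :: "real ^ 'n"
        unfolding that power2_norm_eq_inner by (simp add: inner_simps inner_commute algebra_simps)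
      from this[OF refl refl, of "p x" "?p x"]
      have n: "(norm (q x))\<^sup>2 = ((norm (p x))\<^sup>2 + (norm (?p x))\<^sup>2) / 2 - (norm (r x))\<^sup>2"
        unfolding q_def r_def .
      show ?thesis
        unfolding energy_density_def n
        by (simp add: q_def r_def inner_simps power2_eq_square field_simps)
    qed
  qed (use d in \<open>simp_all add: energy_density_nonneg measurable_energy_density\<close>)
  show ?thesis
    by (intro exI[of _ q] exI[of _ r] conjI allI v en) (simp add: m add_left_mono w0)
qed

inductive symmetrized :: "(real ^ 'n \<Rightarrow> real) \<Rightarrow> (real ^ 'n \<Rightarrow> real) \<Rightarrow> bool" for u where
  refl: "symmetrized u u"
| step: "symmetrized u v \<Longrightarrow> norm e = 1 \<Longrightarrow> symmetrized u (\<lambda>x. (v x + v (reflection e x)) / 2)"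

text \<open>An estimate for v is carried back to u along the chain of reflections. At each step the
  energy of the odd part is added on both sides; the condition 1 <= a makes room for it in a *
  energy, and k passes through unchanged.\<close>

lemma symmetrized_gradient:
  fixes u :: "real ^ 'n \<Rightarrow> real"
  assumes d: "CARD('n) \<ge> 2" and u: "has_gradient u p" and v: "symmetrized u v"
  shows "\<exists>q. has_gradient v q \<and> (\<forall>c a k. 1 \<le> a \<longrightarrow> mass (\<lambda>x. v x - c) \<le> a * energy q + k \<longrightarrow>
    mass (\<lambda>x. u x - c) \<le> a * energy p + k)"
  using v
proof induction
  case refl
  show ?case using u by blast
next
  case (step v e)
  then obtain q where q: "has_gradient v q"
    "\<And>c a k. 1 \<le> a \<Longrightarrow> mass (\<lambda>x. v x - c) \<le> a * energy q + k \<Longrightarrow> mass (\<lambda>x. u x - c) \<le> a * energy p + k"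
    by blast
  let ?v = "\<lambda>x. (v x + v (reflection e x)) / 2"
  obtain q' and r :: "real ^ 'n \<Rightarrow> real ^ 'n" where r: "has_gradient ?v q'" "\<And>c. mass (\<lambda>x. v x - c) \<le> mass (\<lambda>x. ?v x - c) + energy r"
    "energy q = energy q' + energy r"
    using symmetrization_step[OF d q(1) step.hyps(2)] by blast
  show ?case
  proof (intro exI[of _ q'] conjI r(1) allI impI)
    fix c a k assume a: "1 \<le> (a::ennreal)" and le: "mass (\<lambda>x. ?v x - c) \<le> a * energy q' + k"
    have "mass (\<lambda>x. v x - c) \<le> (a * energy q' + k) + a * energy r"
    proof -
      have "energy r \<le> a * energy r" using mult_right_mono[OF a, of "energy r"] by simp
      then show ?thesis using r(2)[of c] le add_mono[of _ _ "energy r"] order_trans by blast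
    qed
    also have "\<dots> = a * energy q + k" by (simp add: r(3) distrib_left add_ac)
    finally show "mass (\<lambda>x. u x - c) \<le> a * energy p + k" by (rule q(2)[OF a])
  qed
qed

text \<open>Suppose that \<open>v\<close> nearly minimises the maximum on the sphere and is low on a small ball. Averaging
  with a reflection that maps this ball to another one makes the average low on both; after finitely many
  steps, their number depending only on the common modulus of continuity, it is low everywhere.\<close>
lemma symmetrized_almost_constant:
  fixes u :: "real ^ 'n \<Rightarrow> real"
  assumes u: "continuous_on UNIV u" and r: "0 < r" and del: "0 < del"
  shows "\<exists>v. symmetrized u v \<and> (\<forall>x\<in>sphere 0 r. \<forall>y\<in>sphere 0 r. \<bar>v x - v y\<bar> \<le> del)"
proof -
  define S where "S = sphere (0::real^'n) r"
  have cS: "compact S" by (simp add: S_def)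
  have nS: "reflection e x \<in> S" if "norm e = 1" "x \<in> S" for e x
    using that orthogonal_transformation_norm[OF orthogonal_reflection[OF that(1)], of x] by (simp add: S_def)
  have neS: "S \<noteq> {}" using r vector_choose_size[of r] by (force simp: S_def)
  have cu: "continuous_on S u" using u continuous_on_subset by blast
  have "uniformly_continuous_on S u" by (rule compact_uniformly_continuous[OF cu cS])
  then obtain rho where rho: "rho > 0" "\<And>x y. x \<in> S \<Longrightarrow> y \<in> S \<Longrightarrow> dist x y < rho \<Longrightarrow> \<bar>u x - u y\<bar> < del / 2"
    unfolding uniformly_continuous_on_def dist_real_def
    by (metis del half_gt_zero dist_commute)
  \<comment> \<open>Averaging with an isometry of the sphere preserves the modulus of continuity, so
    one rho serves all symmetrized functions.\<close>
  have mod: "\<forall>x\<in>S. \<forall>y\<in>S. dist x y < rho \<longrightarrow> \<bar>v x - v y\<bar> < del / 2" if "symmetrized u v" for v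
    using that
  proof induction
    case (step v e)
    show ?case
    proof (intro ballI impI)
      fix x y assume xy: "x \<in> S" "y \<in> S" "dist x y < rho"
      have 1: "\<bar>v x - v y\<bar> < del / 2" using step.IH xy by blast
      have "dist (reflection e x) (reflection e y) < rho" using xy(3) dist_reflection[OF step.hyps(2), of x y] by simp
      then have 2: "\<bar>v (reflection e x) - v (reflection e y)\<bar> < del / 2"
        using step.IH nS[OF step.hyps(2)] xy(1,2) by blast
      have "(v x + v (reflection e x)) / 2 - (v y + v (reflection e y)) / 2 = (v x - v y) / 2 + (v (reflection e x) - v (reflection e y)) / 2"
        by (simp add: add_divide_distrib diff_divide_distrib)
      also have "\<bar>\<dots>\<bar> \<le> \<bar>v x - v y\<bar> / 2 + \<bar>v (reflection e x) - v (reflection e y)\<bar> / 2"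
        using abs_triangle_ineq[of "(v x - v y) / 2" "(v (reflection e x) - v (reflection e y)) / 2"] by simp
      also have "\<dots> < (del / 2) / 2 + (del / 2) / 2" using 1 2 by (intro add_strict_mono divide_strict_right_mono) auto
      finally show "\<bar>(v x + v (reflection e x)) / 2 - (v y + v (reflection e y)) / 2\<bar> < del / 2" by simp
    qed
  qed (use rho in blast)
  obtain m0 where m0: "\<And>x. x \<in> S \<Longrightarrow> m0 \<le> u x"
    using continuous_attains_inf[OF cS neS cu] by blast
  have low: "\<forall>x\<in>S. m0 \<le> v x" if "symmetrized u v" for v
    using that
  proof induction
    case (step v e)
    show ?case
    proof
      fix x assume "x \<in> S"
      then have "m0 \<le> v x" "m0 \<le> v (reflection e x)" using step.IH nS[OF step.hyps(2), of x] by blast+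
      then show "m0 \<le> (v x + v (reflection e x)) / 2" by simp
    qed
  qed (use m0 in blast)
  \<comment> \<open>The upper bounds on S attained by some symmetrized function; the common lower
    bound \<open>m0\<close> makes the infimum meaningful.\<close>
  define A where "A = {a. \<exists>v. symmetrized u v \<and> (\<forall>x\<in>S. v x \<le> a)}"
  have "A \<noteq> {}"
    using continuous_attains_sup[OF cS neS cu] symmetrized.refl unfolding A_def by blast
  obtain z where z: "z \<in> S" using neS by blast
  have bdd: "bdd_below A"
  proof (rule bdd_belowI[of _ m0])
    fix a assume "a \<in> A"
    then obtain v where "symmetrized u v" "\<forall>x\<in>S. v x \<le> a" unfolding A_def by blast
    then show "m0 \<le> a" using low[of v] z by (meson order_trans)
  qed
  have bo: "open (ball q rho)" for q :: "real ^ 'n" by simp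
  have bS: "S \<subseteq> (\<Union>q\<in>S. ball q rho)" using rho(1) by auto
  obtain P where P: "P \<subseteq> S" "finite P" "S \<subseteq> (\<Union>q\<in>P. ball q rho)"
    by (rule compactE_image[OF cS bo bS]) (rule that)
  \<comment> \<open>At most \<open>card P\<close> reflections will be used. The gain starts at del /
    2 and is halved by each of them.\<close>
  define kap where "kap = (del / 2) / 2 ^ card P"
  have kap: "kap > 0" using del by (simp add: kap_def)
  obtain a v where a: "a < Inf A + kap" and v: "symmetrized u v" "\<And>x. x \<in> S \<Longrightarrow> v x \<le> a"
    using cInf_lessD[OF \<open>A \<noteq> {}\<close>, of "Inf A + kap"] kap unfolding A_def by auto
  have "\<bar>v x - v y\<bar> \<le> del" if xy: "x \<in> S" "y \<in> S" for x y
  proof (rule ccontr)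
    assume "\<not> \<bar>v x - v y\<bar> \<le> del"
    \<comment> \<open>Both values are at most a and differ by more than del, so the smaller one lies
      below a - del. By the modulus of continuity v stays below a - del / 2 near that point.\<close>
    then obtain x0 where x0: "x0 \<in> S" "v x0 < a - del"
      using xy v(2)[OF xy(1)] v(2)[OF xy(2)] by (cases "v x \<le> v y") force+
    have near: "v z \<le> a - del / 2" if "z \<in> S" "dist x0 z < rho" for z
      using mod[OF v(1), rule_format, OF x0(1) that] x0(2) unfolding abs_less_iff by linarith
    have "\<exists>w. symmetrized u w \<and> (\<forall>x\<in>S. w x \<le> a) \<and>
        (\<forall>x\<in>S. x \<in> ball x0 rho \<union> (\<Union>q\<in>Q. ball q rho) \<longrightarrow> w x \<le> a - (del / 2) / 2 ^ card Q)"
      if "finite Q" "Q \<subseteq> P" for Q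
      using that
    proof (induction Q)
      case empty
      show ?case using v near by (intro exI[of _ v]) auto
    next
      case (insert q Q)
      then have "Q \<subseteq> P" by blast
      then obtain w where w0: "symmetrized u w" "\<forall>x\<in>S. w x \<le> a"
        "\<forall>x\<in>S. x \<in> ball x0 rho \<union> (\<Union>q\<in>Q. ball q rho) \<longrightarrow> w x \<le> a - (del / 2) / 2 ^ card Q"
        using insert.IH by blast
      note w = w0(1) w0(2)[rule_format] w0(3)[rule_format]
      define b where "b = (del / 2) / 2 ^ card Q"
      have b: "0 < b" "(del / 2) / 2 ^ card (insert q Q) = b / 2" using insert del by (simp_all add: b_def)
      have qS: "q \<in> S" using insert P by auto
      show ?case
      proof (cases "q = x0")
        case True
        then show ?thesis using w b unfolding b_def[symmetric]
          by (intro exI[of _ w]) (fastforce simp: b_def[symmetric])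
      next
        case False
        \<comment> \<open>q and \<open>x0\<close> have the same norm, so the reflection in the
          hyperplane orthogonal to q - x0 exchanges them.\<close>
        define e where "e = (1 / norm (q - x0)) *\<^sub>R (q - x0)"
        have e: "norm e = 1" using False by (simp add: e_def)
        have "q \<bullet> q = x0 \<bullet> x0" using qS x0(1) by (simp add: S_def dot_square_norm)
        then have "2 * (q \<bullet> (q - x0)) = (norm (q - x0))\<^sup>2"
          by (simp add: power2_norm_eq_inner inner_diff_left inner_diff_right inner_commute)
        moreover have "q \<bullet> e = (q \<bullet> (q - x0)) / norm (q - x0)" unfolding e_def inner_scaleR_right by simp
        ultimately have "2 * (q \<bullet> e) = norm (q - x0)"
          using False by (simp add: power2_eq_square)
        then have rq: "reflection e q = x0" using False by (simp add: reflection_def e_def)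
        let ?w = "\<lambda>x. (w x + w (reflection e x)) / 2"
        have "?w x \<le> a" if "x \<in> S" for x
          using w(2)[OF that] w(2)[OF nS[OF e that]] by simp
        \<comment> \<open>One of the two averaged values is at most a - b, the other at most
          a.\<close>
        moreover have "?w x \<le> a - b / 2" if x: "x \<in> S" "x \<in> ball x0 rho \<union> (\<Union>q\<in>insert q Q. ball q rho)" for x
        proof (cases "x \<in> ball q rho")
          case True
          have "dist (reflection e q) (reflection e x) = dist q x"
            using dist_reflection[OF e] by blast
          then have "w (reflection e x) \<le> a - b"
            using w(3)[OF nS[OF e x(1)]] True rq by (simp add: b_def)
          then show ?thesis using w(2)[OF x(1)] by simp
        next
          case False
          then have "w x \<le> a - b" using w(3)[OF x(1)] x(2) by (auto simp: b_def)
          then show ?thesis using w(2)[OF nS[OF e x(1)]] by simp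
        qed
        ultimately show ?thesis unfolding b
          using symmetrized.step[OF w(1) e] by (intro exI[of _ ?w]) blast
      qed
    qed
    from this[OF P(2) order_refl] obtain w where "symmetrized u w" "\<And>x. x \<in> S \<Longrightarrow> w x \<le> a - kap"
      using P(3) unfolding kap_def by blast
    then have "a - kap \<in> A" unfolding A_def by blast
    \<comment> \<open>A bound lower by \<open>kap\<close> has been reached, although a was within
      \<open>kap\<close> of the infimum.\<close>
    then have "Inf A \<le> a - kap" using bdd by (rule cInf_lower)
    then show False using a by simp
  qed
  then show ?thesis using v(1) unfolding S_def by blast
qed

subsection \<open>The inequality for smooth functions\<close>

lemma nn_integral_FTC_atMost:
  fixes f F :: "real \<Rightarrow> real"
  assumes [measurable]: "f \<in> borel_measurable borel"
    and F: "\<And>x. x \<le> a \<Longrightarrow> (F has_real_derivative f x) (at x)" and nn: "\<And>x. x \<le> a \<Longrightarrow> 0 \<le> f x"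
    and lim: "(F \<longlongrightarrow> L) at_bot"
  shows "(\<integral>\<^sup>+x. ennreal (f x) * indicator {..a} x \<partial>lborel) = ennreal (F a - L)"
proof -
  have "(\<integral>\<^sup>+x. ennreal (f x) * indicator {..a} x \<partial>lborel) = (\<integral>\<^sup>+x. ennreal (f (- x)) * indicator {-a..} x \<partial>lborel)"
    by (subst nn_integral_real_affine[of _ "-1" 0]) (auto intro!: nn_integral_cong simp: indicator_def)
  also have "\<dots> = ennreal (- L - (- F (- (- a))))"
  proof (rule nn_integral_FTC_atLeast)
    fix x assume "- a \<le> x"
    then have "(F has_real_derivative f (- x)) (at (- x))" "0 \<le> f (- x)" using F nn by auto
    then show "((\<lambda>x. - F (- x)) has_real_derivative f (- x)) (at x)" "0 \<le> f (- x)"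
      using DERIV_mirror[of F "f (- x)" x] by (auto intro!: derivative_eq_intros)
  next
    show "((\<lambda>x. - F (- x)) \<longlongrightarrow> - L) at_top"
      by (intro tendsto_minus filterlim_compose[OF lim] filterlim_uminus_at_bot_at_top)
  qed measurable
  finally show ?thesis by simp
qed

lemma nn_integral_FTC_line:
  fixes f F :: "real \<Rightarrow> real"
  assumes [measurable]: "f \<in> borel_measurable borel"
    and F: "\<And>x. (F has_real_derivative f x) (at x)" and nn: "\<And>x. 0 \<le> f x"
    and lim: "(F \<longlongrightarrow> L) at_bot" "(F \<longlongrightarrow> M) at_top"
  shows "(\<integral>\<^sup>+x. ennreal (f x) \<partial>lborel) = ennreal (M - L)"
proof -
  have mono: "F x \<le> F y" if "x \<le> y" for x y
    using F nn that by (meson DERIV_nonneg_imp_nondecreasing)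
  have "\<forall>\<^sub>F x in at_bot. F x \<le> F 0" "\<forall>\<^sub>F x in at_top. F 0 \<le> F x"
    by (rule eventually_mono[OF eventually_le_at_bot[of 0]] eventually_mono[OF eventually_ge_at_top[of 0]], rule mono, assumption)+
  then have LM: "L \<le> F 0" "F 0 \<le> M"
    using tendsto_upperbound[OF lim(1)] tendsto_lowerbound[OF lim(2)] by auto
  have "(\<integral>\<^sup>+x. ennreal (f x) \<partial>lborel) = (\<integral>\<^sup>+x. ennreal (f x) * indicator {..0} x + ennreal (f x) * indicator {0..} x \<partial>lborel)"
    using AE_lborel_singleton[of 0] by (intro nn_integral_cong_AE, eventually_elim) (auto simp: indicator_def)
  also have "\<dots> = ennreal (F 0 - L) + ennreal (M - F 0)"
    using nn_integral_FTC_atMost[of f 0 F L] nn_integral_FTC_atLeast[of f 0 F M] assms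
    by (subst nn_integral_add) auto
  also have "\<dots> = ennreal (M - L)" using LM by (subst ennreal_plus[symmetric]) auto
  finally show ?thesis .
qed

lemma logistic_limits: "(logistic \<longlongrightarrow> 0) at_bot" "(logistic \<longlongrightarrow> 1) at_top"
proof -
  have m: "filterlim (\<lambda>t::real. - t) at_top at_bot" by (rule filterlim_uminus_at_top_at_bot)
  have "filterlim (\<lambda>t. 1 + exp (- t)) at_top (at_bot :: real filter)"
    by (intro filterlim_tendsto_add_at_top[OF tendsto_const] filterlim_compose[OF exp_at_top m])
  then show "(logistic \<longlongrightarrow> 0) at_bot"
    unfolding logistic_def[abs_def] by (intro tendsto_divide_0[OF tendsto_const] filterlim_at_top_imp_at_infinity)
  have "((\<lambda>t. 1 / (1 + exp (- t))) \<longlongrightarrow> 1 / (1 + 0)) (at_top :: real filter)"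
    by (intro tendsto_intros filterlim_compose[OF exp_at_bot filterlim_uminus_at_bot_at_top]) auto
  then show "(logistic \<longlongrightarrow> 1) at_top" unfolding logistic_def[abs_def] by simp
qed

text \<open>The annulus integral K of the polar formula is never evaluated. Applying the formula a
  second time, to the indicator of the unit ball, expresses K through the volume of the ball, and d
  times that volume is the area of the sphere.\<close>

lemma total_mass:
  assumes d: "CARD('n) \<ge> 2"
  shows "(\<integral>\<^sup>+x. ennreal (mass_density (x :: real ^ 'n)) \<partial>lborel) = ennreal (sphere_measure (sphere (0 :: real ^ 'n) 1))"
proof -
  let ?d = "real CARD('n)" and ?b = "dim_exp TYPE('n)"
  define n where "n = CARD('n) - 2"
  have dn: "?d = real n + 2" "CARD('n) - 1 = Suc n" using d by (auto simp: n_def)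
  have b: "?b > 0" by (rule dim_exp_pos[OF d])
  have [measurable]: "cball (0 :: real ^ 'n) 1 \<in> sets borel" by simp
  define K where "K = (\<integral>\<^sup>+y. ennreal (inverse (norm y ^ DIM(real^'n))) * indicator {y::real^'n. 1 \<le> norm y \<and> norm y < exp ?b} y \<partial>lborel)"
  have polar: "(\<integral>\<^sup>+x. ennreal (inverse (norm x ^ DIM(real^'n))) * f x \<partial>lborel) = K * c"
    if [measurable]: "f \<in> borel_measurable borel" and c: "\<And>y::real^'n. y \<noteq> 0 \<Longrightarrow> (\<integral>\<^sup>+t. f (exp (?b * t) *\<^sub>R sgn y) \<partial>lborel) = c" for f c
  proof -
    have "(\<integral>\<^sup>+x. ennreal (inverse (norm x ^ DIM(real^'n))) * f x \<partial>lborel) =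
      (\<integral>\<^sup>+y. ennreal (inverse (norm y ^ DIM(real^'n))) * indicator {y::real^'n. 1 \<le> norm y \<and> norm y < exp ?b} y * (\<integral>\<^sup>+t. f (exp (?b * t) *\<^sub>R sgn y) \<partial>lborel) \<partial>lborel)"
      by (rule nn_integral_polar[OF _ b]) measurable
    also have "\<dots> = (\<integral>\<^sup>+y. ennreal (inverse (norm y ^ DIM(real^'n))) * indicator {y::real^'n. 1 \<le> norm y \<and> norm y < exp ?b} y * c \<partial>lborel)"
      using AE_lborel_singleton[of "0::real^'n"]
      by (intro nn_integral_cong_AE, eventually_elim) (simp add: c)
    also have "\<dots> = K * c" unfolding K_def by (rule nn_integral_multc) measurable
    finally show ?thesis .
  qed
  have "(\<integral>\<^sup>+x. ennreal (mass_density (x :: real ^ 'n)) \<partial>lborel) =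
     (\<integral>\<^sup>+x. ennreal (inverse (norm x ^ DIM(real^'n))) * ennreal (?d * radial_z (x :: real ^ 'n) ^ Suc n * (1 - radial_z x)) \<partial>lborel)"
    unfolding mass_density_def dn(2) by (simp add: ennreal_mult')
  also have "\<dots> = K * ennreal (?d / (?d - 1))"
  proof (rule polar)
    fix y :: "real ^ 'n" assume y: "y \<noteq> 0"
    have "(\<integral>\<^sup>+t. ennreal (?d * logistic t ^ Suc n * (1 - logistic t)) \<partial>lborel) = ennreal (?d / real (Suc n) * 1 ^ Suc n - ?d / real (Suc n) * 0 ^ Suc n)"
    proof (rule nn_integral_FTC_line)
      show "((\<lambda>t. ?d / real (Suc n) * logistic t ^ Suc n) has_real_derivative ?d * logistic t ^ Suc n * (1 - logistic t)) (at t)" for t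
        using DERIV_cmult[OF DERIV_logistic_power[of "Suc n" t], of "?d / real (Suc n)"] by (simp add: mult.assoc del: of_nat_Suc power_Suc)
      show "0 \<le> ?d * logistic t ^ Suc n * (1 - logistic t)" for t
        using logistic_bounds[of t] by (intro mult_nonneg_nonneg) auto
      show "(\<lambda>t. ?d * logistic t ^ Suc n * (1 - logistic t)) \<in> borel_measurable borel" by measurable
    qed (intro tendsto_intros logistic_limits)+
    then show "(\<integral>\<^sup>+t. ennreal (?d * radial_z (exp (?b * t) *\<^sub>R sgn y) ^ Suc n * (1 - radial_z (exp (?b * t) *\<^sub>R sgn y))) \<partial>lborel) = ennreal (?d / (?d - 1))"
      using dn(1) unfolding radial_z_ray[OF y less_imp_neq[OF b, symmetric]] by simp
  qed measurable
  also have "\<dots> = ennreal ?d * (K * ennreal (1 / (?d - 1)))"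
    using d by (simp add: mult.left_commute ennreal_mult'[symmetric])
  \<comment> \<open>The factor \<open>norm x ^ d\<close> cancels the weight, so the right-hand side
    is the volume of the unit ball; along a ray the integrand is exp ((d - 1) * t) for t <=
    0.\<close>
  also have "K * ennreal (1 / (?d - 1)) = (\<integral>\<^sup>+x. ennreal (inverse (norm x ^ DIM(real^'n))) * (ennreal (norm x ^ CARD('n)) * indicator (cball (0::real^'n) 1) x) \<partial>lborel)"
  proof (rule polar[symmetric])
    fix y :: "real ^ 'n" assume y: "y \<noteq> 0"
    have "(\<integral>\<^sup>+t. ennreal (exp ((?d - 1) * t)) * indicator {..0} t \<partial>lborel) = ennreal (exp ((?d - 1) * 0) / (?d - 1) - 0)"
    proof (rule nn_integral_FTC_atMost)
      show "((\<lambda>t. exp ((?d - 1) * t) / (?d - 1)) has_real_derivative exp ((?d - 1) * t)) (at t)" for t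
        using d by (auto intro!: derivative_eq_intros)
      have "((\<lambda>t. exp ((?d - 1) * t)) \<longlongrightarrow> 0) at_bot"
        using d by (intro filterlim_compose[OF exp_at_bot] filterlim_tendsto_pos_mult_at_bot[OF tendsto_const]) (auto intro: filterlim_ident)
      then show "((\<lambda>t. exp ((?d - 1) * t) / (?d - 1)) \<longlongrightarrow> 0) at_bot" by (rule tendsto_divide_zero)
    qed auto
    moreover have "ennreal (norm (exp (?b * t) *\<^sub>R sgn y) ^ CARD('n)) * indicator (cball (0::real^'n) 1) (exp (?b * t) *\<^sub>R sgn y) =
      ennreal (exp ((?d - 1) * t)) * indicator {..0} t" for t
    proof -
      have "?d * (?b * t) = (?d - 1) * t" by (simp add: dim_exp_def)
      moreover have "exp (?b * t) \<le> 1 \<longleftrightarrow> t \<le> 0" using b by (simp add: mult_le_0_iff)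
      ultimately show ?thesis using y by (simp add: norm_sgn indicator_def flip: exp_of_nat_mult)
    qed
    ultimately show "(\<integral>\<^sup>+t. ennreal (norm (exp (?b * t) *\<^sub>R sgn y) ^ CARD('n)) * indicator (cball (0::real^'n) 1) (exp (?b * t) *\<^sub>R sgn y) \<partial>lborel) = ennreal (1 / (?d - 1))"
      by simp
  qed measurable
  also have "\<dots> = (\<integral>\<^sup>+x. indicator (cball (0::real^'n) 1) x \<partial>lborel)"
    using AE_lborel_singleton[of "0::real^'n"]
    by (intro nn_integral_cong_AE, eventually_elim) (simp add: indicator_def ennreal_mult'[symmetric])
  also have "\<dots> = ennreal (unit_ball_vol ?d)"
    by (simp add: emeasure_cball)
  also have "ennreal ?d * \<dots> = ennreal (sphere_measure (sphere (0 :: real ^ 'n) 1))"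
  proof -
    have "Gamma (?d / 2 + 1) = ?d / 2 * Gamma (?d / 2)"
      using nonpos_Ints_nonpos[of "?d / 2"] by (intro Gamma_plus1) fastforce
    then have "?d * unit_ball_vol ?d = sphere_measure (sphere (0 :: real ^ 'n) 1)"
      unfolding sphere_measure_unit_sphere unit_ball_vol_def by (simp only:) simp
    then show ?thesis by (simp flip: ennreal_mult')
  qed
  finally show ?thesis .
qed

lemma radial_z_eq:
  fixes x :: "real ^ 'n"
  assumes "CARD('n) \<ge> 2" "x \<noteq> 0"
  defines "s \<equiv> norm x powr (real CARD('n) / (real CARD('n) - 1))"
  shows "radial_z x = s / (1 + s)"
proof -
  have "s = exp (ln (norm x) / dim_exp TYPE('n))"
    using assms by (simp add: s_def powr_def dim_exp_def mult.commute)
  then show ?thesis by (simp add: radial_z_def logistic_def exp_minus) (simp add: field_simps add_pos_pos)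
qed

lemma mass_density_eq:
  fixes x :: "real ^ 'n"
  assumes d: "CARD('n) \<ge> 2" and x: "x \<noteq> 0"
  shows "mass_density x = real CARD('n) * (1 / (1 + norm x powr (real CARD('n) / (real CARD('n) - 1))) ^ CARD('n))"
proof -
  let ?d = "real CARD('n)"
  define n where "n = CARD('n) - 2"
  have dn: "?d = real n + 2" "CARD('n) = Suc (Suc n)" "CARD('n) - 1 = Suc n" using d by (auto simp: n_def)
  define s where "s = norm x powr (?d / (?d - 1))"
  have s: "s > 0" using x by (simp add: s_def)
  have z: "radial_z x = s / (1 + s)" unfolding s_def by (rule radial_z_eq[OF d x])
  \<comment> \<open>The exponent d / (d - 1) is chosen such that the power d - 1 of s is the power d
    of the norm; this cancels the singular factor of \<open>mass_density\<close>.\<close>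
  have sd: "s ^ Suc n = norm x ^ CARD('n)"
  proof -
    have "s ^ Suc n = s powr real (Suc n)" using s by (simp only: powr_realpow)
    also have "\<dots> = norm x powr (?d / (?d - 1) * real (Suc n))" unfolding s_def powr_powr ..
    also have "?d / (?d - 1) * real (Suc n) = ?d" using dn(1) by simp
    finally show ?thesis using x by (simp add: powr_realpow)
  qed
  have "mass_density x = inverse (s ^ Suc n) * (?d * (s / (1 + s)) ^ Suc n * (1 - s / (1 + s)))"
    unfolding mass_density_def z sd dn(3) ..
  also have "1 - s / (1 + s) = 1 / (1 + s)" using s by (simp add: field_simps)
  also have "inverse (s ^ Suc n) * (?d * (s / (1 + s)) ^ Suc n * (1 / (1 + s))) = ?d * (1 / (1 + s) ^ Suc (Suc n))"
    using s unfolding power_divide by (simp add: field_simps)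
  finally show ?thesis by (simp add: s_def dn(2)[symmetric] del: power_Suc)
qed

text \<open>After symmetrization v is only nearly constant on the sphere of radius r. Splitting v -
  c into the difference from the value on that sphere and the oscillation there costs a factor 1 +
  eta and an additive error, and both disappear in the final limit.\<close>

lemma smooth_poincare:
  fixes u :: "real ^ 'n \<Rightarrow> real"
  assumes d: "CARD('n) \<ge> 2" and u: "has_gradient u p" and eta: "0 < eta"
  shows "\<exists>c. mass (\<lambda>x. u x - c) \<le> ennreal (1 + eta) * energy p + ennreal eta"
proof -
  define r where "r = exp (dim_exp TYPE('n) * ln (real CARD('n) - 1))"
  have r: "r > 0" by (simp add: r_def)
  define A where "A = sphere_measure (sphere (0 :: real ^ 'n) 1)"
  have A: "A \<ge> 0" by (simp add: A_def sphere_measure_def)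
  \<comment> \<open>Solves (1 + 1 / eta) * del^2 * (A + 1) = eta, where A is the total mass.\<close>
  define del where "del = sqrt (eta / ((1 + 1 / eta) * (A + 1)))"
  have del: "del > 0" "(1 + 1 / eta) * del\<^sup>2 * A \<le> eta"
  proof -
    have "eta / ((1 + 1 / eta) * (A + 1)) > 0" using eta A by (intro divide_pos_pos mult_pos_pos add_pos_pos add_nonneg_pos) auto
    then show "del > 0" by (simp add: del_def)
    have "del\<^sup>2 = eta / ((1 + 1 / eta) * (A + 1))"
      using \<open>eta / ((1 + 1 / eta) * (A + 1)) > 0\<close> by (simp add: del_def)
    moreover have "1 + 1 / eta > 0" using eta by (intro add_pos_pos) auto
    ultimately have "(1 + 1 / eta) * del\<^sup>2 * A = eta * (A / (A + 1))" by simp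
    also have "\<dots> \<le> eta * 1" using A eta by (intro mult_left_mono) auto
    finally show "(1 + 1 / eta) * del\<^sup>2 * A \<le> eta" by simp
  qed
  obtain v where v: "symmetrized u v" "\<And>x y. x \<in> sphere 0 r \<Longrightarrow> y \<in> sphere 0 r \<Longrightarrow> \<bar>v x - v y\<bar> \<le> del"
    using symmetrized_almost_constant[OF has_gradient_continuous_fun[OF u] r del(1)] by blast
  obtain q where q: "has_gradient v q"
    "\<And>c a k. 1 \<le> a \<Longrightarrow> mass (\<lambda>x. v x - c) \<le> a * energy q + k \<Longrightarrow> mass (\<lambda>x. u x - c) \<le> a * energy p + k"
    using symmetrized_gradient[OF d u v(1)] by blast
  obtain z :: "real ^ 'n" where z: "norm z = r" using vector_choose_size[of r] r by auto
  define c where "c = v z"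
  note [measurable] = measurable_has_gradient[OF q(1)]
  have [measurable]: "(sgn :: real ^ 'n \<Rightarrow> real ^ 'n) \<in> borel_measurable borel" by (simp add: sgn_div_norm[abs_def])
  let ?e = "ennreal (1 + eta)" and ?k = "ennreal ((1 + 1 / eta) * del\<^sup>2)"
  have "mass (\<lambda>x. v x - c) \<le> (\<integral>\<^sup>+x. ?e * ennreal (mass_density x * (v x - v (r *\<^sub>R sgn x))\<^sup>2) + ?k * ennreal (mass_density x) \<partial>lborel)"
    unfolding mass_def
  proof (rule nn_integral_mono_AE, use AE_lborel_singleton[of "0::real^'n"] in eventually_elim)
    fix x :: "real ^ 'n" assume x: "x \<noteq> 0"
    define a b where "a = v x - v (r *\<^sub>R sgn x)" and "b = v (r *\<^sub>R sgn x) - c"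
    have "\<bar>b\<bar> \<le> del" unfolding b_def c_def using x r z by (intro v(2)) (auto simp: norm_sgn)
    then have b: "b\<^sup>2 \<le> del\<^sup>2" by (simp add: abs_le_square_iff[symmetric])
    \<comment> \<open>Young's inequality 2ab <= eta * a^2 + b^2 / eta.\<close>
    have "0 \<le> (eta * a - b)\<^sup>2 / eta" using eta by simp
    also have "(eta * a - b)\<^sup>2 / eta = eta * a\<^sup>2 - 2 * a * b + b\<^sup>2 / eta"
      using eta by (simp add: field_simps power2_eq_square)
    finally have "(a + b)\<^sup>2 \<le> (1 + eta) * a\<^sup>2 + (1 + 1 / eta) * b\<^sup>2"
      by (simp add: power2_sum distrib_right)
    also have "\<dots> \<le> (1 + eta) * a\<^sup>2 + (1 + 1 / eta) * del\<^sup>2"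
      using b eta by (intro add_left_mono mult_left_mono) auto
    finally have "mass_density x * (a + b)\<^sup>2 \<le> mass_density x * ((1 + eta) * a\<^sup>2 + (1 + 1 / eta) * del\<^sup>2)"
      by (rule mult_left_mono) (rule mass_density_nonneg)
    then have "ennreal (mass_density x * (a + b)\<^sup>2) \<le> ennreal ((1 + eta) * (mass_density x * a\<^sup>2) + ((1 + 1 / eta) * del\<^sup>2) * mass_density x)"
      by (intro ennreal_leI) (simp add: algebra_simps)
    also have "\<dots> = ?e * ennreal (mass_density x * a\<^sup>2) + ?k * ennreal (mass_density x)"
      using eta mass_density_nonneg[of x] by (subst ennreal_plus) (auto simp: ennreal_mult)
    finally show "ennreal (mass_density x * (v x - c)\<^sup>2) \<le> ?e * ennreal (mass_density x * (v x - v (r *\<^sub>R sgn x))\<^sup>2) + ?k * ennreal (mass_density x)"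
      by (simp add: a_def b_def)
  qed
  also have "\<dots> = ?e * mass (\<lambda>x. v x - v (r *\<^sub>R sgn x)) + ?k * ennreal A"
  proof -
    have t: "(\<integral>\<^sup>+x. ennreal (mass_density (x :: real ^ 'n)) \<partial>lborel) = ennreal A" unfolding A_def by (rule total_mass[OF d])
    show ?thesis unfolding mass_def t[symmetric] by (subst nn_integral_add) (auto simp: nn_integral_cmult)
  qed
  also have "\<dots> \<le> ?e * energy q + ennreal eta"
  proof (intro add_mono mult_left_mono mass_radial_difference_le_energy[OF d q(1) r_def])
    have "?k * ennreal A = ennreal ((1 + 1 / eta) * del\<^sup>2 * A)" using eta A by (simp add: ennreal_mult)
    then show "?k * ennreal A \<le> ennreal eta" using del(2) by (simp add: ennreal_leI)
  qed simp
  finally have "mass (\<lambda>x. v x - c) \<le> ?e * energy q + ennreal eta" .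
  then show ?thesis using eta by (intro exI q(2)) (auto simp: ennreal_1[symmetric] simp del: ennreal_1 intro!: ennreal_leI)
qed

subsection \<open>Mollification\<close>

text \<open>The negative powers of t are built in because differentiating exp (-1/t) produces them:
  the span of the family is closed under differentiation.\<close>

definition bump_fun :: "nat \<Rightarrow> real \<Rightarrow> real" where
  "bump_fun k t = (if t > 0 then exp (- (1 / t)) / t ^ k else 0)"

lemma bump_fun_nonneg: "0 \<le> bump_fun k t" by (simp add: bump_fun_def)

lemma bump_fun_0: "bump_fun k 0 = 0" by (simp add: bump_fun_def)

lemma bump_fun_div: "bump_fun k t / t = bump_fun (Suc k) t" by (simp add: bump_fun_def)

lemma bump_fun_tendsto_0: "(bump_fun k \<longlongrightarrow> 0) (at 0)"
proof -
  have "((\<lambda>t. inverse t ^ k / exp (inverse t)) \<longlongrightarrow> 0) (at_right (0::real))"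
    by (rule filterlim_compose[OF tendsto_power_div_exp_0 filterlim_inverse_at_top_right])
  then have "(bump_fun k \<longlongrightarrow> 0) (at_right 0)"
    by (rule Lim_transform_eventually)
       (auto simp: eventually_at_filter bump_fun_def exp_minus field_simps intro!: always_eventually)
  moreover have "(bump_fun k \<longlongrightarrow> 0) (at_left 0)"
    by (rule Lim_transform_eventually[OF tendsto_const])
       (auto simp: eventually_at_filter bump_fun_def intro!: always_eventually)
  ultimately show ?thesis by (simp add: filterlim_split_at)
qed

lemma bump_fun_deriv:
  "(bump_fun k has_real_derivative bump_fun (k + 2) t - real k * bump_fun (k + 1) t) (at t)"
proof -
  consider "t > 0" | "t < 0" | "t = 0" by linarith
  then show ?thesis
  proof cases
    case 1
    have "((\<lambda>t. exp (- (1 / t)) / t ^ k) has_real_derivative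
       ((exp (- (1 / t)) * (1 / t\<^sup>2)) * t ^ k - exp (- (1 / t)) * (real k * t ^ (k - 1))) / (t ^ k * t ^ k)) (at t)"
      using 1 by (auto intro!: derivative_eq_intros simp: power2_eq_square)
    moreover have "((exp (- (1 / t)) * (1 / t\<^sup>2)) * t ^ k - exp (- (1 / t)) * (real k * t ^ (k - 1))) / (t ^ k * t ^ k)
      = bump_fun (k + 2) t - real k * bump_fun (k + 1) t"
      using 1 by (cases k) (simp_all add: bump_fun_def field_simps power2_eq_square)
    ultimately show ?thesis
      using 1 by (auto intro: has_field_derivative_transform_within_open[where S="{0<..}"] simp: bump_fun_def[abs_def])
  next
    case 2
    have "((\<lambda>t. 0) has_real_derivative 0) (at t)" by simp
    then have "(bump_fun k has_real_derivative 0) (at t)"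
      by (rule has_field_derivative_transform_within_open[where S="{..<0}"]) (use 2 in \<open>auto simp: bump_fun_def\<close>)
    then show ?thesis using 2 by (simp add: bump_fun_def)
  next
    case 3
    \<comment> \<open>At 0 the difference quotient is the next member of the family, which tends to
      0.\<close>
    have "((\<lambda>y. (bump_fun k y - bump_fun k 0) / (y - 0)) \<longlongrightarrow> 0) (at 0)"
      using bump_fun_tendsto_0[of "Suc k"] by (simp add: bump_fun_0 bump_fun_div)
    then show ?thesis using 3 by (simp add: has_field_derivative_iff bump_fun_0)
  qed
qed

lemma continuous_bump_fun: "continuous_on S (bump_fun k)"
  using bump_fun_deriv DERIV_isCont by (blast intro: continuous_at_imp_continuous_on)

lemma real_polynomial_function_has_derivative:
  fixes p :: "'a::real_normed_vector \<Rightarrow> real"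
  assumes "real_polynomial_function p"
  shows "\<exists>D. (\<forall>x. (p has_derivative D x) (at x)) \<and> (\<forall>h. real_polynomial_function (\<lambda>x. D x h))"
  using assms
proof induction
  case (linear f)
  then show ?case by (intro exI[of _ "\<lambda>_. f"]) (auto intro: bounded_linear_imp_has_derivative)
next
  case (const c)
  then show ?case by (intro exI[of _ "\<lambda>_ _. 0"]) auto
next
  case (add f g)
  then obtain D E where "\<forall>x. (f has_derivative D x) (at x)" "\<forall>h. real_polynomial_function (\<lambda>x. D x h)"
    "\<forall>x. (g has_derivative E x) (at x)" "\<forall>h. real_polynomial_function (\<lambda>x. E x h)" by blast
  then show ?case by (intro exI[of _ "\<lambda>x h. D x h + E x h"]) (auto intro: has_derivative_add)
next
  case (mult f g)
  then obtain D E where "\<forall>x. (f has_derivative D x) (at x)" "\<forall>h. real_polynomial_function (\<lambda>x. D x h)"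
    "\<forall>x. (g has_derivative E x) (at x)" "\<forall>h. real_polynomial_function (\<lambda>x. E x h)" by blast
  with mult.hyps show ?case by (intro exI[of _ "\<lambda>x h. f x * E x h + D x h * g x"]) (auto intro!: has_derivative_mult real_polynomial_function.intros(3,4))
qed

text \<open>Contains the kernels and is closed under directional derivatives, so that smoothness of
  every order follows by one induction.\<close>

inductive bump_span :: "('a::real_normed_vector \<Rightarrow> real) \<Rightarrow> ('a \<Rightarrow> real) \<Rightarrow> bool" for q where
  base: "real_polynomial_function p \<Longrightarrow> bump_span q (\<lambda>x. p x * bump_fun k (q x))"
| add: "bump_span q f \<Longrightarrow> bump_span q g \<Longrightarrow> bump_span q (\<lambda>x. f x + g x)"

lemma bump_span_has_derivative:
  assumes q: "real_polynomial_function q" and f: "bump_span q f"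
  shows "\<exists>D. (\<forall>x. (f has_derivative D x) (at x)) \<and> (\<forall>h. bump_span q (\<lambda>x. D x h))"
  using f
proof induction
  case (base p k)
  obtain E where E: "\<And>x. (q has_derivative E x) (at x)" "\<And>h. real_polynomial_function (\<lambda>x. E x h)"
    using real_polynomial_function_has_derivative[OF q] by blast
  obtain D where D: "\<And>x. (p has_derivative D x) (at x)" "\<And>h. real_polynomial_function (\<lambda>x. D x h)"
    using real_polynomial_function_has_derivative[OF base] by blast
  have b: "((\<lambda>x. bump_fun k (q x)) has_derivative (\<lambda>h. (bump_fun (k + 2) (q x) - real k * bump_fun (k + 1) (q x)) * E x h)) (at x)" for x
    using has_derivative_compose[OF E(1) bump_fun_deriv[unfolded has_field_derivative_def]] by simp
  let ?D = "\<lambda>x h. (D x h * bump_fun k (q x) + (p x * E x h) * bump_fun (k + 2) (q x)) + (p x * (- real k * E x h)) * bump_fun (k + 1) (q x)"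
  show ?case
  proof (intro exI[of _ ?D] conjI allI)
    fix x
    have "((\<lambda>x. p x * bump_fun k (q x)) has_derivative
      (\<lambda>h. p x * ((bump_fun (k + 2) (q x) - real k * bump_fun (k + 1) (q x)) * E x h) + D x h * bump_fun k (q x))) (at x)"
      by (rule has_derivative_mult[OF D(1) b])
    then show "((\<lambda>x. p x * bump_fun k (q x)) has_derivative ?D x) (at x)" by (simp add: algebra_simps)
    show "bump_span q (\<lambda>x. ?D x h)" for h
      by (intro bump_span.intros real_polynomial_function.intros(2-4) D(2) E(2) base)
  qed
next
  case (add f g)
  then obtain D E where "\<forall>x. (f has_derivative D x) (at x)" "\<forall>h. bump_span q (\<lambda>x. D x h)"
    "\<forall>x. (g has_derivative E x) (at x)" "\<forall>h. bump_span q (\<lambda>x. E x h)" by blast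
  then show ?case by (intro exI[of _ "\<lambda>x h. D x h + E x h"]) (auto intro: has_derivative_add bump_span.add)
qed

lemma bump_span_Ck_fun:
  assumes q: "real_polynomial_function q" and f: "bump_span q f"
  shows "Ck_fun k f"
  using f
proof (induction k arbitrary: f)
  case (0 f)
  obtain D where "\<And>x. (f has_derivative D x) (at x)" using bump_span_has_derivative[OF q 0] by blast
  then show ?case by (auto intro!: continuous_at_imp_continuous_on has_derivative_continuous)
next
  case (Suc k f)
  obtain D where D: "\<And>x. (f has_derivative D x) (at x)" "\<And>h. bump_span q (\<lambda>x. D x h)"
    using bump_span_has_derivative[OF q Suc.prems] by blast
  have "frechet_derivative f (at x) = D x" for x using frechet_derivative_at[OF D(1)] by simp
  then show ?case using D Suc.IH by (auto simp: differentiable_def)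
qed

definition bump_kernel :: "real \<Rightarrow> real ^ 'n \<Rightarrow> real" where
  "bump_kernel e z = bump_fun 0 (e\<^sup>2 - (norm z)\<^sup>2)"

text \<open>For k = 0 the derivative of \<open>bump_fun k\<close> is \<open>bump_fun 2\<close>
  alone; the factor -2 * z is the gradient of the inner function.\<close>

definition bump_kernel_grad :: "real \<Rightarrow> real ^ 'n \<Rightarrow> real ^ 'n" where
  "bump_kernel_grad e z = (- 2 * bump_fun 2 (e\<^sup>2 - (norm z)\<^sup>2)) *\<^sub>R z"

lemma bump_kernel_zero:
  assumes "0 < e" "e \<le> norm z"
  shows "bump_kernel e z = 0" "bump_kernel_grad e z = 0"
proof -
  have "e\<^sup>2 \<le> (norm z)\<^sup>2" using assms by (intro power_mono) auto
  then show "bump_kernel e z = 0" "bump_kernel_grad e z = 0"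
    by (simp_all add: bump_kernel_def bump_kernel_grad_def bump_fun_def)
qed

lemma bump_kernel_nonneg: "0 \<le> bump_kernel e z" by (simp add: bump_kernel_def bump_fun_nonneg)

lemma bump_kernel_minus: "bump_kernel e (- z) = bump_kernel e z" by (simp add: bump_kernel_def)

lemma has_derivative_norm_sq: "((\<lambda>z::'a::real_inner. (norm z)\<^sup>2) has_derivative (\<lambda>h. 2 * (z \<bullet> h))) (at z)"
  unfolding power2_norm_eq_inner by (auto intro!: derivative_eq_intros simp: inner_commute)

lemma has_gradient_bump_kernel: "has_gradient (bump_kernel e :: real ^ 'n \<Rightarrow> real) (bump_kernel_grad e)"
proof -
  have "(bump_kernel e has_derivative (\<lambda>h. bump_kernel_grad e z \<bullet> h)) (at z)" for z :: "real ^ 'n"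
  proof -
    have "((\<lambda>z. e\<^sup>2 - (norm z)\<^sup>2) has_derivative (\<lambda>h. 0 - 2 * (z \<bullet> h))) (at z)"
      by (intro has_derivative_diff has_derivative_const has_derivative_norm_sq)
    from has_derivative_compose[OF this bump_fun_deriv[of 0, unfolded has_field_derivative_def]]
    show ?thesis by (simp add: bump_kernel_def[abs_def] bump_kernel_grad_def ac_simps flip: numeral_2_eq_2)
  qed
  moreover have "continuous_on UNIV (\<lambda>z :: real ^ 'n. bump_fun 2 (e\<^sup>2 - (norm z)\<^sup>2))"
    by (intro continuous_on_compose2[OF continuous_bump_fun[of UNIV]] continuous_intros) auto
  then have "continuous_on UNIV (bump_kernel_grad e :: real ^ 'n \<Rightarrow> _)"
    unfolding bump_kernel_grad_def[abs_def] by (intro continuous_intros)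
  ultimately show ?thesis by (simp add: has_gradient_def)
qed

text \<open>The square of the norm makes the inner function a polynomial, which places the kernel in
  \<open>bump_span\<close>. The argument x - y is the form in which the kernel is paired with a weak
  gradient.\<close>

lemma test_function_bump_kernel:
  fixes x :: "real ^ 'n"
  assumes e: "0 < e"
  shows "test_function (\<lambda>y. a * bump_kernel e (x - y))"
proof -
  let ?q = "\<lambda>y. e\<^sup>2 - (norm (x - y))\<^sup>2"
  have lin: "bounded_linear (\<lambda>y :: real ^ 'n. y $ i)" for i by (rule bounded_linear_vec_nth)
  have "?q = (\<lambda>y. e\<^sup>2 - (\<Sum>i\<in>UNIV. (x $ i - y $ i) * (x $ i - y $ i)))"
    by (simp add: power2_norm_eq_inner inner_vec_def)
  moreover have "real_polynomial_function (\<lambda>y. e\<^sup>2 - (\<Sum>i\<in>UNIV. (x $ i - y $ i) * (x $ i - y $ i)))"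
    by (intro real_polynomial_function_diff real_polynomial_function_sum real_polynomial_function.intros(4)
       real_polynomial_function.intros(1,2) lin) auto
  ultimately have q: "real_polynomial_function ?q" by simp
  have "bump_span ?q (\<lambda>y. a * bump_fun 0 (?q y))" by (intro bump_span.base real_polynomial_function.intros(2))
  then have "Ck_fun k (\<lambda>y. a * bump_kernel e (x - y))" for k
    unfolding bump_kernel_def using bump_span_Ck_fun[OF q] by simp
  moreover have "{y. a * bump_kernel e (x - y) \<noteq> 0} \<subseteq> cball x e"
    using bump_kernel_zero(1)[OF e] by (force simp: dist_norm not_le)
  then have "compact (closure {y. a * bump_kernel e (x - y) \<noteq> 0})"
    by (meson bounded_cball bounded_subset compact_closure)
  ultimately show ?thesis by (simp add: test_function_def)
qed

text \<open>Borel instead of Lebesgue measurability, so that translations and Fubini's theorem for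
  \<open>lborel\<close> apply directly. Borel representatives are chosen at the very end.\<close>

definition loc_integrable :: "('a::euclidean_space \<Rightarrow> real) \<Rightarrow> bool" where
  "loc_integrable u \<longleftrightarrow> u \<in> borel_measurable borel \<and> (\<forall>r. integrable lborel (\<lambda>y. indicator (cball 0 r) y * u y))"

lemma loc_integrable_mult:
  assumes u: "loc_integrable u" and p: "continuous_on UNIV p" and z: "\<And>y. R < norm y \<Longrightarrow> p y = 0"
  shows "integrable lborel (\<lambda>y. u y * p y :: real)"
proof -
  have [measurable]: "u \<in> borel_measurable borel" "p \<in> borel_measurable borel"
    using u p by (auto simp: loc_integrable_def intro: borel_measurable_continuous_onI)
  have "compact (p ` cball 0 R)" using p by (intro compact_continuous_image continuous_on_subset[OF p]) auto
  then have "bounded (p ` cball 0 R)" by (rule compact_imp_bounded)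
  then obtain B where "\<forall>z\<in>p ` cball 0 R. norm z \<le> B" unfolding bounded_iff by blast
  then have B: "\<And>y. norm y \<le> R \<Longrightarrow> \<bar>p y\<bar> \<le> B" by simp
  have "integrable lborel (\<lambda>y. B * (indicator (cball 0 R) y * u y))"
    using u by (intro integrable_mult_right) (simp add: loc_integrable_def)
  then show ?thesis
  proof (rule Bochner_Integration.integrable_bound)
    show "AE y in lborel. norm (u y * p y) \<le> norm (B * (indicator (cball 0 R) y * u y))"
    proof (intro AE_I2)
      fix y
      show "norm (u y * p y) \<le> norm (B * (indicator (cball 0 R) y * u y))"
      proof (cases "norm y \<le> R")
        case True
        then have "\<bar>p y\<bar> * \<bar>u y\<bar> \<le> \<bar>B\<bar> * \<bar>u y\<bar>" using B[OF True] by (intro mult_right_mono) auto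
        then show ?thesis using True by (simp add: abs_mult mult.commute)
      qed (simp add: z)
    qed
  qed measurable
qed

lemma uniformly_continuous_compact_support:
  fixes G :: "'a::euclidean_space \<Rightarrow> 'b::real_normed_vector"
  assumes G: "continuous_on UNIV G" and z: "\<And>y. R < norm y \<Longrightarrow> G y = 0" and e: "0 < e"
  obtains d where "0 < d" "d \<le> 1" "\<And>x h. norm h < d \<Longrightarrow> norm (G (x + h) - G x) \<le> e"
proof -
  have "uniformly_continuous_on (cball 0 (R + 1)) G"
    by (intro compact_uniformly_continuous continuous_on_subset[OF G]) auto
  then obtain d where d: "d > 0" "\<And>x y. x \<in> cball 0 (R + 1) \<Longrightarrow> y \<in> cball 0 (R + 1) \<Longrightarrow> dist y x < d \<Longrightarrow> dist (G y) (G x) < e"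
    unfolding uniformly_continuous_on_def using e by metis
  show thesis
  proof (rule that[of "min d 1"])
    fix x h :: 'a assume h: "norm h < min d 1"
    show "norm (G (x + h) - G x) \<le> e"
    proof (cases "norm x \<le> R + 1 \<and> norm (x + h) \<le> R + 1")
      case True
      then have "x \<in> cball 0 (R + 1)" "x + h \<in> cball 0 (R + 1)" by simp_all
      moreover have "dist (x + h) x < d" using h by (simp add: dist_norm)
      ultimately have "dist (G (x + h)) (G x) < e" by (rule d(2))
      then show ?thesis by (simp add: dist_norm)
    next
      case False
      have "norm (x + h) \<le> norm x + norm h" "norm x \<le> norm (x + h) + norm h"
        using norm_triangle_ineq[of x h] norm_triangle_ineq4[of "x + h" h] by simp_all
      then have "R < norm x" "R < norm (x + h)" using False h by linarith+
      then show ?thesis using e by (simp add: z)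
    qed
  qed (use d in auto)
qed

text \<open>Uniform continuity of the compactly supported G bounds the first-order remainder of p by
  a small multiple of norm h, uniformly in y. Integration against u over a fixed ball preserves this
  bound.\<close>

lemma has_derivative_convolution:
  fixes u :: "real ^ 'n \<Rightarrow> real"
  assumes u: "loc_integrable u" and p: "has_gradient p G"
    and z: "\<And>y. R < norm y \<Longrightarrow> p y = 0" "\<And>y. R < norm y \<Longrightarrow> G y = 0"
  shows "((\<lambda>x. LINT y|lborel. u y * p (x - y)) has_derivative
     (\<lambda>h. (\<chi> i. LINT y|lborel. u y * G (x - y) $ i) \<bullet> h)) (at x)"
proof -
  have cp: "continuous_on UNIV p" using p by (rule has_gradient_continuous_fun)
  have cG: "continuous_on UNIV G" using p by (simp add: has_gradient_def)
  have [measurable]: "u \<in> borel_measurable borel" using u by (simp add: loc_integrable_def)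
  have far: "R < norm (x - y)" if "norm x + R < norm y" for x y :: "real ^ 'n"
    using that norm_triangle_ineq2[of y x] by (simp add: norm_minus_commute)
  have ip: "integrable lborel (\<lambda>y. u y * p (x - y))" for x
    by (rule loc_integrable_mult[OF u, where R="norm x + R"])
       (auto intro!: continuous_on_compose2[OF cp] continuous_intros z far)
  have iG: "integrable lborel (\<lambda>y. u y * G (x - y) $ i)" for x i
  proof (rule loc_integrable_mult[OF u, where R="norm x + R"])
    have "continuous_on UNIV (\<lambda>y. G (x - y))" by (rule continuous_on_compose2[OF cG]) (auto intro!: continuous_intros)
    then show "continuous_on UNIV (\<lambda>y. G (x - y) $ i)" by (intro continuous_intros)
  qed (simp add: z far)
  define L where "L = (\<chi> i. LINT y|lborel. u y * G (x - y) $ i)"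
  have L: "L \<bullet> h = (LINT y|lborel. u y * (G (x - y) \<bullet> h))" "integrable lborel (\<lambda>y. u y * (G (x - y) \<bullet> h))" for h
  proof -
    have e: "u y * (G (x - y) \<bullet> h) = (\<Sum>i\<in>UNIV. u y * G (x - y) $ i * h $ i)" for y
      by (simp add: inner_vec_def sum_distrib_left mult.assoc)
    show "integrable lborel (\<lambda>y. u y * (G (x - y) \<bullet> h))"
      unfolding e by (intro Bochner_Integration.integrable_sum integrable_mult_left iG)
    show "L \<bullet> h = (LINT y|lborel. u y * (G (x - y) \<bullet> h))"
      unfolding e by (subst Bochner_Integration.integral_sum) (auto intro: iG simp: L_def inner_vec_def)
  qed
  \<comment> \<open>The additional 1 lets a single ball contain the supports for all points within
    distance 1 of x.\<close>
  define r where "r = norm x + R + 1"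
  define C where "C = (LINT y|lborel. indicator (cball 0 r) y * \<bar>u y\<bar>)"
  have iC: "integrable lborel (\<lambda>y. indicator (cball 0 r) y * \<bar>u y\<bar>)"
    using u integrable_abs[of lborel "\<lambda>y. indicator (cball 0 r) y * u y"]
    by (simp add: loc_integrable_def abs_mult)
  have C: "0 \<le> C" unfolding C_def by (intro Bochner_Integration.integral_nonneg) auto
  have "bounded_linear (\<lambda>h. L \<bullet> h)" by (rule bounded_linear_inner_right)
  moreover have "\<exists>d>0. \<forall>x'. norm (x' - x) < d \<longrightarrow> norm ((LINT y|lborel. u y * p (x' - y)) - (LINT y|lborel. u y * p (x - y)) - L \<bullet> (x' - x)) \<le> e * norm (x' - x)"
    if e: "0 < e" for e
  proof -
    have e': "0 < e / (C + 1)" using e C by simp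
    obtain d where d: "0 < d" "d \<le> 1" "\<And>x h. norm h < d \<Longrightarrow> norm (G (x + h) - G x) \<le> e / (C + 1)"
      using uniformly_continuous_compact_support[OF cG z(2) e'] by metis
    have "norm ((LINT y|lborel. u y * p (x' - y)) - (LINT y|lborel. u y * p (x - y)) - L \<bullet> (x' - x)) \<le> e * norm (x' - x)"
      if x': "norm (x' - x) < d" for x'
    proof -
      define h where "h = x' - x"
      have h: "norm h < d" using x' by (simp add: h_def)
      have pt: "\<bar>p (x' - y) - p (x - y) - G (x - y) \<bullet> h\<bar> \<le> indicator (cball 0 r) y * (e / (C + 1) * norm h)" for y
      proof (cases "norm y \<le> r")
        case True
        \<comment> \<open>The mean value theorem for this function yields the remainder as an
          increment of G times h.\<close>
        define f where "f t = p (x - y + t *\<^sub>R h) - t * (G (x - y) \<bullet> h)" for t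
        have "((\<lambda>t. x - y + t *\<^sub>R h) has_vector_derivative h) (at t)" for t
          by (auto intro!: derivative_eq_intros)
        from has_gradient_curve[OF p this]
        have fd: "(f has_real_derivative (G (x - y + t *\<^sub>R h) \<bullet> h - G (x - y) \<bullet> h)) (at t)" for t
          unfolding f_def by (auto intro!: derivative_eq_intros)
        obtain t where t: "0 < t" "t < 1" "f 1 - f 0 = (1 - 0) * (G (x - y + t *\<^sub>R h) \<bullet> h - G (x - y) \<bullet> h)"
          using MVT2[of 0 1 f "\<lambda>t. G (x - y + t *\<^sub>R h) \<bullet> h - G (x - y) \<bullet> h"] fd by auto
        have "norm (t *\<^sub>R h) < d" using t h mult_right_mono[of t 1 "norm h"] by simp
        then have "norm (G (x - y + t *\<^sub>R h) - G (x - y)) \<le> e / (C + 1)" by (rule d(3))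
        then have "norm (G (x - y + t *\<^sub>R h) - G (x - y)) * norm h \<le> e / (C + 1) * norm h"
          by (rule mult_right_mono) simp
        moreover have "\<bar>(G (x - y + t *\<^sub>R h) - G (x - y)) \<bullet> h\<bar> \<le> norm (G (x - y + t *\<^sub>R h) - G (x - y)) * norm h"
          by (rule Cauchy_Schwarz_ineq2)
        moreover have "p (x' - y) - p (x - y) - G (x - y) \<bullet> h = f 1 - f 0"
          by (simp add: f_def h_def algebra_simps)
        ultimately show ?thesis using True t(3) by (simp add: inner_diff_left)
      next
        case False
        have "norm x + R < norm y" using False by (simp add: r_def)
        moreover have "norm x' \<le> norm x + norm h" using norm_triangle_ineq[of x h] by (simp add: h_def)
        then have "norm x' + R < norm y" using False h d(2) by (simp add: r_def)
        ultimately show ?thesis using z far e C False by simp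
      qed
      have "(LINT y|lborel. u y * p (x' - y)) - (LINT y|lborel. u y * p (x - y)) - L \<bullet> h
        = (LINT y|lborel. u y * p (x' - y) - u y * p (x - y) - u y * (G (x - y) \<bullet> h))"
        by (simp add: L ip)
      also have "\<bar>\<dots>\<bar> \<le> (LINT y|lborel. (e / (C + 1) * norm h) * (indicator (cball 0 r) y * \<bar>u y\<bar>))"
      proof (rule order_trans[OF integral_abs_bound], rule integral_mono)
        show "integrable lborel (\<lambda>y. \<bar>u y * p (x' - y) - u y * p (x - y) - u y * (G (x - y) \<bullet> h)\<bar>)"
          by (intro integrable_abs Bochner_Integration.integrable_diff ip L(2))
        show "integrable lborel (\<lambda>y. (e / (C + 1) * norm h) * (indicator (cball 0 r) y * \<bar>u y\<bar>))"
          by (intro integrable_mult_right iC)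
        fix y
        have "\<bar>u y * p (x' - y) - u y * p (x - y) - u y * (G (x - y) \<bullet> h)\<bar> = \<bar>u y\<bar> * \<bar>p (x' - y) - p (x - y) - G (x - y) \<bullet> h\<bar>"
          by (simp add: abs_mult[symmetric] right_diff_distrib)
        also have "\<dots> \<le> \<bar>u y\<bar> * (indicator (cball 0 r) y * (e / (C + 1) * norm h))"
          by (rule mult_left_mono[OF pt]) simp
        finally show "\<bar>u y * p (x' - y) - u y * p (x - y) - u y * (G (x - y) \<bullet> h)\<bar> \<le> (e / (C + 1) * norm h) * (indicator (cball 0 r) y * \<bar>u y\<bar>)"
          by (simp add: mult_ac)
      qed
      also have "\<dots> = e * norm h * (C / (C + 1))" by (simp add: C_def)
      also have "\<dots> \<le> e * norm h * 1" using C e by (intro mult_left_mono) auto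
      finally show ?thesis by (simp add: h_def)
    qed
    then show ?thesis using d(1) by blast
  qed
  ultimately show ?thesis
    unfolding L_def[symmetric] has_derivative_at_alt by blast
qed

definition mollifier :: "real \<Rightarrow> real ^ 'n \<Rightarrow> real" where
  "mollifier e z = bump_kernel e z / (LINT y|lborel. bump_kernel e (y :: real ^ 'n))"

definition mollifier_grad :: "real \<Rightarrow> real ^ 'n \<Rightarrow> real ^ 'n" where
  "mollifier_grad e z = (1 / (LINT y|lborel. bump_kernel e (y :: real ^ 'n))) *\<^sub>R bump_kernel_grad e z"

lemma integrable_bump_kernel:
  assumes "0 < e"
  shows "integrable lborel (bump_kernel e :: real ^ 'n \<Rightarrow> real)"
proof -
  have "loc_integrable (\<lambda>_ :: real ^ 'n. 1)"
    by (auto simp: loc_integrable_def intro!: integrable_real_indicator emeasure_bounded_finite)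
  from loc_integrable_mult[OF this has_gradient_continuous_fun[OF has_gradient_bump_kernel], of e e]
  have "integrable lborel (\<lambda>y :: real ^ 'n. 1 * bump_kernel e y)"
    by (simp add: bump_kernel_zero(1)[OF assms])
  then show ?thesis by simp
qed

lemma integral_bump_kernel_pos:
  assumes e: "0 < e"
  shows "0 < (LINT y|lborel. bump_kernel e (y :: real ^ 'n))"
proof (rule ccontr)
  assume "\<not> ?thesis"
  then have "(LINT y|lborel. bump_kernel e (y :: real ^ 'n)) = 0"
    by (intro antisym Bochner_Integration.integral_nonneg) (auto simp: bump_kernel_nonneg)
  then have ae: "AE y in lborel. bump_kernel e (y :: real ^ 'n) = 0"
    using integral_nonneg_eq_0_iff_AE[OF integrable_bump_kernel[OF e]] bump_kernel_nonneg by auto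
  have pos: "bump_kernel e y > 0" if "y \<in> ball (0 :: real ^ 'n) e" for y
    using that e power_strict_mono[of "norm y" e 2] by (simp add: bump_kernel_def bump_fun_def)
  have "AE y in lborel. y \<notin> ball (0 :: real ^ 'n) e" using ae by eventually_elim (use pos in force)
  then have "emeasure lborel (ball (0 :: real ^ 'n) e) = 0"
    by (subst (asm) AE_iff_measurable[of "ball 0 e"]) auto
  then show False using content_ball_pos[OF e, of "0 :: real ^ 'n"] by (simp add: measure_def)
qed

lemma mollifier_zero: "0 < e \<Longrightarrow> e \<le> norm z \<Longrightarrow> mollifier e z = 0" "0 < e \<Longrightarrow> e \<le> norm z \<Longrightarrow> mollifier_grad e z = 0"
  by (simp_all add: mollifier_def mollifier_grad_def bump_kernel_zero)

lemma mollifier_nonneg: "0 < e \<Longrightarrow> 0 \<le> mollifier e z"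
  unfolding mollifier_def using integral_bump_kernel_pos[of e] bump_kernel_nonneg[of e z]
  by (meson divide_nonneg_pos)

lemma mollifier_minus: "mollifier e (- z) = mollifier e z"
  by (simp add: mollifier_def bump_kernel_minus)

lemma has_gradient_mollifier: "has_gradient (mollifier e :: real ^ 'n \<Rightarrow> real) (mollifier_grad e)"
  using has_gradient_lincomb[OF has_gradient_bump_kernel has_gradient_bump_kernel, of "1 / (LINT y|lborel. bump_kernel e (y :: real ^ 'n))" e 0 e]
  by (simp add: mollifier_def[abs_def] mollifier_grad_def[abs_def])

lemma continuous_mollifier: "continuous_on UNIV (mollifier e)"
  by (rule has_gradient_continuous_fun[OF has_gradient_mollifier])

lemma measurable_mollifier [measurable]: "mollifier e \<in> borel_measurable borel"
  by (intro borel_measurable_continuous_onI continuous_mollifier)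

lemma test_function_mollifier: "0 < e \<Longrightarrow> test_function (\<lambda>y. mollifier e (x - y))"
  using test_function_bump_kernel[of e "1 / (LINT y|lborel. bump_kernel e y)" x] by (simp add: mollifier_def)

lemma nn_integral_mollifier:
  assumes e: "0 < e"
  shows "(\<integral>\<^sup>+z. ennreal (mollifier e (z :: real ^ 'n)) \<partial>lborel) = 1"
proof -
  have i: "integrable lborel (mollifier e :: real ^ 'n \<Rightarrow> real)"
    unfolding mollifier_def[abs_def] by (intro integrable_divide_zero integrable_bump_kernel[OF e])
  have "(LINT z|lborel. mollifier e (z :: real ^ 'n)) = 1"
    using integral_bump_kernel_pos[OF e, where 'n='n] by (simp add: mollifier_def)
  then show ?thesis
    by (subst nn_integral_eq_integral[OF i]) (auto simp: mollifier_nonneg[OF e])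
qed

lemma nn_integral_mollifier_shift:
  assumes e: "0 < e"
  shows "(\<integral>\<^sup>+y. ennreal (mollifier e (x - y :: real ^ 'n)) \<partial>lborel) = 1"
    "(\<integral>\<^sup>+y. ennreal (mollifier e (y - x :: real ^ 'n)) \<partial>lborel) = 1"
proof -
  have "(\<integral>\<^sup>+y. ennreal (mollifier e (- x + y)) \<partial>lborel) = 1"
    using nn_integral_translate[of "\<lambda>y. ennreal (mollifier e y)" "- x"] nn_integral_mollifier[OF e] by simp
  then show 1: "(\<integral>\<^sup>+y. ennreal (mollifier e (y - x)) \<partial>lborel) = 1" by simp
  have "mollifier e (x - y) = mollifier e (y - x)" for y using mollifier_minus[of e "y - x"] by simp
  then show "(\<integral>\<^sup>+y. ennreal (mollifier e (x - y)) \<partial>lborel) = 1" using 1 by simp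
qed

lemma integrable_mollifier_mult:
  fixes u :: "real ^ 'n \<Rightarrow> real"
  assumes e: "0 < e" and u: "loc_integrable u"
  shows "integrable lborel (\<lambda>y. u y * mollifier e (x - y))"
proof (rule loc_integrable_mult[OF u, where R="norm x + e"])
  show "continuous_on UNIV (\<lambda>y. mollifier e (x - y))"
    by (rule continuous_on_compose2[OF continuous_mollifier]) (auto intro!: continuous_intros)
  fix y :: "real ^ 'n" assume "norm x + e < norm y"
  then have "e \<le> norm (x - y)" using norm_triangle_ineq2[of y x] by (simp add: norm_minus_commute)
  then show "mollifier e (x - y) = 0" by (rule mollifier_zero(1)[OF e])
qed

lemma integrable_mollifier_shift:
  assumes e: "0 < e"
  shows "integrable lborel (\<lambda>y. mollifier e (x - y :: real ^ 'n))" "(LINT y|lborel. mollifier e (x - y)) = 1"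
proof -
  show i: "integrable lborel (\<lambda>y. mollifier e (x - y))"
    using integrable_mollifier_mult[OF e, of "\<lambda>_. 1" x]
    by (simp add: loc_integrable_def integrable_real_indicator emeasure_lborel_cball_finite[unfolded infinity_ennreal_def])
  have "AE y in lborel. 0 \<le> mollifier e (x - y)" by (simp add: mollifier_nonneg[OF e])
  from nn_integral_eq_integral[OF i this] show "(LINT y|lborel. mollifier e (x - y)) = 1"
    by (simp add: nn_integral_mollifier_shift(1)[OF e])
qed

definition mollify :: "real \<Rightarrow> (real ^ 'n \<Rightarrow> real) \<Rightarrow> real ^ 'n \<Rightarrow> real" where
  "mollify e u x = (LINT y|lborel. u y * mollifier e (x - y))"

text \<open>Two dominated convergences: u is replaced by a truncation at a large level n, and then
  an almost everywhere approximation of u by continuous functions is truncated at the same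
  level.\<close>

lemma ex_continuous_L1_approx:
  fixes u :: "'a::euclidean_space \<Rightarrow> real"
  assumes u: "loc_integrable u" and k: "0 < k"
  shows "\<exists>w. continuous_on UNIV w \<and> (\<integral>\<^sup>+y. ennreal \<bar>u y - w y\<bar> * indicator (cball 0 R) y \<partial>lborel) \<le> ennreal k"
proof -
  define B where "B = cball (0::'a) R"
  have [measurable]: "u \<in> borel_measurable borel" "B \<in> sets borel" using u by (auto simp: loc_integrable_def B_def)
  have Bf: "emeasure lborel B < \<infinity>" using emeasure_lborel_cball_finite[of "0::'a" R] by (simp add: B_def less_top)
  have iu: "integrable lborel (\<lambda>y. indicator B y * u y)" using u by (simp add: loc_integrable_def B_def)
  \<comment> \<open>Clipping to [-n, n]. It is continuous, hence preserves pointwise limits, and it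
    is bounded, which supplies the majorant 2 * n on the ball.\<close>
  define T where "T n a = max (- real n) (min (real n) a)" for n and a :: real
  have T: "\<bar>T n a\<bar> \<le> real n" "\<bar>a - T n a\<bar> \<le> \<bar>a\<bar>" "isCont (T n) a" for n a
    by (auto simp: T_def[abs_def] intro!: continuous_intros)
  have Tm [measurable]: "T n \<in> borel_measurable borel" for n unfolding T_def[abs_def] by measurable
  have "(\<lambda>n. LINT y|lborel. indicator B y * \<bar>u y - T n (u y)\<bar>) \<longlonglongrightarrow> (LINT y|(lborel :: 'a measure). 0 :: real)"
  proof (rule integral_dominated_convergence)
    show "integrable lborel (\<lambda>y. \<bar>indicator B y * u y\<bar>)" using iu by (rule integrable_abs)
    have "(\<lambda>n. indicator B y * \<bar>u y - T n (u y)\<bar>) \<longlonglongrightarrow> 0" for y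
    proof (rule tendsto_eventually)
      obtain N where "\<bar>u y\<bar> \<le> real N" using real_arch_simple by blast
      then have "T n (u y) = u y" if "N \<le> n" for n using that by (auto simp: T_def)
      then show "eventually (\<lambda>n. indicator B y * \<bar>u y - T n (u y)\<bar> = 0) sequentially"
        by (auto intro: eventually_sequentiallyI[of N])
    qed
    then show "AE y in lborel. (\<lambda>n. indicator B y * \<bar>u y - T n (u y)\<bar>) \<longlonglongrightarrow> 0" by simp
    show "AE y in lborel. norm (indicator B y * \<bar>u y - T n (u y)\<bar>) \<le> \<bar>indicator B y * u y\<bar>" for n
      using T(2) by (auto simp: indicator_def)
  qed measurable
  then obtain n where n: "(LINT y|lborel. indicator B y * \<bar>u y - T n (u y)\<bar>) < k / 2"
    using k LIMSEQ_D[of _ 0 "k/2"] by (force simp: abs_less_iff dest: order_tendstoD)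
  \<comment> \<open>The definition of \<open>measurable_on\<close> itself provides continuous
    functions that converge to u off a negligible set.\<close>
  have "u measurable_on UNIV" by (rule lebesgue_measurable_imp_measurable_on) (auto simp: measurable_completion)
  then obtain N g where N: "negligible N" and g: "\<And>m. continuous_on UNIV (g m)" "\<And>x. x \<notin> N \<Longrightarrow> (\<lambda>m. g m x) \<longlonglongrightarrow> u x"
    unfolding measurable_on_def by auto
  have [measurable]: "g m \<in> borel_measurable borel" for m using g(1) by (rule borel_measurable_continuous_onI)
  have aeN: "AE y in lborel. y \<notin> N"
    using N AE_not_in[of N lebesgue] by (simp add: negligible_iff_null_sets AE_completion_iff)
  have "(\<lambda>m. LINT y|lborel. indicator B y * \<bar>T n (u y) - T n (g m y)\<bar>) \<longlonglongrightarrow> (LINT y|(lborel :: 'a measure). 0 :: real)"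
  proof (rule integral_dominated_convergence)
    show "integrable lborel (\<lambda>y. indicator B y * (2 * real n))"
      using Bf by (intro integrable_mult_left integrable_real_indicator) auto
    show "AE y in lborel. (\<lambda>m. indicator B y * \<bar>T n (u y) - T n (g m y)\<bar>) \<longlonglongrightarrow> 0"
      using aeN
    proof eventually_elim
      fix y assume "y \<notin> N"
      from isCont_tendsto_compose[OF T(3) g(2)[OF this]]
      have "(\<lambda>m. indicator B y * \<bar>T n (u y) - T n (g m y)\<bar>) \<longlonglongrightarrow> indicator B y * \<bar>T n (u y) - T n (u y)\<bar>"
        by (intro tendsto_intros)
      then show "(\<lambda>m. indicator B y * \<bar>T n (u y) - T n (g m y)\<bar>) \<longlonglongrightarrow> 0" by simp
    qed
    show "AE y in lborel. norm (indicator B y * \<bar>T n (u y) - T n (g m y)\<bar>) \<le> indicator B y * (2 * real n)" for m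
    proof (intro AE_I2)
      fix y show "norm (indicator B y * \<bar>T n (u y) - T n (g m y)\<bar>) \<le> indicator B y * (2 * real n)"
        using T(1)[of n "u y"] T(1)[of n "g m y"] by (auto simp: indicator_def)
    qed
  qed measurable
  then obtain m where m: "(LINT y|lborel. indicator B y * \<bar>T n (u y) - T n (g m y)\<bar>) < k / 2"
    using k LIMSEQ_D[of _ 0 "k/2"] by (force simp: abs_less_iff dest: order_tendstoD)
  have i1: "integrable lborel (\<lambda>y. indicator B y * \<bar>u y - T n (u y)\<bar>)"
    by (rule Bochner_Integration.integrable_bound[OF iu]) (use T(2) in \<open>auto simp: indicator_def\<close>)
  have i2: "integrable lborel (\<lambda>y. indicator B y * \<bar>T n (u y) - T n (g m y)\<bar>)"
  proof (rule Bochner_Integration.integrable_bound[of _ "\<lambda>y. indicator B y * (2 * real n)"])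
    show "integrable lborel (\<lambda>y. indicator B y * (2 * real n))"
      using Bf by (intro integrable_mult_left integrable_real_indicator) auto
    show "AE y in lborel. norm (indicator B y * \<bar>T n (u y) - T n (g m y)\<bar>) \<le> norm (indicator B y * (2 * real n))"
    proof (intro AE_I2)
      fix y show "norm (indicator B y * \<bar>T n (u y) - T n (g m y)\<bar>) \<le> norm (indicator B y * (2 * real n))"
        using T(1)[of n "u y"] T(1)[of n "g m y"] by (auto simp: indicator_def)
    qed
  qed measurable
  have "(\<integral>\<^sup>+y. ennreal \<bar>u y - T n (g m y)\<bar> * indicator B y \<partial>lborel) \<le>
    (\<integral>\<^sup>+y. ennreal (indicator B y * \<bar>u y - T n (u y)\<bar> + indicator B y * \<bar>T n (u y) - T n (g m y)\<bar>) \<partial>lborel)"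
    by (intro nn_integral_mono) (auto simp: indicator_def simp del: ennreal_plus intro!: ennreal_leI)
  also have "\<dots> = ennreal ((LINT y|lborel. indicator B y * \<bar>u y - T n (u y)\<bar>) + (LINT y|lborel. indicator B y * \<bar>T n (u y) - T n (g m y)\<bar>))"
    by (subst nn_integral_eq_integral) (auto intro!: Bochner_Integration.integrable_add i1 i2 simp: Bochner_Integration.integral_add[OF i1 i2] simp del: ennreal_plus)
  also have "\<dots> \<le> ennreal k" using n m by (intro ennreal_leI) simp
  finally have "(\<integral>\<^sup>+y. ennreal \<bar>u y - T n (g m y)\<bar> * indicator B y \<partial>lborel) \<le> ennreal k" .
  moreover have "continuous_on UNIV (\<lambda>y. T n (g m y))" unfolding T_def by (intro continuous_intros g)
  ultimately show ?thesis unfolding B_def by blast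
qed

lemma has_derivative_mollify:
  fixes u :: "real ^ 'n \<Rightarrow> real"
  assumes e: "0 < e" and u: "loc_integrable u"
  shows "(mollify e u has_derivative (\<lambda>h. (\<chi> i. LINT y|lborel. u y * mollifier_grad e (x - y) $ i) \<bullet> h)) (at x)"
  unfolding mollify_def[abs_def]
  by (rule has_derivative_convolution[OF u has_gradient_mollifier, where R=e]) (simp_all add: mollifier_zero[OF e])

lemma continuous_mollify:
  fixes u :: "real ^ 'n \<Rightarrow> real"
  assumes "0 < e" "loc_integrable u"
  shows "continuous_on UNIV (mollify e u)"
  using has_derivative_mollify[OF assms] by (blast intro: continuous_at_imp_continuous_on has_derivative_continuous)

text \<open>The Borel counterpart of \<open>distributional_gradient\<close>, with integrals over
  \<open>lborel\<close>.\<close>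

definition weak_gradient :: "(real ^ 'n \<Rightarrow> real) \<Rightarrow> (real ^ 'n \<Rightarrow> real ^ 'n) \<Rightarrow> bool" where
  "weak_gradient u g \<longleftrightarrow> loc_integrable u \<and> g \<in> borel_measurable borel \<and> (\<forall>i. loc_integrable (\<lambda>x. g x $ i)) \<and>
     (\<forall>f i. test_function f \<longrightarrow>
        (LINT x|lborel. u x * frechet_derivative f (at x) (axis i 1)) = - (LINT x|lborel. g x $ i * f x))"

definition mollify_grad :: "real \<Rightarrow> (real ^ 'n \<Rightarrow> real ^ 'n) \<Rightarrow> real ^ 'n \<Rightarrow> real ^ 'n" where
  "mollify_grad e g x = (\<chi> i. mollify e (\<lambda>y. g y $ i) x)"

text \<open>The gradient falls on the kernel, which is a test function of y for fixed x.
  Differentiating x - y in y changes the sign, and this cancels the minus sign in the definition of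
  the weak gradient.\<close>

lemma has_gradient_mollify:
  fixes u :: "real ^ 'n \<Rightarrow> real"
  assumes e: "0 < e" and g: "weak_gradient u g"
  shows "has_gradient (mollify e u) (mollify_grad e g)"
proof -
  have u: "loc_integrable u" and gi: "loc_integrable (\<lambda>x. g x $ i)" for i using g by (auto simp: weak_gradient_def)
  have "(LINT y|lborel. u y * mollifier_grad e (x - y) $ i) = mollify_grad e g x $ i" for x i
  proof -
    let ?f = "\<lambda>y. mollifier e (x - y)"
    have "frechet_derivative ?f (at y) (axis i 1) = - mollifier_grad e (x - y) $ i" for y
    proof -
      have "(mollifier e has_derivative (\<lambda>h. mollifier_grad e (x - y) \<bullet> h)) (at (x - y))"
        using has_gradient_mollifier[of e] unfolding has_gradient_def by blast
      moreover have "((\<lambda>y. x - y) has_derivative (\<lambda>h. - h)) (at y)"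
        by (auto intro!: derivative_eq_intros)
      ultimately have "(?f has_derivative (\<lambda>h. mollifier_grad e (x - y) \<bullet> (- h))) (at y)"
        by (rule has_derivative_compose[rotated])
      from frechet_derivative_at[OF this, symmetric] show ?thesis by (simp add: inner_axis)
    qed
    moreover have "(LINT y|lborel. u y * frechet_derivative ?f (at y) (axis i 1)) = - (LINT y|lborel. g y $ i * ?f y)"
      using g test_function_mollifier[OF e, of x] unfolding weak_gradient_def by blast
    ultimately show ?thesis by (simp add: mollify_grad_def mollify_def)
  qed
  then have "(\<chi> i. LINT y|lborel. u y * mollifier_grad e (x - y) $ i) = mollify_grad e g x" for x
    by (simp add: vec_eq_iff)
  with has_derivative_mollify[OF e u] have "(mollify e u has_derivative (\<lambda>h. mollify_grad e g x \<bullet> h)) (at x)" for x by metis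
  moreover have "continuous_on UNIV (mollify_grad e g)"
    unfolding mollify_grad_def[abs_def] by (intro continuous_on_vec_lambda continuous_mollify[OF e gi])
  ultimately show ?thesis by (simp add: has_gradient_def)
qed

text \<open>With a continuous w close to u, the error is split into the mollification of |u - w|,
  the oscillation of w at scale e, and |u - w|, each contributing k / 3. The radius R + 1 accounts
  for the support of the kernel, as e < 1.\<close>

lemma mollify_L1:
  fixes u :: "real ^ 'n \<Rightarrow> real"
  assumes u: "loc_integrable u" and k: "0 < k"
  shows "\<exists>e0>0. \<forall>e. 0 < e \<and> e < e0 \<longrightarrow>
    (\<integral>\<^sup>+x. ennreal \<bar>mollify e u x - u x\<bar> * indicator (cball 0 R) x \<partial>lborel) \<le> ennreal k"
proof -
  obtain w where w: "continuous_on UNIV w" "(\<integral>\<^sup>+y. ennreal \<bar>u y - w y\<bar> * indicator (cball 0 (R + 1)) y \<partial>lborel) \<le> ennreal (k / 3)"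
    using ex_continuous_L1_approx[OF u, of "k / 3" "R + 1"] k by auto
  have [measurable]: "u \<in> borel_measurable borel" "w \<in> borel_measurable borel"
    using u w by (auto simp: loc_integrable_def intro: borel_measurable_continuous_onI)
  have [measurable]: "cball (0 :: real ^ 'n) r \<in> sets borel" for r by simp
  define V where "V = measure lborel (cball (0 :: real ^ 'n) R)"
  have V: "emeasure lborel (cball (0 :: real ^ 'n) R) = ennreal V" "0 \<le> V"
    using emeasure_lborel_cball_finite[of "0 :: real ^ 'n" R] by (auto simp: V_def emeasure_eq_ennreal_measure)
  define k' where "k' = k / 3 / (V + 1)"
  have k': "0 < k'" "k' * V \<le> k / 3"
  proof -
    show "0 < k'" using k V by (simp add: k'_def)
    have "k' * V = k / 3 * (V / (V + 1))" by (simp add: k'_def)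
    also have "\<dots> \<le> k / 3 * 1" using k V by (intro mult_left_mono) auto
    finally show "k' * V \<le> k / 3" by simp
  qed
  have "uniformly_continuous_on (cball 0 (R + 1)) w"
    by (intro compact_uniformly_continuous continuous_on_subset[OF w(1)]) auto
  then obtain d where d: "d > 0" "\<And>x y. x \<in> cball 0 (R + 1) \<Longrightarrow> y \<in> cball 0 (R + 1) \<Longrightarrow> dist y x < d \<Longrightarrow> dist (w y) (w x) < k'"
    unfolding uniformly_continuous_on_def using k'(1) by metis
  show ?thesis
  proof (intro exI[of _ "min d 1"] conjI allI impI)
    fix e assume e0: "0 < e \<and> e < min d 1"
    then have e: "0 < e" by simp
    have [measurable]: "mollify e u \<in> borel_measurable borel"
      by (intro borel_measurable_continuous_onI continuous_mollify e u)
    let ?M = "\<lambda>x y :: real ^ 'n. ennreal (mollifier e (x - y))"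
    let ?B = "indicator (cball (0 :: real ^ 'n) R) :: _ \<Rightarrow> ennreal" and ?B1 = "indicator (cball (0 :: real ^ 'n) (R + 1)) :: _ \<Rightarrow> ennreal"
    have pt: "ennreal \<bar>mollify e u x - u x\<bar> * ?B x \<le>
      (\<integral>\<^sup>+y. ennreal \<bar>u y - w y\<bar> * ?B1 y * ?M x y \<partial>lborel) + (ennreal k' * ?B x + ennreal \<bar>u x - w x\<bar> * ?B1 x)" for x
    proof (cases "x \<in> cball 0 R")
      case True
      note im = integrable_mollifier_shift(1)[OF e, of x] and m1 = integrable_mollifier_shift(2)[OF e, of x]
      have iu: "integrable lborel (\<lambda>y. u y * mollifier e (x - y))" by (rule integrable_mollifier_mult[OF e u])
      have "mollify e u x - u x = (LINT y|lborel. u y * mollifier e (x - y) - u x * mollifier e (x - y))"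
        by (simp add: mollify_def iu im m1)
      then have "ennreal \<bar>mollify e u x - u x\<bar> \<le> (\<integral>\<^sup>+y. ennreal (norm (u y * mollifier e (x - y) - u x * mollifier e (x - y))) \<partial>lborel)"
        using integral_norm_bound_ennreal[of lborel "\<lambda>y. u y * mollifier e (x - y) - u x * mollifier e (x - y)"] iu im by simp
      also have "\<dots> \<le> (\<integral>\<^sup>+y. ennreal \<bar>u y - w y\<bar> * ?B1 y * ?M x y + (ennreal (k' + \<bar>u x - w x\<bar>) * ?M x y) \<partial>lborel)"
      proof (rule nn_integral_mono)
        fix y
        show "ennreal (norm (u y * mollifier e (x - y) - u x * mollifier e (x - y))) \<le> ennreal \<bar>u y - w y\<bar> * ?B1 y * ?M x y + (ennreal (k' + \<bar>u x - w x\<bar>) * ?M x y)"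
        proof (cases "norm (x - y) < e")
          case near: True
          have "norm y \<le> norm x + norm (x - y)" using norm_triangle_ineq4[of x "x - y"] by simp
          then have y: "y \<in> cball 0 (R + 1)" "x \<in> cball 0 (R + 1)" using near e0 True by auto
          have "dist y x < d" using near e0 by (simp add: dist_norm norm_minus_commute)
          then have "\<bar>w y - w x\<bar> < k'" using d(2)[OF y(2) y(1)] by (simp add: dist_real_def)
          then have "\<bar>u y - u x\<bar> \<le> \<bar>u y - w y\<bar> + (k' + \<bar>u x - w x\<bar>)" by linarith
          then have "\<bar>u y - u x\<bar> * mollifier e (x - y) \<le> (\<bar>u y - w y\<bar> + (k' + \<bar>u x - w x\<bar>)) * mollifier e (x - y)"
            by (rule mult_right_mono) (rule mollifier_nonneg[OF e])
          then have "ennreal (norm (u y * mollifier e (x - y) - u x * mollifier e (x - y))) \<le> ennreal ((\<bar>u y - w y\<bar> + (k' + \<bar>u x - w x\<bar>)) * mollifier e (x - y))"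
            using mollifier_nonneg[OF e, of "x - y"] by (intro ennreal_leI) (simp add: abs_mult left_diff_distrib[symmetric])
          also have "\<dots> = ennreal \<bar>u y - w y\<bar> * ?M x y + ennreal (k' + \<bar>u x - w x\<bar>) * ?M x y"
            using k'(1) mollifier_nonneg[OF e, of "x - y"]
            by (simp add: distrib_right ennreal_mult[symmetric] ennreal_plus[symmetric] del: ennreal_plus)
          finally show ?thesis using y by simp
        qed (simp add: mollifier_zero[OF e])
      qed
      also have "\<dots> = (\<integral>\<^sup>+y. ennreal \<bar>u y - w y\<bar> * ?B1 y * ?M x y \<partial>lborel) + ennreal (k' + \<bar>u x - w x\<bar>)"
        by (subst nn_integral_add) (simp_all add: nn_integral_cmult nn_integral_mollifier_shift(1)[OF e])
      finally show ?thesis using True k'(1) by (simp add: indicator_def)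
    qed (simp add: indicator_def)
    have "(\<integral>\<^sup>+x. ennreal \<bar>mollify e u x - u x\<bar> * ?B x \<partial>lborel) \<le>
      (\<integral>\<^sup>+x. (\<integral>\<^sup>+y. ennreal \<bar>u y - w y\<bar> * ?B1 y * ?M x y \<partial>lborel) + (ennreal k' * ?B x + ennreal \<bar>u x - w x\<bar> * ?B1 x) \<partial>lborel)"
      by (rule nn_integral_mono) (rule pt)
    also have "\<dots> = (\<integral>\<^sup>+x. (\<integral>\<^sup>+y. ennreal \<bar>u y - w y\<bar> * ?B1 y * ?M x y \<partial>lborel) \<partial>lborel)
      + ((\<integral>\<^sup>+x. ennreal k' * ?B x \<partial>lborel) + (\<integral>\<^sup>+x. ennreal \<bar>u x - w x\<bar> * ?B1 x \<partial>lborel))"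
      by (subst nn_integral_add, measurable, subst nn_integral_add, measurable)
    also have "(\<integral>\<^sup>+x. (\<integral>\<^sup>+y. ennreal \<bar>u y - w y\<bar> * ?B1 y * ?M x y \<partial>lborel) \<partial>lborel) =
      (\<integral>\<^sup>+y. (\<integral>\<^sup>+x. ennreal \<bar>u y - w y\<bar> * ?B1 y * ?M x y \<partial>lborel) \<partial>lborel)"
      by (rule lborel_pair.Fubini') measurable
    also have "\<dots> = (\<integral>\<^sup>+y. ennreal \<bar>u y - w y\<bar> * ?B1 y \<partial>lborel)"
    proof (rule nn_integral_cong)
      fix y
      have "(\<integral>\<^sup>+x. ennreal \<bar>u y - w y\<bar> * ?B1 y * ?M x y \<partial>lborel) = ennreal \<bar>u y - w y\<bar> * ?B1 y * (\<integral>\<^sup>+x. ?M x y \<partial>lborel)"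
        by (rule nn_integral_cmult) measurable
      then show "(\<integral>\<^sup>+x. ennreal \<bar>u y - w y\<bar> * ?B1 y * ?M x y \<partial>lborel) = ennreal \<bar>u y - w y\<bar> * ?B1 y"
        by (simp add: nn_integral_mollifier_shift(2)[OF e])
    qed
    also have "(\<integral>\<^sup>+x. ennreal k' * ?B x \<partial>lborel) = ennreal (k' * V)"
      using k'(1) V(2) by (subst nn_integral_cmult_indicator) (simp_all add: V(1) ennreal_mult)
    also have "(\<integral>\<^sup>+y. ennreal \<bar>u y - w y\<bar> * ?B1 y \<partial>lborel) + (ennreal (k' * V) + (\<integral>\<^sup>+x. ennreal \<bar>u x - w x\<bar> * ?B1 x \<partial>lborel))
      \<le> ennreal (k / 3) + (ennreal (k / 3) + ennreal (k / 3))"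
      by (intro add_mono w(2) ennreal_leI k'(2))
    also have "\<dots> = ennreal k" using k by (simp add: ennreal_plus[symmetric] del: ennreal_plus)
    finally show "(\<integral>\<^sup>+x. ennreal \<bar>mollify e u x - u x\<bar> * ?B x \<partial>lborel) \<le> ennreal k" .
  qed (use d in auto)
qed

text \<open>W is the gradient of the quadratic form at q. The inequality is the supporting
  hyperplane there, the defect being the form at p - q; the equation is Euler's identity for degree
  2.\<close>

lemma energy_density_convex:
  fixes x p q :: "real ^ 'n"
  assumes "CARD('n) \<ge> 2"
  defines "W \<equiv> (2 * energy_weight x * ((real CARD('n) - 1) / (real CARD('n))\<^sup>2)) *\<^sub>R
     (((real CARD('n) - 2) * (q \<bullet> x)) *\<^sub>R x + (norm x)\<^sup>2 *\<^sub>R q)"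
  shows "W \<bullet> p - energy_density x q \<le> energy_density x p" "W \<bullet> q = 2 * energy_density x q"
proof -
  let ?c = "energy_weight x * ((real CARD('n) - 1) / (real CARD('n))\<^sup>2)"
  have n: "(norm p)\<^sup>2 = p \<bullet> p" "(norm q)\<^sup>2 = q \<bullet> q" "(norm (p - q))\<^sup>2 = p \<bullet> p - 2 * (q \<bullet> p) + q \<bullet> q"
    by (simp_all add: power2_norm_eq_inner inner_diff_left inner_diff_right inner_commute)
  have "energy_density x p - (W \<bullet> p - energy_density x q) = energy_density x (p - q)"
    unfolding energy_density_def W_def n
    by (simp add: inner_add_left inner_diff_left inner_diff_right inner_commute power2_eq_square algebra_simps)
  then show "W \<bullet> p - energy_density x q \<le> energy_density x p"
    using energy_density_nonneg[OF assms(1), of x "p - q"] by simp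
  show "W \<bullet> q = 2 * energy_density x q"
    unfolding energy_density_def W_def n by (simp add: inner_add_left power2_eq_square algebra_simps inner_commute)
qed

text \<open>Inside the unit ball \<open>radial_z x\<close> is at most
  \<open>norm x powr (d / (d - 1))\<close>, whose exponent exceeds 1; outside,
  \<open>radial_z x < 1\<close> suffices.\<close>

lemma radial_z_le_norm:
  fixes x :: "real ^ 'n"
  assumes d: "CARD('n) \<ge> 2" and x: "x \<noteq> 0"
  shows "radial_z x \<le> norm x"
proof (cases "norm x \<le> 1")
  case True
  define l where "l = ln (norm x)"
  have l: "norm x = exp l" "l \<le> 0" using x True by (simp_all add: l_def)
  have b: "0 < dim_exp TYPE('n)" "dim_exp TYPE('n) \<le> 1" using dim_exp_pos[OF d] by (auto simp: dim_exp_def)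
  have "radial_z x = exp (l / dim_exp TYPE('n)) / (1 + exp (l / dim_exp TYPE('n)))"
    unfolding radial_z_def l_def[symmetric] logistic_def by (simp add: exp_minus field_simps add_pos_pos)
  also have "\<dots> \<le> exp (l / dim_exp TYPE('n)) / 1" by (intro divide_left_mono) (auto simp: add_pos_pos)
  also have "\<dots> \<le> exp l"
  proof -
    have "l * 1 \<le> l * dim_exp TYPE('n)" using b l(2) by (intro mult_left_mono_neg) auto
    then show ?thesis using b by (simp add: divide_le_eq)
  qed
  finally show ?thesis by (simp add: l)
qed (use radial_z_bounds[of x] in linarith)

text \<open>\<open>energy_weight x * norm x ^ 2\<close> equals (radial_z x / norm x)^(d - 2), which
  is at most 1. Hence a square integrable gradient has finite energy, and its square dominates all
  translates of the weight.\<close>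

lemma energy_density_le:
  fixes x p :: "real ^ 'n"
  assumes d: "CARD('n) \<ge> 2" and x: "x \<noteq> 0"
  shows "energy_density x p \<le> (norm p)\<^sup>2"
proof -
  define n where "n = CARD('n) - 2"
  have dn: "real CARD('n) = real n + 2" "CARD('n) = n + 2" using d by (auto simp: n_def)
  have nx: "norm x > 0" using x by simp
  have "energy_weight x * (norm x)\<^sup>2 = (radial_z x / norm x) ^ n"
    unfolding energy_weight_def n_def[symmetric] dn(2) using nx by (simp add: field_simps power_add power2_eq_square)
  also have "\<dots> \<le> 1" using radial_z_le_norm[OF d x] nx radial_z_bounds[of x] by (intro power_le_one) auto
  finally have w: "energy_weight x * (norm x)\<^sup>2 \<le> 1" .
  have c: "((real CARD('n) - 1) / (real CARD('n))) \<^sup>2 \<le> 1" using dn by (intro power_le_one) auto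
  have "energy_density x p \<le> energy_weight x * ((real CARD('n) - 1) / (real CARD('n))\<^sup>2 * ((real CARD('n) - 2) * ((norm x)\<^sup>2 * (norm p)\<^sup>2) + (norm x)\<^sup>2 * (norm p)\<^sup>2))"
    unfolding energy_density_def using dn energy_weight_nonneg[of x] norm_cauchy_schwarz_sq[of p x]
    by (intro mult_left_mono add_right_mono) auto
  also have "\<dots> = (energy_weight x * (norm x)\<^sup>2) * (((real CARD('n) - 1) / (real CARD('n))) \<^sup>2 * (norm p)\<^sup>2)"
  proof -
    have "(real CARD('n) - 2) * a + a = (real CARD('n) - 1) * a" for a by algebra
    then show ?thesis by (simp add: power2_eq_square)
  qed
  also have "\<dots> \<le> 1 * (1 * (norm p)\<^sup>2)"
    using w c by (intro mult_mono) (auto intro: mult_right_mono)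
  finally show ?thesis by simp
qed

lemma ennreal_integral_le_nn_integral:
  assumes h: "integrable M h" and le: "\<And>x. h x \<le> F x"
  shows "ennreal (LINT x|M. h x) \<le> (\<integral>\<^sup>+x. ennreal (F x) \<partial>M)"
proof -
  have i: "integrable M (\<lambda>x. max 0 (h x))" using h by (intro Bochner_Integration.integrable_max) auto
  have "ennreal (LINT x|M. h x) \<le> ennreal (LINT x|M. max 0 (h x))"
    using h i by (intro ennreal_leI integral_mono) auto
  also have "\<dots> = (\<integral>\<^sup>+x. ennreal (max 0 (h x)) \<partial>M)"
    by (rule nn_integral_eq_integral[OF i, symmetric]) simp
  also have "\<dots> \<le> (\<integral>\<^sup>+x. ennreal (F x) \<partial>M)"
  proof (rule nn_integral_mono)
    fix x show "ennreal (max 0 (h x)) \<le> ennreal (F x)"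
      using le[of x] by (cases "h x \<le> 0") (auto simp: max_def intro: ennreal_leI)
  qed
  finally show ?thesis .
qed

text \<open>Jensen's inequality with the weight frozen at x: the supporting hyperplane at the mean q
  is integrated against the kernel, and its linear part reproduces twice the form at q.\<close>

lemma energy_density_mollify_grad_le:
  fixes g :: "real ^ 'n \<Rightarrow> real ^ 'n"
  assumes d: "CARD('n) \<ge> 2" and e: "0 < e" and g: "\<And>i. loc_integrable (\<lambda>x. g x $ i)"
  shows "ennreal (energy_density x (mollify_grad e g x)) \<le>
    (\<integral>\<^sup>+y. ennreal (mollifier e (x - y) * energy_density x (g y)) \<partial>lborel)"
proof -
  define q where "q = mollify_grad e g x"
  define W where "W = (2 * energy_weight x * ((real CARD('n) - 1) / (real CARD('n))\<^sup>2)) *\<^sub>R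
     (((real CARD('n) - 2) * (q \<bullet> x)) *\<^sub>R x + (norm x)\<^sup>2 *\<^sub>R q)"
  note cv = energy_density_convex[OF d, of x q, folded W_def]
  let ?N = "energy_density x q" and ?m = "\<lambda>y. mollifier e (x - y)"
  note im = integrable_mollifier_shift(1)[OF e, of x] and m1 = integrable_mollifier_shift(2)[OF e, of x]
  have ig: "integrable lborel (\<lambda>y. g y $ i * ?m y)" for i by (rule integrable_mollifier_mult[OF e g])
  have s: "(W \<bullet> g y) * ?m y = (\<Sum>i\<in>UNIV. W $ i * (g y $ i * ?m y))" for y
    by (simp add: inner_vec_def sum_distrib_right mult.assoc)
  have iW: "integrable lborel (\<lambda>y. (W \<bullet> g y) * ?m y)"
    unfolding s by (intro Bochner_Integration.integrable_sum integrable_mult_right ig)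
  have "(LINT y|lborel. (W \<bullet> g y) * ?m y) = W \<bullet> q"
    unfolding s by (subst Bochner_Integration.integral_sum)
      (auto intro: ig integrable_mult_right simp: inner_vec_def q_def mollify_grad_def mollify_def)
  then have "(LINT y|lborel. (W \<bullet> g y) * ?m y - ?N * ?m y) = ?N"
    using iW im by (simp add: m1 cv(2))
  moreover have "ennreal (LINT y|lborel. (W \<bullet> g y) * ?m y - ?N * ?m y) \<le> (\<integral>\<^sup>+y. ennreal (?m y * energy_density x (g y)) \<partial>lborel)"
  proof (rule ennreal_integral_le_nn_integral)
    show "integrable lborel (\<lambda>y. (W \<bullet> g y) * ?m y - ?N * ?m y)"
      using iW im by (intro Bochner_Integration.integrable_diff integrable_mult_right)
    show "(W \<bullet> g y) * ?m y - ?N * ?m y \<le> ?m y * energy_density x (g y)" for y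
      using mult_left_mono[OF cv(1)[of "g y"] mollifier_nonneg[OF e, of "x - y"]] by (simp add: algebra_simps)
  qed
  ultimately show ?thesis by (simp add: q_def)
qed

text \<open>The substitution x = y + h keeps the gradient at y and moves the shift to the weight.
  What remains to be controlled is a translation of an explicit function.\<close>

lemma energy_mollify_grad_le:
  fixes g :: "real ^ 'n \<Rightarrow> real ^ 'n"
  assumes d: "CARD('n) \<ge> 2" and e: "0 < e" and [measurable]: "g \<in> borel_measurable borel"
    and g: "\<And>i. loc_integrable (\<lambda>x. g x $ i)"
  shows "energy (mollify_grad e g) \<le>
    (\<integral>\<^sup>+h. ennreal (mollifier e h) * (\<integral>\<^sup>+y. ennreal (energy_density (y + h) (g y)) \<partial>lborel) \<partial>lborel)"
proof -
  have m1 [measurable]: "(\<lambda>(x, y). ennreal (mollifier e (x - y) * energy_density x (g y))) \<in> borel_measurable (borel \<Otimes>\<^sub>M borel)"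
    unfolding energy_density_def by measurable
  have m2: "(\<lambda>(y, h). ennreal (mollifier e h * energy_density (y + h) (g y))) \<in> borel_measurable (lborel \<Otimes>\<^sub>M lborel)"
    unfolding energy_density_def by measurable
  have m3: "(\<lambda>y. ennreal (energy_density (y + h) (g y))) \<in> borel_measurable lborel" for h
    unfolding energy_density_def by measurable
  have "energy (mollify_grad e g) \<le> (\<integral>\<^sup>+x. (\<integral>\<^sup>+y. ennreal (mollifier e (x - y) * energy_density x (g y)) \<partial>lborel) \<partial>lborel)"
    unfolding energy_def by (intro nn_integral_mono energy_density_mollify_grad_le[OF d e g])
  also have "\<dots> = (\<integral>\<^sup>+y. (\<integral>\<^sup>+x. ennreal (mollifier e (x - y) * energy_density x (g y)) \<partial>lborel) \<partial>lborel)"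
    by (rule lborel_pair.Fubini'[symmetric, of "\<lambda>x y. ennreal (mollifier e (x - y) * energy_density x (g y))"]) (use m1 in simp)
  also have "\<dots> = (\<integral>\<^sup>+y. (\<integral>\<^sup>+h. ennreal (mollifier e h * energy_density (y + h) (g y)) \<partial>lborel) \<partial>lborel)"
  proof (rule nn_integral_cong)
    fix y
    have "(\<lambda>x. ennreal (mollifier e (x - y) * energy_density x (g y))) \<in> borel_measurable borel"
      unfolding energy_density_def by measurable
    from nn_integral_translate[OF this, of y]
    show "(\<integral>\<^sup>+x. ennreal (mollifier e (x - y) * energy_density x (g y)) \<partial>lborel) = (\<integral>\<^sup>+h. ennreal (mollifier e h * energy_density (y + h) (g y)) \<partial>lborel)"
      by simp
  qed
  also have "\<dots> = (\<integral>\<^sup>+h. (\<integral>\<^sup>+y. ennreal (mollifier e h * energy_density (y + h) (g y)) \<partial>lborel) \<partial>lborel)"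
    by (rule lborel_pair.Fubini'[symmetric, of "\<lambda>y h. ennreal (mollifier e h * energy_density (y + h) (g y))"]) (rule m2)
  also have "\<dots> = (\<integral>\<^sup>+h. ennreal (mollifier e h) * (\<integral>\<^sup>+y. ennreal (energy_density (y + h) (g y)) \<partial>lborel) \<partial>lborel)"
    unfolding ennreal_mult'[OF mollifier_nonneg[OF e]] by (simp only: nn_integral_cmult[OF m3])
  finally show ?thesis .
qed

lemma energy_density_tendsto:
  fixes x :: "real ^ 'n"
  assumes d: "CARD('n) \<ge> 2" and x: "x \<noteq> 0" and X: "X \<longlonglongrightarrow> x"
  shows "(\<lambda>n. energy_density (X n) p) \<longlonglongrightarrow> energy_density x p"
proof -
  have "(\<lambda>n. ln (norm (X n)) / dim_exp TYPE('n)) \<longlonglongrightarrow> ln (norm x) / dim_exp TYPE('n)"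
    using x dim_exp_pos[OF d] by (intro tendsto_intros X) auto
  then have "(\<lambda>n. radial_z (X n)) \<longlonglongrightarrow> radial_z x"
    unfolding radial_z_def by (rule isCont_tendsto_compose[OF isCont_logistic])
  then show ?thesis
    unfolding energy_density_def energy_weight_def using x by (intro tendsto_intros X) auto
qed

text \<open>Dominated convergence along a sequence h tending to 0: the weight is continuous off the
  origin and \<open>(norm (g y))^2\<close> is a majorant.\<close>

lemma translated_energy_le:
  fixes g :: "real ^ 'n \<Rightarrow> real ^ 'n"
  assumes d: "CARD('n) \<ge> 2" and [measurable]: "g \<in> borel_measurable borel"
    and g: "(\<integral>\<^sup>+y. ennreal ((norm (g y))\<^sup>2) \<partial>lborel) < \<infinity>" and k: "0 < k"
  shows "\<exists>e0>0. \<forall>h. norm h < e0 \<longrightarrow> (\<integral>\<^sup>+y. ennreal (energy_density (y + h) (g y)) \<partial>lborel) \<le> energy g + ennreal k"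
proof (rule ccontr)
  assume "\<not> ?thesis"
  then have "\<forall>n::nat. \<exists>h. norm h < 1 / (real n + 1) \<and> \<not> (\<integral>\<^sup>+y. ennreal (energy_density (y + h) (g y)) \<partial>lborel) \<le> energy g + ennreal k"
    by (metis add_pos_nonneg of_nat_0_le_iff zero_less_divide_1_iff zero_less_one add.commute)
  then obtain h where h: "\<And>n::nat. norm (h n) < 1 / (real n + 1)"
    "\<And>n. energy g + ennreal k < (\<integral>\<^sup>+y. ennreal (energy_density (y + h n) (g y)) \<partial>lborel)"
    by (metis not_le)
  have "(\<lambda>n. norm (h n)) \<longlonglongrightarrow> 0"
    using h(1) by (intro tendsto_sandwich[OF _ _ tendsto_const LIMSEQ_inverse_real_of_nat])
      (auto simp: inverse_eq_divide add.commute intro!: always_eventually less_imp_le)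
  then have h0: "h \<longlonglongrightarrow> 0" by (rule tendsto_norm_zero_cancel)
  have "(\<lambda>n. \<integral>\<^sup>+y. ennreal (energy_density (y + h n) (g y)) \<partial>lborel) \<longlonglongrightarrow> (\<integral>\<^sup>+y. ennreal (energy_density y (g y)) \<partial>lborel)"
  proof (rule nn_integral_dominated_convergence[where w="\<lambda>y. ennreal ((norm (g y))\<^sup>2)"])
    show "(\<lambda>y. ennreal (energy_density (y + h n) (g y))) \<in> borel_measurable lborel" for n
      unfolding energy_density_def by measurable
    show "(\<lambda>y. ennreal (energy_density y (g y))) \<in> borel_measurable lborel"
      unfolding energy_density_def by measurable
    show "AE y in lborel. ennreal (energy_density (y + h n) (g y)) \<le> ennreal ((norm (g y))\<^sup>2)" for n
      using AE_lborel_singleton[of "- h n"]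
    proof eventually_elim
      fix y assume "y \<noteq> - h n"
      then have "y + h n \<noteq> 0" by (simp add: eq_neg_iff_add_eq_0)
      then show "ennreal (energy_density (y + h n) (g y)) \<le> ennreal ((norm (g y))\<^sup>2)"
        by (intro ennreal_leI energy_density_le[OF d])
    qed
    show "AE y in lborel. (\<lambda>n. ennreal (energy_density (y + h n) (g y))) \<longlonglongrightarrow> ennreal (energy_density y (g y))"
      using AE_lborel_singleton[of 0]
    proof eventually_elim
      fix y :: "real ^ 'n" assume "y \<noteq> 0"
      then show "(\<lambda>n. ennreal (energy_density (y + h n) (g y))) \<longlonglongrightarrow> ennreal (energy_density y (g y))"
        using tendsto_add[OF tendsto_const h0, of y] by (intro tendsto_ennrealI energy_density_tendsto[OF d]) simp_all
    qed
  qed (use g in simp_all)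
  then have "energy g + ennreal k \<le> energy g"
    unfolding energy_def[symmetric] by (rule tendsto_lowerbound) (auto intro!: always_eventually less_imp_le h(2))
  moreover have "energy g < \<infinity>"
  proof -
    have "energy g \<le> (\<integral>\<^sup>+y. ennreal ((norm (g y))\<^sup>2) \<partial>lborel)"
      unfolding energy_def using AE_lborel_singleton[of 0]
      by (intro nn_integral_mono_AE, eventually_elim) (intro ennreal_leI energy_density_le[OF d])
    then show ?thesis using g by (rule order.strict_trans1)
  qed
  ultimately show False using k by (cases "energy g") (auto simp: ennreal_plus[symmetric] simp del: ennreal_plus)
qed

lemma energy_mollify_grad_limit:
  fixes g :: "real ^ 'n \<Rightarrow> real ^ 'n"
  assumes d: "CARD('n) \<ge> 2" and gm[measurable]: "g \<in> borel_measurable borel"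
    and gi: "\<And>i. loc_integrable (\<lambda>x. g x $ i)"
    and g: "(\<integral>\<^sup>+y. ennreal ((norm (g y))\<^sup>2) \<partial>lborel) < \<infinity>" and k: "0 < k"
  shows "\<exists>e0>0. \<forall>e. 0 < e \<and> e < e0 \<longrightarrow> energy (mollify_grad e g) \<le> energy g + ennreal k"
proof -
  obtain e0 where e0: "e0 > 0" "\<And>h. norm h < e0 \<Longrightarrow> (\<integral>\<^sup>+y. ennreal (energy_density (y + h) (g y)) \<partial>lborel) \<le> energy g + ennreal k"
    using translated_energy_le[OF d gm g k] by blast
  have "energy (mollify_grad e g) \<le> energy g + ennreal k" if e: "0 < e" "e < e0" for e
  proof -
    have "energy (mollify_grad e g) \<le> (\<integral>\<^sup>+h. ennreal (mollifier e h) * (\<integral>\<^sup>+y. ennreal (energy_density (y + h) (g y)) \<partial>lborel) \<partial>lborel)"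
      by (rule energy_mollify_grad_le[OF d e(1) gm gi])
    also have "\<dots> \<le> (\<integral>\<^sup>+h. ennreal (mollifier e (h :: real ^ 'n)) * (energy g + ennreal k) \<partial>lborel)"
    proof (rule nn_integral_mono)
      fix h :: "real ^ 'n"
      show "ennreal (mollifier e h) * (\<integral>\<^sup>+y. ennreal (energy_density (y + h) (g y)) \<partial>lborel) \<le> ennreal (mollifier e h) * (energy g + ennreal k)"
        using e0(2)[of h] e by (cases "norm h < e") (auto intro: mult_left_mono simp: mollifier_zero)
    qed
    also have "\<dots> = energy g + ennreal k"
      by (subst nn_integral_multc) (simp_all add: nn_integral_mollifier[OF e(1)])
    finally show ?thesis .
  qed
  then show ?thesis using e0(1) by blast
qed

text \<open>The vector X inserted into the quadratic form has norm d * radial_z x / norm x. Its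
  power d - 2 produces \<open>energy_weight\<close> and most of the powers of d.\<close>

lemma Gform_eq:
  fixes x p :: "real ^ 'n"
  assumes d: "CARD('n) \<ge> 2" and x: "x \<noteq> 0"
  shows "Gform x p = real CARD('n) ^ (CARD('n) - 1) * (real CARD('n) - 1) * energy_density x p"
proof -
  define d where "d = real CARD('n)"
  define n where "n = CARD('n) - 2"
  have dn: "d = real n + 2" "CARD('n) = n + 2" "CARD('n) - 1 = Suc n" using assms by (auto simp: n_def d_def)
  define s where "s = norm x powr (d / (d - 1))"
  define c where "c = d * norm x powr (- ((d - 2) / (d - 1))) / (1 + s)"
  define q where "q = (d - 2) * (p \<bullet> x)\<^sup>2 + (norm x)\<^sup>2 * (norm p)\<^sup>2"
  define X where "X = (- c) *\<^sub>R x"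
  have r: "norm x > 0" using x by simp
  have s: "s > 0" using x by (simp add: s_def)
  have c: "c > 0" using x s dn by (simp add: c_def add_pos_pos)
  have X: "X \<noteq> 0" using c x by (simp add: X_def)
  have nX: "norm X = c * norm x" using c by (simp add: X_def)
  have z: "radial_z x = s / (1 + s)" unfolding s_def d_def by (rule radial_z_eq[OF d x])
  have "norm x powr (- ((d - 2) / (d - 1))) * norm x * norm x = norm x powr (- ((d - 2) / (d - 1)) + 1 + 1)"
    by (simp only: powr_add powr_one[OF less_imp_le[OF r]])
  also have "- ((d - 2) / (d - 1)) + 1 + 1 = d / (d - 1)" using dn by (simp add: field_simps)
  \<comment> \<open>Two factors of the norm raise the exponent -(d - 2) / (d - 1) to d / (d - 1),
    the power that occurs in \<open>radial_z\<close>.\<close>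
  finally have cx: "c * norm x * norm x = d * radial_z x"
    unfolding z c_def s_def[symmetric] by (simp add: mult.assoc)
  \<comment> \<open>The exponent d - 4 is negative for d = 2 and d = 3. Merged with the square it
    becomes the natural number d - 2.\<close>
  have pw: "norm X powi (int CARD('n) - 4) * (norm X)\<^sup>2 = norm X ^ n"
  proof -
    have "norm X powi (int CARD('n) - 4) * norm X powi 2 = norm X powi (int CARD('n) - 4 + 2)"
      using X by (subst power_int_add) auto
    also have "int CARD('n) - 4 + 2 = int n" using dn by simp
    finally show ?thesis by simp
  qed
  have "Gform x p = Qform X (((d - 1) / d) *\<^sub>R p)"
    unfolding Gform_def Let_def X_def c_def s_def d_def by simp
  also have "\<dots> = d * norm X powi (int CARD('n) - 4) *
           ((d - 2) * (X \<bullet> (((d - 1) / d) *\<^sub>R p))\<^sup>2 + (norm X)\<^sup>2 * (norm (((d - 1) / d) *\<^sub>R p))\<^sup>2)"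
    unfolding Qform_eq[OF X] d_def ..
  also have "(d - 2) * (X \<bullet> (((d - 1) / d) *\<^sub>R p))\<^sup>2 + (norm X)\<^sup>2 * (norm (((d - 1) / d) *\<^sub>R p))\<^sup>2
      = (norm X)\<^sup>2 * ((((d - 1) / d)\<^sup>2 / (norm x)\<^sup>2) * q)"
  proof -
    have "X \<bullet> (((d - 1) / d) *\<^sub>R p) = - (c * ((d - 1) / d)) * (p \<bullet> x)" by (simp add: X_def inner_commute)
    then have e1: "(X \<bullet> (((d - 1) / d) *\<^sub>R p))\<^sup>2 = (norm X)\<^sup>2 / (norm x)\<^sup>2 * ((d - 1) / d)\<^sup>2 * (p \<bullet> x)\<^sup>2"
      unfolding nX using r by (simp only: power_mult_distrib power2_minus) (simp add: field_simps)
    have e2: "(norm (((d - 1) / d) *\<^sub>R p))\<^sup>2 = ((d - 1) / d)\<^sup>2 * (norm p)\<^sup>2"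
      by (simp only: norm_scaleR power_mult_distrib power2_abs)
    have "(d - 2) * (a / R * b * t) + a * (b * w) = a * ((b / R) * ((d - 2) * t + R * w))" if "R \<noteq> 0" for a b t w R :: real
      using that by (simp add: field_simps)
    from this[of "(norm x)\<^sup>2"] show ?thesis unfolding q_def e1 e2 using r by simp
  qed
  also have "d * norm X powi (int CARD('n) - 4) * ((norm X)\<^sup>2 * ((((d - 1) / d)\<^sup>2 / (norm x)\<^sup>2) * q))
      = d * norm X ^ n * ((((d - 1) / d)\<^sup>2 / (norm x)\<^sup>2) * q)"
    unfolding pw[symmetric] by (simp only: mult.assoc)
  also have "norm X = d * radial_z x / norm x"
    unfolding nX cx[symmetric] using r by simp
  also have "d * (d * radial_z x / norm x) ^ n * ((((d - 1) / d)\<^sup>2 / (norm x)\<^sup>2) * q)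
      = d ^ Suc n * (d - 1) * (energy_weight x * ((d - 1) / d\<^sup>2 * q))"
    unfolding energy_weight_def n_def[symmetric] dn(2) using r
    by (simp add: power_divide power_mult_distrib power_add field_simps power2_eq_square)
  finally show ?thesis
    unfolding energy_density_def q_def dn(3) d_def .
qed

text \<open>The constant of the theorem cancels the factor from \<open>Gform_eq\<close> and leaves
  the normalisation of the probability measure.\<close>

lemma onofri_const_eq:
  assumes d: "CARD('n::finite) \<ge> 2"
  shows "onofri_const CARD('n) * (real CARD('n) ^ (CARD('n) - 1) * (real CARD('n) - 1)) = 1 / sphere_measure (sphere (0 :: real ^ 'n) 1)"
    "0 < sphere_measure (sphere (0 :: real ^ 'n) 1)"
proof -
  let ?d = "real CARD('n)"
  have G: "Gamma (?d / 2) > 0" using d by (intro Gamma_real_pos) auto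
  have "?d ^ (CARD('n) - 1) = ?d powr (?d - 1)"
    using powr_realpow[of ?d "CARD('n) - 1"] d by (simp add: of_nat_diff)
  then have "?d powr (1 - ?d) * ?d ^ (CARD('n) - 1) = 1"
    using d by (simp flip: powr_add)
  moreover have "onofri_const CARD('n) * (?d ^ (CARD('n) - 1) * (?d - 1)) =
    (?d powr (1 - ?d) * ?d ^ (CARD('n) - 1)) * (Gamma (?d / 2) / (2 * pi powr (?d / 2)))"
    using d by (simp add: onofri_const_def field_simps)
  ultimately show "onofri_const CARD('n) * (?d ^ (CARD('n) - 1) * (?d - 1)) = 1 / sphere_measure (sphere (0 :: real ^ 'n) 1)"
    by (simp add: sphere_measure_unit_sphere)
  show "0 < sphere_measure (sphere (0 :: real ^ 'n) 1)"
    using G by (simp add: sphere_measure_unit_sphere)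
qed

subsection \<open>The general case\<close>

text \<open>Both sides are twice the variance; expanding the square makes the mean appear only in
  the cross term.\<close>

lemma (in finite_measure) nn_integral_pairwise_difference:
  fixes a :: "'a \<Rightarrow> real"
  assumes one: "measure M (space M) = 1"
    and a: "integrable M a" and a2: "integrable M (\<lambda>x. (a x)\<^sup>2)"
  shows "(\<integral>\<^sup>+x. (\<integral>\<^sup>+y. ennreal ((a x - a y)\<^sup>2) \<partial>M) \<partial>M) = ennreal (2 * (LINT x|M. (a x)\<^sup>2) - 2 * (LINT x|M. a x)\<^sup>2)"
proof -
  define m s where "m = (LINT x|M. a x)" and "s = (LINT x|M. (a x)\<^sup>2)"
  have e: "(a x - a y)\<^sup>2 = (a x)\<^sup>2 - 2 * a x * a y + (a y)\<^sup>2" for x y by (simp add: power2_diff)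
  have in1: "integrable M (\<lambda>y. (a x)\<^sup>2 - 2 * a x * a y + (a y)\<^sup>2)" for x using a a2 by simp
  have I1: "(LINT y|M. (a x)\<^sup>2 - 2 * a x * a y + (a y)\<^sup>2) = (a x)\<^sup>2 - 2 * a x * m + s" for x
    using a a2 by (simp add: m_def s_def one)
  have inner: "(\<integral>\<^sup>+y. ennreal ((a x - a y)\<^sup>2) \<partial>M) = ennreal ((a x)\<^sup>2 - 2 * a x * m + s)" for x
    unfolding e I1[symmetric] using in1 by (intro nn_integral_eq_integral) (auto simp flip: e)
  have nn: "0 \<le> (a x)\<^sup>2 - 2 * a x * m + s" for x
    unfolding I1[symmetric] by (intro Bochner_Integration.integral_nonneg) (simp flip: e)
  have "(\<integral>\<^sup>+x. ennreal ((a x)\<^sup>2 - 2 * a x * m + s) \<partial>M) = ennreal (LINT x|M. (a x)\<^sup>2 - 2 * a x * m + s)"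
    using a a2 nn by (intro nn_integral_eq_integral) auto
  also have "(LINT x|M. (a x)\<^sup>2 - 2 * a x * m + s) = 2 * s - 2 * m\<^sup>2"
    using a a2 by (simp add: m_def[symmetric] s_def[symmetric] one) (simp add: power2_eq_square)
  finally show ?thesis by (simp add: inner m_def s_def)
qed

lemma (in finite_measure) integrable_of_integrable_square:
  fixes a :: "'a \<Rightarrow> real"
  assumes [measurable]: "a \<in> borel_measurable M" and a2: "integrable M (\<lambda>x. (a x)\<^sup>2)"
  shows "integrable M a"
proof (rule Bochner_Integration.integrable_bound[of _ "\<lambda>x. 1 + (a x)\<^sup>2"])
  show "AE x in M. norm (a x) \<le> norm (1 + (a x)\<^sup>2)"
  proof (intro AE_I2)
    fix x
    have "0 \<le> (\<bar>a x\<bar> - 1)\<^sup>2" by simp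
    then have "2 * \<bar>a x\<bar> \<le> 1 + (a x)\<^sup>2" by (simp add: power2_diff)
    then show "norm (a x) \<le> norm (1 + (a x)\<^sup>2)" by simp
  qed
qed (use a2 in simp_all)

text \<open>The second moment about any c is at least the variance, so the unspecified constant of
  \<open>smooth_poincare\<close> is good enough.\<close>

lemma (in finite_measure) nn_integral_pairwise_difference_le:
  fixes a :: "'a \<Rightarrow> real"
  assumes one: "measure M (space M) = 1"
    and [measurable]: "a \<in> borel_measurable M" and fin: "(\<integral>\<^sup>+x. ennreal ((a x - c)\<^sup>2) \<partial>M) < \<infinity>"
  shows "(\<integral>\<^sup>+x. (\<integral>\<^sup>+y. ennreal ((a x - a y)\<^sup>2) \<partial>M) \<partial>M) \<le> 2 * (\<integral>\<^sup>+x. ennreal ((a x - c)\<^sup>2) \<partial>M)"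
proof -
  have i2: "integrable M (\<lambda>x. (a x - c)\<^sup>2)"
    using fin by (intro integrableI_nonneg) auto
  have i1: "integrable M (\<lambda>x. a x - c)" by (rule integrable_of_integrable_square[OF _ i2]) simp
  have "(\<integral>\<^sup>+x. (\<integral>\<^sup>+y. ennreal ((a x - a y)\<^sup>2) \<partial>M) \<partial>M) = (\<integral>\<^sup>+x. (\<integral>\<^sup>+y. ennreal (((a x - c) - (a y - c))\<^sup>2) \<partial>M) \<partial>M)"
    by simp
  also have "\<dots> = ennreal (2 * (LINT x|M. (a x - c)\<^sup>2) - 2 * (LINT x|M. a x - c)\<^sup>2)"
    by (rule nn_integral_pairwise_difference[OF one i1 i2])
  also have "\<dots> \<le> ennreal (2 * (LINT x|M. (a x - c)\<^sup>2))" by (intro ennreal_leI) simp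
  also have "\<dots> = 2 * (\<integral>\<^sup>+x. ennreal ((a x - c)\<^sup>2) \<partial>M)"
    by (subst nn_integral_eq_integral[OF i2]) (auto simp: ennreal_mult)
  finally show ?thesis .
qed

text \<open>The converse passage, in which square integrability of a is a conclusion: it is read off
  from one slice of the double integral.\<close>

lemma (in finite_measure) variance_le_of_pairwise_difference:
  fixes a :: "'a \<Rightarrow> real"
  assumes one: "measure M (space M) = 1"
    and a: "integrable M a" and B: "(\<integral>\<^sup>+x. (\<integral>\<^sup>+y. ennreal ((a x - a y)\<^sup>2) \<partial>M) \<partial>M) \<le> ennreal (2 * B)" "0 \<le> B"
  shows "integrable M (\<lambda>x. (a x - (LINT y|M. a y))\<^sup>2)" "(LINT x|M. (a x - (LINT y|M. a y))\<^sup>2) \<le> B"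
proof -
  have [measurable]: "a \<in> borel_measurable M" using a by simp
  have "(\<integral>\<^sup>+x. (\<integral>\<^sup>+y. ennreal ((a x - a y)\<^sup>2) \<partial>M) \<partial>M) \<noteq> \<infinity>"
    using B(1) by (auto simp: top_unique)
  then have "AE x in M. (\<integral>\<^sup>+y. ennreal ((a x - a y)\<^sup>2) \<partial>M) \<noteq> \<infinity>"
    by (intro nn_integral_PInf_AE) auto
  moreover have "ae_filter M \<noteq> bot" using one by (auto simp: ae_filter_eq_bot_iff measure_def)
  \<comment> \<open>Almost every slice is finite and the measure is not zero, so a finite slice
    exists; a^2 is its integrand plus an integrable function.\<close>
  ultimately obtain z where z: "(\<integral>\<^sup>+y. ennreal ((a z - a y)\<^sup>2) \<partial>M) \<noteq> \<infinity>"
    using eventually_happens' by blast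
  have iz: "integrable M (\<lambda>y. (a z - a y)\<^sup>2)"
    using z by (intro integrableI_nonneg) (auto simp: less_top)
  have "integrable M (\<lambda>y. (a z - a y)\<^sup>2 + (2 * a z * a y - (a z)\<^sup>2))" using iz a by simp
  moreover have "(\<lambda>y. (a z - a y)\<^sup>2 + (2 * a z * a y - (a z)\<^sup>2)) = (\<lambda>y. (a y)\<^sup>2)" by (simp add: power2_diff)
  ultimately have a2: "integrable M (\<lambda>y. (a y)\<^sup>2)" by (simp only:)
  define m s where "m = (LINT x|M. a x)" and "s = (LINT x|M. (a x)\<^sup>2)"
  have e: "(a x - m)\<^sup>2 = (a x)\<^sup>2 - 2 * m * a x + m\<^sup>2" for x by (simp add: power2_diff)
  show "integrable M (\<lambda>x. (a x - (LINT y|M. a y))\<^sup>2)"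
    unfolding m_def[symmetric] e using a a2 by simp
  have "(LINT x|M. (a x - m)\<^sup>2) = s - m\<^sup>2"
    unfolding e using a a2 by (simp add: m_def[symmetric] s_def[symmetric] one) (simp add: power2_eq_square)
  moreover have "2 * s - 2 * m\<^sup>2 \<le> 2 * B"
    using B unfolding nn_integral_pairwise_difference[OF one a a2] m_def[symmetric] s_def[symmetric]
    by (simp add: ennreal_le_iff)
  ultimately show "(LINT x|M. (a x - (LINT y|M. a y))\<^sup>2) \<le> B" by (simp add: m_def)
qed

text \<open>Fatou's lemma for the inner and then for the outer integral, so that convergence almost
  everywhere in each variable separately is enough.\<close>

lemma nn_integral_pairwise_difference_liminf:
  fixes a :: "nat \<Rightarrow> 'a \<Rightarrow> real"
  assumes "sigma_finite_measure M" and [measurable]: "\<And>n. a n \<in> borel_measurable M" "b \<in> borel_measurable M"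
    and lim: "AE x in M. (\<lambda>n. a n x) \<longlonglongrightarrow> b x"
  shows "(\<integral>\<^sup>+x. (\<integral>\<^sup>+y. ennreal ((b x - b y)\<^sup>2) \<partial>M) \<partial>M) \<le>
    liminf (\<lambda>n. \<integral>\<^sup>+x. (\<integral>\<^sup>+y. ennreal ((a n x - a n y)\<^sup>2) \<partial>M) \<partial>M)"
proof -
  interpret sigma_finite_measure M by fact
  have "(\<integral>\<^sup>+x. (\<integral>\<^sup>+y. ennreal ((b x - b y)\<^sup>2) \<partial>M) \<partial>M) \<le> (\<integral>\<^sup>+x. liminf (\<lambda>n. \<integral>\<^sup>+y. ennreal ((a n x - a n y)\<^sup>2) \<partial>M) \<partial>M)"
    using lim
  proof (intro nn_integral_mono_AE, eventually_elim)
    fix x assume x: "(\<lambda>n. a n x) \<longlonglongrightarrow> b x"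
    have "(\<integral>\<^sup>+y. ennreal ((b x - b y)\<^sup>2) \<partial>M) = (\<integral>\<^sup>+y. liminf (\<lambda>n. ennreal ((a n x - a n y)\<^sup>2)) \<partial>M)"
      using lim
    proof (intro nn_integral_cong_AE, eventually_elim)
      fix y assume y: "(\<lambda>n. a n y) \<longlonglongrightarrow> b y"
      have "(\<lambda>n. ennreal ((a n x - a n y)\<^sup>2)) \<longlonglongrightarrow> ennreal ((b x - b y)\<^sup>2)"
        by (intro tendsto_ennrealI tendsto_intros x y)
      from lim_imp_Liminf[OF sequentially_bot this]
      show "ennreal ((b x - b y)\<^sup>2) = liminf (\<lambda>n. ennreal ((a n x - a n y)\<^sup>2))" by (rule sym)
    qed
    also have "\<dots> \<le> liminf (\<lambda>n. \<integral>\<^sup>+y. ennreal ((a n x - a n y)\<^sup>2) \<partial>M)" by (rule nn_integral_liminf) measurable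
    finally show "(\<integral>\<^sup>+y. ennreal ((b x - b y)\<^sup>2) \<partial>M) \<le> liminf (\<lambda>n. \<integral>\<^sup>+y. ennreal ((a n x - a n y)\<^sup>2) \<partial>M)" .
  qed
  also have "\<dots> \<le> liminf (\<lambda>n. \<integral>\<^sup>+x. (\<integral>\<^sup>+y. ennreal ((a n x - a n y)\<^sup>2) \<partial>M) \<partial>M)"
    by (rule nn_integral_liminf) measurable
  finally show ?thesis .
qed

text \<open>The Borel version of \<open>onofri_measure\<close>: the densities agree off the origin,
  and \<open>lborel\<close> replaces its completion.\<close>

definition mass_measure :: "(real ^ 'n) measure" where
  "mass_measure = density lborel (\<lambda>x. ennreal (mass_density x / sphere_measure (sphere (0 :: real ^ 'n) 1)))"

lemma emeasure_mass_measure: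
  assumes d: "CARD('n) \<ge> 2"
  shows "emeasure (mass_measure :: (real ^ 'n) measure) (space mass_measure) = 1"
proof -
  let ?A = "sphere_measure (sphere (0 :: real ^ 'n) 1)"
  note A = onofri_const_eq(2)[OF d]
  have "emeasure (mass_measure :: (real ^ 'n) measure) (space mass_measure) = (\<integral>\<^sup>+x. ennreal (mass_density (x :: real ^ 'n)) / ennreal ?A \<partial>lborel)"
    using A by (simp add: mass_measure_def emeasure_density divide_ennreal mass_density_nonneg)
  also have "\<dots> = ennreal ?A / ennreal ?A"
    by (subst nn_integral_divide) (simp_all add: total_mass[OF d])
  also have "\<dots> = 1" using A by (simp add: divide_ennreal)
  finally show ?thesis .
qed

lemma mass_eq_mass_measure:
  fixes w :: "real ^ 'n \<Rightarrow> real"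
  assumes d: "CARD('n) \<ge> 2" and [measurable]: "w \<in> borel_measurable borel"
  shows "mass w = ennreal (sphere_measure (sphere (0 :: real ^ 'n) 1)) * (\<integral>\<^sup>+x. ennreal ((w x)\<^sup>2) \<partial>mass_measure)"
proof -
  let ?A = "sphere_measure (sphere (0 :: real ^ 'n) 1)"
  note A = onofri_const_eq(2)[OF d]
  have "(\<integral>\<^sup>+x. ennreal ((w x)\<^sup>2) \<partial>mass_measure) = (\<integral>\<^sup>+x. ennreal (mass_density x / ?A) * ennreal ((w x)\<^sup>2) \<partial>lborel)"
    unfolding mass_measure_def by (subst nn_integral_density) measurable
  then have "ennreal ?A * (\<integral>\<^sup>+x. ennreal ((w x)\<^sup>2) \<partial>mass_measure) = (\<integral>\<^sup>+x. ennreal ?A * (ennreal (mass_density x / ?A) * ennreal ((w x)\<^sup>2)) \<partial>lborel)"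
    by (subst nn_integral_cmult) simp_all
  also have "\<dots> = mass w"
    unfolding mass_def using A
    by (intro nn_integral_cong) (simp add: mass_density_nonneg flip: ennreal_mult)
  finally show ?thesis ..
qed

text \<open>The double integral needs no control of the means of the approximating functions.\<close>
lemma weak_poincare:
  fixes u :: "real ^ 'n \<Rightarrow> real"
  assumes d: "CARD('n) \<ge> 2" and ug: "weak_gradient u g"
    and g2: "(\<integral>\<^sup>+y. ennreal ((norm (g y))\<^sup>2) \<partial>lborel) < \<infinity>"
    and E: "energy g = ennreal E" "0 \<le> E"
  shows "(\<integral>\<^sup>+x. (\<integral>\<^sup>+y. ennreal ((u x - u y)\<^sup>2) \<partial>mass_measure) \<partial>mass_measure) \<le>
    ennreal (2 * (E / sphere_measure (sphere (0 :: real ^ 'n) 1)))"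
proof -
  let ?A = "sphere_measure (sphere (0 :: real ^ 'n) 1)"
  let ?N = "mass_measure :: (real ^ 'n) measure"
  let ?D = "\<lambda>w. \<integral>\<^sup>+x. (\<integral>\<^sup>+y. ennreal ((w x - w y)\<^sup>2) \<partial>?N) \<partial>?N"
  note A = onofri_const_eq(2)[OF d]
  have N1: "emeasure ?N (space ?N) = 1" by (rule emeasure_mass_measure[OF d])
  interpret finite_measure ?N by (rule finite_measureI) (simp add: N1)
  have N1': "measure ?N (space ?N) = 1" by (simp add: measure_def N1)
  have sN [measurable_cong, simp]: "sets ?N = sets borel" by (simp add: mass_measure_def)
  have u: "loc_integrable u" and [measurable]: "u \<in> borel_measurable borel" "g \<in> borel_measurable borel"
    and gi: "loc_integrable (\<lambda>x. g x $ i)" for i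
    using ug by (auto simp: weak_gradient_def loc_integrable_def)
  define k where "k n = 1 / (real n + 1)" for n :: nat
  have k: "0 < k n" for n by (simp add: k_def)
  have k0: "k \<longlonglongrightarrow> 0"
    using LIMSEQ_inverse_real_of_nat by (simp add: k_def[abs_def] inverse_eq_divide add.commute)
  \<comment> \<open>One radius for both approximations at stage n, with the ball growing with
    n.\<close>
  have "\<exists>e>0. energy (mollify_grad e g) \<le> energy g + ennreal (k n) \<and>
    (\<integral>\<^sup>+x. ennreal \<bar>mollify e u x - u x\<bar> * indicator (cball 0 (real n)) x \<partial>lborel) \<le> ennreal (k n)" for n
  proof -
    obtain e1 where e1: "e1 > 0" "\<And>e. 0 < e \<Longrightarrow> e < e1 \<Longrightarrow> energy (mollify_grad e g) \<le> energy g + ennreal (k n)"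
      using energy_mollify_grad_limit[OF d _ gi g2 k[of n]] by auto
    obtain e2 where e2: "e2 > 0" "\<And>e. 0 < e \<Longrightarrow> e < e2 \<Longrightarrow> (\<integral>\<^sup>+x. ennreal \<bar>mollify e u x - u x\<bar> * indicator (cball 0 (real n)) x \<partial>lborel) \<le> ennreal (k n)"
      using mollify_L1[OF u k[of n], of "real n"] by blast
    show ?thesis
      using e1(1) e2(1) by (intro exI[of _ "min e1 e2 / 2"] conjI e1(2) e2(2)) auto
  qed
  then have "\<forall>n. \<exists>e. 0 < e \<and> energy (mollify_grad e g) \<le> energy g + ennreal (k n) \<and>
    (\<integral>\<^sup>+x. ennreal \<bar>mollify e u x - u x\<bar> * indicator (cball 0 (real n)) x \<partial>lborel) \<le> ennreal (k n)" by blast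
  from choice[OF this] obtain e where e: "\<And>n. 0 < e n" "\<And>n. energy (mollify_grad (e n) g) \<le> energy g + ennreal (k n)"
    "\<And>n. (\<integral>\<^sup>+x. ennreal \<bar>mollify (e n) u x - u x\<bar> * indicator (cball 0 (real n)) x \<partial>lborel) \<le> ennreal (k n)"
    by blast
  define v where "v n = mollify (e n) u" for n
  have [measurable]: "v n \<in> borel_measurable borel" for n
    unfolding v_def by (intro borel_measurable_continuous_onI continuous_mollify e u)
  \<comment> \<open>The bound of \<open>smooth_poincare\<close> with eta = \<open>k n\<close>, as a
    real number; it tends to E.\<close>
  define B where "B n = (1 + k n) * (E + k n) + k n" for n
  have Dv: "?D (v n) \<le> ennreal (2 * (B n / ?A))" for n
  proof -
    have "has_gradient (v n) (mollify_grad (e n) g)" unfolding v_def by (rule has_gradient_mollify[OF e(1) ug])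
    from smooth_poincare[OF d this k[of n]] obtain c
      where "mass (\<lambda>x. v n x - c) \<le> ennreal (1 + k n) * energy (mollify_grad (e n) g) + ennreal (k n)" by blast
    also have "\<dots> \<le> ennreal (1 + k n) * (ennreal E + ennreal (k n)) + ennreal (k n)"
      using e(2)[of n] unfolding E(1) by (intro add_mono mult_left_mono) auto
    also have "\<dots> = ennreal (B n)"
      using k[of n] E(2) unfolding B_def
      by (simp add: ennreal_plus[symmetric] ennreal_mult[symmetric] del: ennreal_plus)
    finally have m: "ennreal ?A * (\<integral>\<^sup>+x. ennreal ((v n x - c)\<^sup>2) \<partial>?N) \<le> ennreal (B n)"
      by (subst (asm) mass_eq_mass_measure[OF d]) simp_all
    have fin: "(\<integral>\<^sup>+x. ennreal ((v n x - c)\<^sup>2) \<partial>?N) < \<infinity>"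
    proof (rule ccontr)
      assume "\<not> ?thesis"
      then have "(\<integral>\<^sup>+x. ennreal ((v n x - c)\<^sup>2) \<partial>?N) = top" by (simp add: not_less top_unique)
      with m A show False by (simp add: ennreal_mult_top top_unique)
    qed
    then obtain i where i: "(\<integral>\<^sup>+x. ennreal ((v n x - c)\<^sup>2) \<partial>?N) = ennreal i" "0 \<le> i"
      by (cases "\<integral>\<^sup>+x. ennreal ((v n x - c)\<^sup>2) \<partial>?N") auto
    have "0 \<le> B n" using k[of n] E(2) by (simp add: B_def)
    then have "?A * i \<le> B n" using m i A by (simp add: ennreal_mult[symmetric] ennreal_le_iff)
    then have "2 * i \<le> 2 * (B n / ?A)" using A by (simp add: field_simps)
    have "?D (v n) \<le> 2 * (\<integral>\<^sup>+x. ennreal ((v n x - c)\<^sup>2) \<partial>?N)"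
      by (rule nn_integral_pairwise_difference_le[OF N1' _ fin]) simp
    also have "\<dots> = ennreal (2 * i)" using i by (simp add: ennreal_mult)
    also have "\<dots> \<le> ennreal (2 * (B n / ?A))" by (rule ennreal_leI) fact
    finally show ?thesis .
  qed
  \<comment> \<open>The cutoff turns local convergence into convergence in L1 of the whole space,
    from which an almost everywhere convergent subsequence is extracted.\<close>
  define w where "w n x = indicator (cball 0 (real n)) x * (v n x - u x)" for n x
  have [measurable]: "cball (0 :: real ^ 'n) (real n) \<in> sets borel" for n by simp
  have [measurable]: "w n \<in> borel_measurable borel" for n unfolding w_def[abs_def] by measurable
  have wn: "(\<integral>\<^sup>+x. ennreal (norm (w n x)) \<partial>lborel) \<le> ennreal (k n)" for n
  proof -
    have "(\<integral>\<^sup>+x. ennreal (norm (w n x)) \<partial>lborel) = (\<integral>\<^sup>+x. ennreal \<bar>v n x - u x\<bar> * indicator (cball 0 (real n)) x \<partial>lborel)"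
      by (intro nn_integral_cong) (simp add: w_def indicator_def)
    then show ?thesis using e(3)[of n] by (simp add: v_def)
  qed
  have wi: "integrable lborel (w n)" for n
    by (rule integrableI_bounded) (use wn[of n] in \<open>auto intro: order.strict_trans1\<close>)
  have wk: "(LINT x|lborel. norm (w n x)) \<le> k n" for n
  proof -
    have "ennreal (LINT x|lborel. norm (w n x)) \<le> ennreal (k n)"
      using wn[of n] nn_integral_eq_integral[OF integrable_norm[OF wi[of n]]] by simp
    then show ?thesis using k[of n] by (simp add: ennreal_le_iff)
  qed
  have "(\<lambda>n. LINT x|lborel. norm (w n x)) \<longlonglongrightarrow> 0"
    by (rule tendsto_sandwich[OF _ _ tendsto_const k0])
       (intro always_eventually allI wk Bochner_Integration.integral_nonneg norm_ge_zero)+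
  from tendsto_L1_AE_subseq[OF wi this]
  obtain r where r: "strict_mono r" "AE x in lborel. (\<lambda>n. indicator (cball 0 (real (r n))) x * (v (r n) x - u x)) \<longlonglongrightarrow> 0"
    unfolding w_def by blast
  have "AE x in lborel. (\<lambda>n. v (r n) x) \<longlonglongrightarrow> u x"
    using r(2)
  proof eventually_elim
    fix x assume x: "(\<lambda>n. indicator (cball 0 (real (r n))) x * (v (r n) x - u x)) \<longlonglongrightarrow> 0"
    \<comment> \<open>At a fixed point x the cutoff equals 1 from some index on.\<close>
    obtain M :: nat where M: "norm x \<le> real M" using real_arch_simple by blast
    have "\<forall>\<^sub>F n in sequentially. indicator (cball 0 (real (r n))) x * (v (r n) x - u x) = v (r n) x - u x"
    proof (rule eventually_sequentiallyI[of M])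
      fix n assume "M \<le> n"
      then have "real M \<le> real (r n)" using seq_suble[OF r(1), of n] by linarith
      then show "indicator (cball 0 (real (r n))) x * (v (r n) x - u x) = v (r n) x - u x" using M by simp
    qed
    from Lim_transform_eventually[OF x this] show "(\<lambda>n. v (r n) x) \<longlonglongrightarrow> u x"
      by (rule LIM_zero_cancel)
  qed
  then have ae: "AE x in ?N. (\<lambda>n. v (r n) x) \<longlonglongrightarrow> u x"
    unfolding mass_measure_def by (subst AE_density) auto
  have "?D u \<le> liminf (\<lambda>n. ?D (v (r n)))"
    by (rule nn_integral_pairwise_difference_liminf[OF _ _ _ ae]) (simp_all add: sigma_finite_measure_axioms)
  also have "\<dots> \<le> liminf (\<lambda>n. ennreal (2 * (B (r n) / ?A)))"
    by (intro Liminf_mono always_eventually allI Dv)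
  also have "\<dots> = ennreal (2 * (E / ?A))"
  proof (rule lim_imp_Liminf[OF sequentially_bot])
    have "B \<longlonglongrightarrow> (1 + 0) * (E + 0) + 0" unfolding B_def[abs_def] by (intro tendsto_intros k0)
    then have "(\<lambda>n. B (r n)) \<longlonglongrightarrow> E" using LIMSEQ_subseq_LIMSEQ[OF _ r(1), of B E] by (simp add: o_def)
    then show "(\<lambda>n. ennreal (2 * (B (r n) / ?A))) \<longlonglongrightarrow> ennreal (2 * (E / ?A))"
      using A by (intro tendsto_ennrealI tendsto_intros) auto
  qed
  finally show ?thesis .
qed

text \<open>The two densities differ at most at the origin and f, f0 on a null set, so the weighted
  integrands agree almost everywhere; integrals of Borel functions do not change under
  completion.\<close>

lemma onofri_measure_transfer:
  fixes f f0 :: "real ^ 'n \<Rightarrow> real"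
  assumes d: "CARD('n) \<ge> 2" and f: "f \<in> borel_measurable lebesgue" and f0[measurable]: "f0 \<in> borel_measurable borel"
    and ae: "AE x in lebesgue. f x = f0 x"
  shows "integrable onofri_measure f \<longleftrightarrow> integrable mass_measure f0"
    "(LINT x|onofri_measure. f x) = (LINT x|mass_measure. f0 x)"
proof -
  let ?A = "sphere_measure (sphere (0 :: real ^ 'n) 1)"
  note A = onofri_const_eq(2)[OF d]
  define D where "D x = real CARD('n) / ?A * (1 / (1 + norm x powr (real CARD('n) / (real CARD('n) - 1))) ^ CARD('n))" for x :: "real ^ 'n"
  define M where "M x = mass_density x / ?A" for x :: "real ^ 'n"
  have Dm[measurable]: "D \<in> borel_measurable borel" unfolding D_def[abs_def] by measurable
  have Mm[measurable]: "M \<in> borel_measurable borel" unfolding M_def[abs_def] by measurable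
  have leb: "h \<in> borel_measurable lebesgue" if "h \<in> borel_measurable borel" for h :: "real ^ 'n \<Rightarrow> real"
    using that by (intro measurable_completion) simp
  have Dl: "D \<in> borel_measurable lebesgue" "M \<in> borel_measurable lebesgue" "f0 \<in> borel_measurable lebesgue"
    by (rule leb[OF Dm] leb[OF Mm] leb[OF f0])+
  have D0: "0 \<le> D x" for x using A by (simp add: D_def add_nonneg_nonneg)
  have M0: "0 \<le> M x" for x using A by (simp add: M_def mass_density_nonneg)
  have DM: "AE x in lebesgue. D x *\<^sub>R f x = M x *\<^sub>R f0 x"
  proof -
    have "AE x :: real ^ 'n in lebesgue. x \<noteq> 0" by (intro AE_completion AE_lborel_singleton)
    then show ?thesis using ae
      by eventually_elim (simp add: D_def M_def mass_density_eq[OF d])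
  qed
  have "integrable onofri_measure f \<longleftrightarrow> integrable lebesgue (\<lambda>x. D x *\<^sub>R f x)"
    unfolding onofri_measure_def D_def[symmetric] by (intro integrable_density f Dl AE_I2 D0)
  also have "\<dots> \<longleftrightarrow> integrable lebesgue (\<lambda>x. M x *\<^sub>R f0 x)"
    by (intro integrable_cong_AE borel_measurable_scaleR f Dl DM)
  also have "\<dots> \<longleftrightarrow> integrable lborel (\<lambda>x. M x *\<^sub>R f0 x)" by (rule integrable_completion) simp
  also have "\<dots> \<longleftrightarrow> integrable mass_measure f0"
    unfolding mass_measure_def M_def[symmetric] by (intro integrable_density[symmetric] AE_I2 M0) measurable
  finally show "integrable onofri_measure f \<longleftrightarrow> integrable mass_measure f0" .
  have "(LINT x|onofri_measure. f x) = (LINT x|lebesgue. D x *\<^sub>R f x)"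
    unfolding onofri_measure_def D_def[symmetric] by (intro integral_density f Dl AE_I2 D0)
  also have "\<dots> = (LINT x|lebesgue. M x *\<^sub>R f0 x)"
    by (intro integral_cong_AE borel_measurable_scaleR f Dl DM)
  also have "\<dots> = (LINT x|lborel. M x *\<^sub>R f0 x)" by (rule integral_completion) simp
  also have "\<dots> = (LINT x|mass_measure. f0 x)"
    unfolding mass_measure_def M_def[symmetric] by (intro integral_density[symmetric] AE_I2 M0) measurable
  finally show "(LINT x|onofri_measure. f x) = (LINT x|mass_measure. f0 x)" .
qed

lemma loc_integrable_of_absolutely_integrable:
  fixes f f0 :: "real ^ 'n \<Rightarrow> real"
  assumes f: "\<And>K. compact K \<Longrightarrow> f absolutely_integrable_on K" and f0[measurable]: "f0 \<in> borel_measurable borel"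
    and ae: "AE x in lebesgue. f x = f0 x"
  shows "loc_integrable f0"
  unfolding loc_integrable_def
proof (intro conjI allI)
  fix r
  have [measurable]: "cball (0 :: real ^ 'n) r \<in> sets borel" by simp
  have i: "integrable lebesgue (\<lambda>x. indicator (cball 0 r) x *\<^sub>R f x)"
    using f[of "cball 0 r"] by (simp add: set_integrable_def)
  have m: "(\<lambda>x. indicator (cball 0 r) x * f0 x) \<in> borel_measurable lborel" by measurable
  have "integrable lebesgue (\<lambda>x. indicator (cball 0 r) x * f0 x)"
    by (rule integrable_cong_AE_imp[OF i]) (use ae in \<open>auto intro: measurable_completion[OF m]\<close>)
  then show "integrable lborel (\<lambda>y. indicator (cball 0 r) y * f0 y)"
    by (subst (asm) integrable_completion) (use m in auto)
qed simp

lemma test_function_measurable: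
  assumes "test_function f"
  shows "f \<in> borel_measurable borel" "(\<lambda>x. frechet_derivative f (at x) h) \<in> borel_measurable borel"
proof -
  have "Ck_fun 0 f" "Ck_fun (Suc 0) f" using assms unfolding test_function_def by blast+
  then show "f \<in> borel_measurable borel" "(\<lambda>x. frechet_derivative f (at x) h) \<in> borel_measurable borel"
    by (auto intro!: borel_measurable_continuous_onI)
qed

theorem corollary2p1:
  fixes v :: "real ^ 'n \<Rightarrow> real" and g :: "real ^ 'n \<Rightarrow> real ^ 'n"
  assumes "CARD('n) \<ge> 2"
    and "integrable onofri_measure v"
    and "distributional_gradient v g"
    and "L2_field g"
  shows "let vbar = (LINT x|onofri_measure. v x) in
           integrable onofri_measure (\<lambda>x. \<bar>v x - vbar\<bar>\<^sup>2) \<and>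
           integrable lebesgue (\<lambda>x. Gform x (g x)) \<and>
           (LINT x|onofri_measure. \<bar>v x - vbar\<bar>\<^sup>2)
             \<le> onofri_const CARD('n) * (LINT x|lebesgue. Gform x (g x))"
proof -
  note d = assms(1)
  let ?A = "sphere_measure (sphere (0 :: real ^ 'n) 1)"
  let ?N = "mass_measure :: (real ^ 'n) measure"
  note A = onofri_const_eq(2)[OF d]
  have leb: "h \<in> borel_measurable lebesgue" if "h \<in> borel_measurable borel" for h :: "real ^ 'n \<Rightarrow> real"
    using that by (intro measurable_completion) simp
  have vm: "v \<in> borel_measurable lebesgue"
    using borel_measurable_integrable[OF assms(2)] by (simp add: onofri_measure_def)
  have gm: "g \<in> borel_measurable lebesgue" using assms(4) by (simp add: L2_field_def)
  have gim: "(\<lambda>x. g x $ i) \<in> borel_measurable lebesgue" for i by (rule measurable_vec_nth[OF gm])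
  \<comment> \<open>Borel representatives of v and of g; every hypothesis is an integral statement
    and passes to them.\<close>
  obtain v0 where v0[measurable]: "v0 \<in> borel_measurable borel" and "AE x in lborel. v x = v0 x"
    using completion_ex_borel_measurable_real[OF vm] by auto
  then have vae: "AE x in lebesgue. v x = v0 x" by (intro AE_completion)
  have "\<forall>i. \<exists>h. h \<in> borel_measurable borel \<and> (AE x in lborel. g x $ i = h x)"
    using completion_ex_borel_measurable_real[OF gim] by auto
  from choice[OF this] obtain h where h[measurable]: "\<And>i. h i \<in> borel_measurable borel" and hae: "\<And>i. AE x in lborel. g x $ i = h i x"
    by blast
  define g0 where "g0 x = (\<chi> i. h i x)" for x
  have g0i: "g0 x $ i = h i x" for x i by (simp add: g0_def)
  \<comment> \<open>As a finite sum over the coordinates the field inherits measurability from its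
    components.\<close>
  have g0e: "g0 = (\<lambda>x. \<Sum>i\<in>UNIV. h i x *\<^sub>R axis i 1)"
    by (auto simp: fun_eq_iff vec_eq_iff g0_def axis_def if_distrib cong: if_cong)
  have g0[measurable]: "g0 \<in> borel_measurable borel"
    unfolding g0e by measurable
  have "AE x in lborel. \<forall>i. g x $ i = h i x" by (subst AE_all_countable) (simp add: hae)
  then have gae: "AE x in lebesgue. g x = g0 x"
    by (intro AE_completion) (auto simp: vec_eq_iff g0_def elim: eventually_mono)
  have gaei: "AE x in lebesgue. g x $ i = g0 x $ i" for i using gae by eventually_elim simp
  have ug: "weak_gradient v0 g0"
    unfolding weak_gradient_def
  proof (intro conjI allI impI)
    show "loc_integrable v0"
      using assms(3) by (intro loc_integrable_of_absolutely_integrable[OF _ v0 vae]) (auto simp: distributional_gradient_def)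
    show "loc_integrable (\<lambda>x. g0 x $ i)" for i
    proof (rule loc_integrable_of_absolutely_integrable[OF _ _ gaei])
      fix K :: "(real ^ 'n) set" assume "compact K"
      then have "g absolutely_integrable_on K" using assms(3) by (auto simp: distributional_gradient_def)
      then show "(\<lambda>x. g x $ i) absolutely_integrable_on K"
        using absolutely_integrable_component[where b="axis i 1"] by (fastforce simp: inner_axis)
    qed measurable
    fix f :: "real ^ 'n \<Rightarrow> real" and i assume f: "test_function f"
    note [measurable] = test_function_measurable[OF f]
    have "(LINT x|lborel. v0 x * frechet_derivative f (at x) (axis i 1)) = (LINT x|lebesgue. v0 x * frechet_derivative f (at x) (axis i 1))"
      by (rule integral_completion[symmetric]) measurable
    also have "\<dots> = (LINT x|lebesgue. v x * frechet_derivative f (at x) (axis i 1))"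
      using vae by (intro integral_cong_AE borel_measurable_times vm leb) auto
    also have "\<dots> = - (LINT x|lebesgue. g x $ i * f x)"
      using assms(3) f unfolding distributional_gradient_def by blast
    also have "(LINT x|lebesgue. g x $ i * f x) = (LINT x|lebesgue. g0 x $ i * f x)"
      using gaei[of i] by (intro integral_cong_AE borel_measurable_times gim leb) auto
    also have "\<dots> = (LINT x|lborel. g0 x $ i * f x)"
      by (rule integral_completion) measurable
    finally show "(LINT x|lborel. v0 x * frechet_derivative f (at x) (axis i 1)) = - (LINT x|lborel. g0 x $ i * f x)" .
  qed (rule g0)
  have g02: "integrable lborel (\<lambda>x. (norm (g0 x))\<^sup>2)"
  proof -
    have i: "integrable lebesgue (\<lambda>x. (norm (g x))\<^sup>2)" using assms(4) by (simp add: L2_field_def)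
    have b: "(\<lambda>x. (norm (g0 x))\<^sup>2) \<in> borel_measurable borel" by measurable
    have "AE x in lebesgue. (norm (g x))\<^sup>2 = (norm (g0 x))\<^sup>2" using gae by eventually_elim simp
    from integrable_cong_AE_imp[OF i leb[OF b] this]
    have "integrable lebesgue (\<lambda>x. (norm (g0 x))\<^sup>2)" .
    then show ?thesis by (subst (asm) integrable_completion) auto
  qed
  then have g2: "(\<integral>\<^sup>+y. ennreal ((norm (g0 y))\<^sup>2) \<partial>lborel) < \<infinity>"
    by (subst nn_integral_eq_integral) auto
  have em: "(\<lambda>x. energy_density x (g0 x)) \<in> borel_measurable borel"
    by (intro measurable_energy_density) simp_all
  have ei: "integrable lborel (\<lambda>x. energy_density x (g0 x))"
  proof (rule Bochner_Integration.integrable_bound[OF g02])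
    show "AE x in lborel. norm (energy_density x (g0 x)) \<le> norm ((norm (g0 x))\<^sup>2)"
      using AE_lborel_singleton[of "0 :: real ^ 'n"]
      by eventually_elim (simp add: energy_density_nonneg[OF d] energy_density_le[OF d])
  qed (use em in simp)
  define E where "E = (LINT x|lborel. energy_density x (g0 x))"
  have E: "energy g0 = ennreal E" "0 \<le> E"
    unfolding energy_def E_def using ei
    by (auto intro!: nn_integral_eq_integral Bochner_Integration.integral_nonneg simp: energy_density_nonneg[OF d])
  have N1: "emeasure ?N (space ?N) = 1" by (rule emeasure_mass_measure[OF d])
  interpret finite_measure ?N by (rule finite_measureI) (simp add: N1)
  have N1': "measure ?N (space ?N) = 1" by (simp add: measure_def N1)
  have iv0: "integrable ?N v0" using onofri_measure_transfer(1)[OF d vm v0 vae] assms(2) by simp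
  define m where "m = (LINT x|onofri_measure. v x)"
  have m: "m = (LINT x|?N. v0 x)" unfolding m_def by (rule onofri_measure_transfer(2)[OF d vm v0 vae])
  \<comment> \<open>Here the mean enters for the first time; the estimate up to this point concerns
    pairwise differences.\<close>
  note var = variance_le_of_pairwise_difference[OF N1' iv0 weak_poincare[OF d ug g2 E], folded m]
  have EA: "0 \<le> E / ?A" using E A by simp
  have t: "(\<lambda>x. \<bar>v x - m\<bar>\<^sup>2) \<in> borel_measurable lebesgue" "(\<lambda>x. (v0 x - m)\<^sup>2) \<in> borel_measurable borel"
    "AE x in lebesgue. \<bar>v x - m\<bar>\<^sup>2 = (v0 x - m)\<^sup>2"
    using vm vae by (auto elim: eventually_mono)
  let ?C = "real CARD('n) ^ (CARD('n) - 1) * (real CARD('n) - 1)"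
  have Gae: "AE x in lebesgue. ?C * energy_density x (g0 x) = Gform x (g x)"
  proof -
    have "AE x :: real ^ 'n in lebesgue. x \<noteq> 0" by (intro AE_completion AE_lborel_singleton)
    then show ?thesis using gae by eventually_elim (simp add: Gform_eq[OF d])
  qed
  have iG: "has_bochner_integral lebesgue (\<lambda>x. Gform x (g x)) (?C * E)"
  proof -
    have "has_bochner_integral lborel (\<lambda>x. ?C * energy_density x (g0 x)) (?C * E)"
      using ei by (intro has_bochner_integral_mult_right) (simp add: has_bochner_integral_iff E_def)
    then have hb: "has_bochner_integral lebesgue (\<lambda>x. ?C * energy_density x (g0 x)) (?C * E)"
      using em by (simp add: has_bochner_integral_iff integrable_completion integral_completion)
    have mG: "(\<lambda>x. Gform x (g x)) \<in> borel_measurable lebesgue"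
      by (rule borel_measurable_AE[OF leb Gae]) (use em in simp)
    show ?thesis
      by (rule iffD1[OF has_bochner_integral_cong_AE[OF borel_measurable_has_bochner_integral[OF hb] mG Gae] hb])
  qed
  have "onofri_const CARD('n) * (?C * E) = E / ?A"
    using onofri_const_eq(1)[OF d] by (simp flip: mult.assoc)
  moreover have "integrable onofri_measure (\<lambda>x. \<bar>v x - m\<bar>\<^sup>2)" "(LINT x|onofri_measure. \<bar>v x - m\<bar>\<^sup>2) \<le> E / ?A"
    using onofri_measure_transfer[OF d t] var[OF EA] by simp_all
  ultimately show ?thesis
    using iG unfolding Let_def m_def[symmetric] has_bochner_integral_iff by simp
qed

end
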